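(* Suppose that for each $n$ the alternative $H_{1n}(\rho)$ holds, i.e. the innovations $\{\varepsilon_t\}$ are i.i.d. with distribution function $A_n(x)=(1-\rho_n)G_0(x)+\rho_nH(x)$, $\rho_n=\min(1,\rho n^{-1/2})$. Suppose that random variables with distribution functions $G_0$ and $H$ have zero means and finite variances, that $G_0$ and $H$ are twice differentiable with bounded second derivatives, and that $G_0$ is symmetric about zero. Let $\hat\mu_n$ and $\hat{\boldsymbol{\beta}}_n$ be any estimators such that $n^{1/2}(\hat\mu_n-\mu)=O_P(1)$ and $n^{1/2}(\hat{\boldsymbol{\beta}}_n-\boldsymbol{\beta})=O_P(1)$ as $n\to\infty$ under $H_{1n}(\rho)$, uniformly in $\gamma\le\Gamma$, $\rho\le R$, for any finite $\Gamma,R\ge0$. Then for all finite $\Gamma\ge0$, $R\ge0$, every $x\in\mathbb{R}$ and every $\delta>0$, $$ \sup_{0\le\gamma\le\Gamma,\;0\le\rho\le R}\mathsf{P}\Big(\big|n^{1/2}[\hat S_n(x)-S_n(x)]-\gamma\Delta_S(x,\Pi)\big|>\delta\Big)\to0,\qquad n\to\infty, $$ where $$ \Delta_S(x,\Pi)=\frac{\Delta(x,\Pi)-\Delta(-x,\Pi)}{2},\qquad \Delta(x,\Pi)=\sum_{j=0}^p\big[\mathsf{E}\,G_0(x+\beta_j\xi_1)-G_0(x)\big],\quad\beta_0=-1. $$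
   Context: Model. Fix $p\ge1$, $\boldsymbol{\beta}=(\beta_1,\dots,\beta_p)^T\in\mathbb{R}^p$ such that all roots of the characteristic equation $\lambda^p-\beta_1\lambda^{p-1}-\dots-\beta_p=0$ are less than one in modulus, and $\nu\in\mathbb{R}$. Let $\{v_t\}_{t\in\mathbb{Z}}$ be the stationary solution of $v_t=\beta_1v_{t-1}+\dots+\beta_pv_{t-p}+\nu+\varepsilon_t$, where the innovations $\{\varepsilon_t\}$ are i.i.d. with zero mean and finite positive variance. Let $\mu$ be defined by $\nu=(1-\beta_1-\dots-\beta_p)\mu$. Outliers. $\{z_t^{\gamma_n}\}$ are i.i.d. random variables taking value $1$ with probability $\gamma_n=\min(1,\gamma n^{-1/2})$ and $0$ with probability $1-\gamma_n$, where $\gamma\ge0$; $\{\xi_t\}$ are i.i.d. with an arbitrary distribution $\Pi$ on $\mathbb{R}$. The sequences $\{\varepsilon_t\}$, $\{z_t^{\gamma_n}\}$, $\{\xi_t\}$ are mutually independent. The observations are $y_t=v_t+z_t^{\gamma_n}\xi_t$, $t=1-p,\dots,n$. $G_0$ and $H$ are fixed distribution functions, $\rho\ge0$. Under $H_{1n}(\rho)$ the innovations (hence $v_t$) depend on $n$ through their distribution $A_n$; $\mathsf{P}$ is the probability in the model with parameters $n,\gamma,\rho$. Symmetry of $G_0$ about zero means $G_0(-x)=1-G_0(x)$ for all $x$. Estimators and residuals. $\hat\mu_n$ is a real-valued and $\hat{\boldsymbol{\beta}}_n=(\hat\beta_{1n},\dots,\hat\beta_{pn})^T$ an $\mathbb{R}^p$-valued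 sequence of estimators constructed from the observations. "$X_n=O_P(1)$ uniformly in $\gamma\le\Gamma,\rho\le R$" means $\lim_{C\to\infty}\limsup_{n\to\infty}\sup_{0\le\gamma\le\Gamma,0\le\rho\le R}\mathsf{P}(|X_n|>C)=0$. Put $\hat u_t=y_t-\hat\mu_n$ for $t=1-p,\dots,n$, and define the residuals $\hat\varepsilon_t=\hat u_t-\hat\beta_{1n}\hat u_{t-1}-\dots-\hat\beta_{pn}\hat u_{t-p}$, $t=1,\dots,n$. With $I(\cdot)$ the indicator of an event, $$\hat G_n(x)=n^{-1}\sum_{t=1}^nI(\hat\varepsilon_t\le x),\qquad G_n(x)=n^{-1}\sum_{t=1}^nI(\varepsilon_t\le x),$$ and the symmetrized versions are $$\hat S_n(x)=\frac{\hat G_n(x)+1-\hat G_n(-x)}{2},\qquad S_n(x)=\frac{G_n(x)+1-G_n(-x)}{2}.$$ *)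

theory Defs
  imports "HOL-Probability.Probability"
begin

text \<open>Vectors of \<open>\<real>\<^sup>p\<close> are functions on \<open>nat\<close> of which only the values at \<open>1, \<dots>, p\<close> matter.\<close>

definition strictly_stationary :: "'a measure \<Rightarrow> (int \<Rightarrow> 'a \<Rightarrow> real) \<Rightarrow> bool" where
  "strictly_stationary M X \<longleftrightarrow>
     (\<forall>h. distr M (PiM UNIV (\<lambda>_. borel)) (\<lambda>\<omega> t. X (t + h) \<omega>) =
          distr M (PiM UNIV (\<lambda>_. borel)) (\<lambda>\<omega> t. X t \<omega>))"

text \<open>
  The model for one sample size \<open>n\<close>. \<open>A\<close> is the distribution function of the innovations \<open>\<epsilon>\<close>,
  \<open>q\<close> the contamination probability, and \<open>P\<^sub>\<xi>\<close> the distribution of the outlier sizes \<open>\<xi>\<close>.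
  When all roots of the characteristic equation are less than one in modulus, \<open>stationary\<close> and
  \<open>recursion\<close> determine \<open>v\<close> up to null sets.
\<close>

locale outlier_ar_model = prob_space M
  for M :: "'a measure" +
  fixes p :: nat and \<beta> :: "nat \<Rightarrow> real" and \<nu> :: real
    and A :: "real \<Rightarrow> real" and q :: real and P\<^sub>\<xi> :: "real measure" and n :: nat
    and \<epsilon> z \<xi> v y :: "int \<Rightarrow> 'a \<Rightarrow> real"
  assumes innovations_indep: "indep_vars (\<lambda>_. borel) \<epsilon> UNIV"
    and innovations_cdf: "\<And>t x. cdf (distr M borel (\<epsilon> t)) x = A x"
    and innovations_mean: "\<And>t. integrable M (\<epsilon> t)" "\<And>t. expectation (\<epsilon> t) = 0"
    and innovations_variance: "\<And>t. integrable M (\<lambda>\<omega>. (\<epsilon> t \<omega>)\<^sup>2)" "\<And>t. variance (\<epsilon> t) > 0"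
    and indicators_indep: "indep_vars (\<lambda>_. borel) z UNIV"
    and indicators_law: "\<And>t. prob {\<omega> \<in> space M. z t \<omega> = 1} = q"
        "\<And>t. prob {\<omega> \<in> space M. z t \<omega> = 0} = 1 - q"
    and outliers_indep: "indep_vars (\<lambda>_. borel) \<xi> UNIV"
    and outliers_law: "\<And>t. distr M borel (\<xi> t) = P\<^sub>\<xi>"
    and sequences_indep:
        "indep_vars (\<lambda>_. PiM UNIV (\<lambda>_. borel)) (\<lambda>k \<omega> t. ([\<epsilon>, z, \<xi>] ! k) t \<omega>) {..<3::nat}"
    and solution_measurable: "\<And>t. random_variable borel (v t)"
    and stationary: "strictly_stationary M v"
    and recursion:
        "\<And>t. AE \<omega> in M. v t \<omega> = (\<Sum>j=1..p. \<beta> j * v (t - int j) \<omega>) + \<nu> + \<epsilon> t \<omega>"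
    and observations:
        "\<And>t \<omega>. t \<in> {1 - int p..int n} \<Longrightarrow> \<omega> \<in> space M \<Longrightarrow> y t \<omega> = v t \<omega> + z t \<omega> * \<xi> t \<omega>"

definition local_rate :: "real \<Rightarrow> nat \<Rightarrow> real" where
  "local_rate c n = min 1 (c / sqrt (real n))"

definition mixture_df :: "(real \<Rightarrow> real) \<Rightarrow> (real \<Rightarrow> real) \<Rightarrow> real \<Rightarrow> real \<Rightarrow> real" where
  "mixture_df G H r x = (1 - r) * G x + r * H x"

definition centered_finite_variance :: "real measure \<Rightarrow> bool" where
  "centered_finite_variance D \<longleftrightarrow>
     integrable D (\<lambda>x. x) \<and> (\<integral>x. x \<partial>D) = 0 \<and> integrable D (\<lambda>x. x\<^sup>2)"

definition twice_diff_bounded :: "(real \<Rightarrow> real) \<Rightarrow> bool" where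
  "twice_diff_bounded F \<longleftrightarrow>
     (\<forall>x. F differentiable (at x)) \<and> (\<forall>x. deriv F differentiable (at x)) \<and>
     bounded (range (deriv (deriv F)))"

definition sample :: "nat \<Rightarrow> nat \<Rightarrow> (int \<Rightarrow> 'a \<Rightarrow> real) \<Rightarrow> 'a \<Rightarrow> (int \<Rightarrow> real)" where
  "sample p n y \<omega> = (\<lambda>t\<in>{1 - int p..int n}. y t \<omega>)"

definition statistic :: "nat \<Rightarrow> nat \<Rightarrow> ((int \<Rightarrow> real) \<Rightarrow> real) \<Rightarrow> bool" where
  "statistic p n T \<longleftrightarrow> T \<in> borel_measurable (PiM {1 - int p..int n} (\<lambda>_. borel))"

text \<open>
  Probabilities are taken as \<open>emeasure\<close> so that the suprema and the limes superior live in the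
  complete lattice \<open>ennreal\<close>. The triple index of \<open>M\<close> and \<open>X\<close> is \<open>n\<close>, \<open>\<gamma>\<close>, \<open>\<rho>\<close>.
\<close>

definition sup_prob ::
  "(nat \<Rightarrow> real \<Rightarrow> real \<Rightarrow> 'a measure) \<Rightarrow> (nat \<Rightarrow> real \<Rightarrow> real \<Rightarrow> 'a \<Rightarrow> real) \<Rightarrow>
    real \<Rightarrow> real \<Rightarrow> real \<Rightarrow> nat \<Rightarrow> ennreal" where
  "sup_prob M X \<Gamma> R C n =
     (SUP (\<gamma>, \<rho>)\<in>{0..\<Gamma>} \<times> {0..R}.
        emeasure (M n \<gamma> \<rho>) {\<omega> \<in> space (M n \<gamma> \<rho>). \<bar>X n \<gamma> \<rho> \<omega>\<bar> > C})"

definition unif_OP1 ::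
  "(nat \<Rightarrow> real \<Rightarrow> real \<Rightarrow> 'a measure) \<Rightarrow> (nat \<Rightarrow> real \<Rightarrow> real \<Rightarrow> 'a \<Rightarrow> real) \<Rightarrow>
    real \<Rightarrow> real \<Rightarrow> bool" where
  "unif_OP1 M X \<Gamma> R \<longleftrightarrow> ((\<lambda>C. limsup (sup_prob M X \<Gamma> R C)) \<longlongrightarrow> 0) at_top"

definition residual :: "nat \<Rightarrow> real \<Rightarrow> (nat \<Rightarrow> real) \<Rightarrow> (int \<Rightarrow> real) \<Rightarrow> int \<Rightarrow> real" where
  "residual p m b y t = (y t - m) - (\<Sum>j=1..p. b j * (y (t - int j) - m))"

definition empirical_df :: "nat \<Rightarrow> (int \<Rightarrow> real) \<Rightarrow> real \<Rightarrow> real" where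
  "empirical_df n e x = (\<Sum>t=1..int n. indicator {..x} (e t)) / real n"

definition symmetrized :: "(real \<Rightarrow> real) \<Rightarrow> real \<Rightarrow> real" where
  "symmetrized F x = (F x + 1 - F (- x)) / 2"

definition Delta :: "nat \<Rightarrow> (nat \<Rightarrow> real) \<Rightarrow> (real \<Rightarrow> real) \<Rightarrow> real measure \<Rightarrow> real \<Rightarrow> real" where
  "Delta p \<beta> G P\<^sub>\<xi> x =
     (\<Sum>j=0..p. (\<integral>s. G (x + (\<beta>(0 := -1)) j * s) \<partial>P\<^sub>\<xi>) - G x)"

definition Delta_S :: "nat \<Rightarrow> (nat \<Rightarrow> real) \<Rightarrow> (real \<Rightarrow> real) \<Rightarrow> real measure \<Rightarrow> real \<Rightarrow> real" where
  "Delta_S p \<beta> G P\<^sub>\<xi> x = (Delta p \<beta> G P\<^sub>\<xi> x - Delta p \<beta> G P\<^sub>\<xi> (- x)) / 2"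

end

theory Submission
  imports Defs "HOL-Complex_Analysis.Complex_Analysis" "HOL-Real_Asymp.Real_Asymp"
begin

text \<open>
  Write \<open>B\<^sub>j\<close> for \<open>\<beta>\<^sub>j\<close> with \<open>B\<^sub>0 = -1\<close> and \<open>w\<^sub>t = z\<^sub>t \<xi>\<^sub>t\<close>. A residual is at most \<open>x\<close> iff \<open>\<epsilon>\<^sub>t\<close> is at most
  \<open>x + d\<^sub>t / \<surd>n + \<Sum>\<^sub>j B\<^sub>j w\<^sub>t\<^sub>-\<^sub>j\<close>, where \<open>d\<^sub>t\<close> is affine in the past observations with coefficients
  that are bounded in probability. Fix these coefficients first. Then the threshold is predictable,
  the centred indicators form a martingale difference sequence whose sum is negligible after
  division by \<open>\<surd>n\<close>, and what is left is a sum of increments of the innovation distribution function.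
  An outlier enters \<open>p + 1\<close> residuals and two outliers rarely meet in one, so the outliers contribute
  \<open>\<gamma> \<Delta>(x)\<close>, while a Taylor expansion shows that the outlier-free part contributes \<open>g(x)\<close> times the mean of \<open>d\<^sub>t\<close>, where \<open>g\<close> is the density of \<open>G\<^sub>0\<close>.
  The estimated coefficients are handled by monotonicity: a finite grid brackets \<open>d\<^sub>t\<close> between two
  fixed shifts. As \<open>g\<close> is even, symmetrization cancels the term in the mean of \<open>d\<^sub>t\<close>, so neither a
  law of large numbers nor the limit of the estimators is needed.
\<close>

section \<open>Inverting the autoregressive polynomial\<close>

text \<open>Second moments of \<open>v\<close> and its measurability with respect to the past
  innovations are not among the assumptions. Hence \<open>v - \<mu>\<close> is compared with a
  moving average cut off at \<open>m\<close>, and every bound is uniform in \<open>m\<close>. Only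
  afterwards is \<open>m\<close> chosen, for fixed \<open>n\<close>, \<open>\<gamma>\<close> and
  \<open>\<rho>\<close>, such that both agree up to a small error on the whole sample with high
  probability. Because of the supremum over \<open>\<gamma>\<close> and \<open>\<rho>\<close>, each
  estimate is an inequality at fixed \<open>n\<close> whose right side can be bounded through
  \<open>\<Gamma>\<close> and \<open>R\<close> alone; limits are taken at the very end. The law of
  the outlier sizes is arbitrary, so a size enters the bounds only through bounded functions such as
  \<open>min 1 (c * \<bar>s\<bar>)\<close>: an outlier changes an increment of a distribution
  function by at most one. The cancellation under symmetrization works because one and the same grid
  point serves \<open>x\<close> and \<open>- x\<close>. The two means of the shift then differ only
  by the width of the bracket, which is small times a quantity with bounded expectation.\<close>

definition ar_fps :: "nat \<Rightarrow> (nat \<Rightarrow> 'a::field) \<Rightarrow> 'a fps" where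
  "ar_fps p \<beta> = 1 - (\<Sum>j=1..p. fps_const (\<beta> j) * fps_X ^ j)"

text \<open>These are the weights of the one-sided infinite moving average that represents the
  stationary solution. As coefficients of a formal inverse they exist before any convergence is
  known.\<close>

definition ma_coeff :: "nat \<Rightarrow> (nat \<Rightarrow> real) \<Rightarrow> nat \<Rightarrow> real" where
  "ma_coeff p \<beta> k = fps_nth (inverse (ar_fps p \<beta>)) k"

lemma ar_fps_nth:
  "fps_nth (ar_fps p \<beta>) k = (if k = 0 then 1 else if k \<le> p then - \<beta> k else 0)"
proof -
  have "(\<Sum>j=1..p. \<beta> j * (if k = j then 1 else 0)) = (\<Sum>j=1..p. if k = j then \<beta> k else 0)"
    by (intro sum.cong) auto
  then show ?thesis
    by (simp add: ar_fps_def fps_sum_nth)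
qed

lemma ar_fps_mult_nth:
  "fps_nth (ar_fps p \<beta> * f) k = fps_nth f k - (\<Sum>j\<in>{j\<in>{1..p}. j \<le> k}. \<beta> j * fps_nth f (k - j))"
proof -
  have "fps_nth (ar_fps p \<beta> * f) k = fps_nth f k - (\<Sum>j=1..p. \<beta> j * fps_nth (fps_X ^ j * f) k)"
    by (simp add: ar_fps_def left_diff_distrib sum_distrib_right fps_sum_nth mult.assoc)
  also have "(\<Sum>j=1..p. \<beta> j * fps_nth (fps_X ^ j * f) k) =
      (\<Sum>j=1..p. if j \<le> k then \<beta> j * fps_nth f (k - j) else 0)"
    by (intro sum.cong) (auto simp: fps_X_power_mult_nth)
  also have "\<dots> = (\<Sum>j\<in>{j\<in>{1..p}. j \<le> k}. \<beta> j * fps_nth f (k - j))"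
    by (rule sum.inter_filter[symmetric]) simp
  finally show ?thesis .
qed

lemma ma_coeff_0: "ma_coeff p \<beta> 0 = 1"
  by (simp add: ma_coeff_def ar_fps_nth)

lemma ma_coeff_rec:
  assumes "k \<ge> 1"
  shows "ma_coeff p \<beta> k = (\<Sum>j\<in>{j\<in>{1..p}. j \<le> k}. \<beta> j * ma_coeff p \<beta> (k - j))"
proof -
  have "ar_fps p \<beta> * inverse (ar_fps p \<beta>) = 1"
    by (rule inverse_mult_eq_1') (simp add: ar_fps_nth)
  then have "fps_nth (ar_fps p \<beta> * inverse (ar_fps p \<beta>)) k = 0"
    using assms by simp
  then show ?thesis
    by (simp add: ar_fps_mult_nth ma_coeff_def)
qed

text \<open>The radius of convergence of an inverse is governed by complex zeros, whereas the
  weights are real. The embedded real weights still solve \<open>?\<phi> * f = 1\<close>, and the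
  inverse is unique.\<close>

lemma of_real_ma_coeff:
  "complex_of_real (ma_coeff p \<beta> k) = fps_nth (inverse (ar_fps p (\<lambda>j. complex_of_real (\<beta> j)))) k"
proof -
  let ?\<phi> = "ar_fps p (\<lambda>j. complex_of_real (\<beta> j))"
  define f where "f = Abs_fps (\<lambda>k. complex_of_real (ma_coeff p \<beta> k))"
  have f: "fps_nth f k = complex_of_real (ma_coeff p \<beta> k)" for k by (simp add: f_def)
  have "?\<phi> * f = 1"
  proof (rule fps_ext)
    fix k
    show "fps_nth (?\<phi> * f) k = fps_nth 1 k"
    proof (cases "k = 0")
      case True
      then show ?thesis by (simp add: f ma_coeff_0 ar_fps_nth)
    next
      case False
      have "fps_nth (?\<phi> * f) k = complex_of_real (ma_coeff p \<beta> k -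
          (\<Sum>j\<in>{j\<in>{1..p}. j \<le> k}. \<beta> j * ma_coeff p \<beta> (k - j)))"
        by (simp only: ar_fps_mult_nth f of_real_diff of_real_sum of_real_mult)
      also have "\<dots> = 0"
        using False by (subst ma_coeff_rec) auto
      finally show ?thesis using False by simp
    qed
  qed
  moreover have "inverse ?\<phi> * ?\<phi> = 1"
    by (rule inverse_mult_eq_1) (simp add: ar_fps_nth)
  ultimately have "f = inverse ?\<phi>"
    using mult.assoc[of "inverse ?\<phi>" ?\<phi> f] by simp
  then show ?thesis
    using f by simp
qed

lemma eval_ar_fps: "eval_fps (ar_fps p \<beta>) z = 1 - (\<Sum>j=1..p. \<beta> j * z ^ j)"
  and conv_radius_ar_fps: "fps_conv_radius (ar_fps p \<beta>) = \<infinity>"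
  for \<beta> :: "nat \<Rightarrow> complex"
proof -
  have *: "ar_fps p \<beta> = fps_of_poly (1 - (\<Sum>j=1..p. monom (\<beta> j) j))"
    by (simp add: fps_eq_iff ar_fps_nth coeff_sum coeff_diff)
  show "eval_fps (ar_fps p \<beta>) z = 1 - (\<Sum>j=1..p. \<beta> j * z ^ j)"
    by (simp add: * poly_sum poly_monom)
  show "fps_conv_radius (ar_fps p \<beta>) = \<infinity>"
    by (simp add: *)
qed

text \<open>The series evaluates to the reciprocal of the characteristic polynomial, so a zero in
  the closed unit disc would be nonzero and its inverse a characteristic root of modulus at least
  one. The zero set is closed and the disc compact, hence a gap \<open>d\<close> separates them. The
  inverse series therefore converges beyond the unit circle, and boundedness of its terms at radius
  \<open>1 + d/2\<close> is geometric decay.\<close>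

lemma ma_coeff_geometric:
  assumes roots: "\<And>r::complex.
      r ^ p - (\<Sum>j=1..p. complex_of_real (\<beta> j) * r ^ (p - j)) = 0 \<Longrightarrow> norm r < 1"
  obtains C r where "C > 0" "0 < r" "r < 1" "\<And>k. \<bar>ma_coeff p \<beta> k\<bar> \<le> C * r ^ k"
proof -
  let ?\<phi> = "ar_fps p (\<lambda>j. complex_of_real (\<beta> j))"
  define Z where "Z = {z. eval_fps ?\<phi> z = 0}"
  have nz: "z \<notin> Z" if "norm z \<le> 1" for z
  proof
    assume "z \<in> Z"
    then have z0: "1 - (\<Sum>j=1..p. complex_of_real (\<beta> j) * z ^ j) = 0"
      by (simp add: Z_def eval_ar_fps)
    have "z \<noteq> 0"
    proof
      assume "z = 0"
      then have "(\<Sum>j=1..p. complex_of_real (\<beta> j) * z ^ j) = 0"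
        by (intro sum.neutral) auto
      with z0 show False by simp
    qed
    have "inverse z ^ p - (\<Sum>j=1..p. complex_of_real (\<beta> j) * inverse z ^ (p - j))
        = inverse z ^ p * (1 - (\<Sum>j=1..p. complex_of_real (\<beta> j) * z ^ j))"
      using \<open>z \<noteq> 0\<close> unfolding right_diff_distrib sum_distrib_left
      by (auto simp: power_diff power_inverse field_simps intro!: sum.cong)
    also have "\<dots> = 0" using z0 by simp
    finally have "norm (inverse z) < 1" by (rule roots)
    with that \<open>z \<noteq> 0\<close> show False
      using one_le_inverse[of "norm z"] by (simp add: norm_inverse)
  qed
  have "closed Z"
    unfolding Z_def eval_ar_fps by (intro closed_Collect_eq continuous_intros)
  moreover have "cball 0 1 \<inter> Z = {}" using nz by auto
  ultimately obtain d where d: "d > 0" "\<And>x y. x \<in> cball 0 1 \<Longrightarrow> y \<in> Z \<Longrightarrow> d \<le> dist x y"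
    using separate_compact_closed[of "cball (0::complex) 1" Z] by auto
  have nz': "eval_fps ?\<phi> z \<noteq> 0" if "norm z < 1 + d" for z
  proof (cases "norm z \<le> 1")
    case True
    then show ?thesis using nz[of z] by (simp add: Z_def)
  next
    case False
    \<comment> \<open>The radial projection of \<open>z\<close> to the unit circle is at distance
      \<open>norm z - 1 < d\<close> from \<open>z\<close>, which is too close if \<open>z\<close> is
      a zero.\<close>
    define x where "x = z / of_real (norm z)"
    have "norm x = 1" using False by (auto simp: x_def norm_divide)
    have "z = of_real (norm z) * x" using False by (auto simp: x_def)
    then have "dist x z = norm (of_real (norm z - 1) * x)"
      by (simp add: dist_norm norm_minus_commute algebra_simps)
    also have "\<dots> = norm z - 1" using \<open>norm x = 1\<close> False by (simp add: norm_mult del: of_real_diff)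
    finally have "dist x z < d" using that by simp
    with d(2)[of x z] \<open>norm x = 1\<close> show ?thesis by (force simp: Z_def)
  qed
  have "ereal (1 + d) \<le> fps_conv_radius (inverse ?\<phi>)"
    using fps_conv_radius_inverse[of "ereal (1 + d)" ?\<phi>] nz' by (simp add: conv_radius_ar_fps)
  then have "ereal (norm (complex_of_real (1 + d / 2))) < fps_conv_radius (inverse ?\<phi>)"
    using d(1) unfolding norm_of_real by (elim less_le_trans[rotated]) simp
  then have "summable (\<lambda>k. fps_nth (inverse ?\<phi>) k * of_real (1 + d/2) ^ k)"
    by (rule summable_fps)
  then have "Bseq (\<lambda>k. fps_nth (inverse ?\<phi>) k * of_real (1 + d/2) ^ k)"
    by (intro convergent_imp_Bseq) (auto simp: convergent_def dest: summable_LIMSEQ_zero)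
  then obtain C where C: "C > 0"
    "\<And>k. norm (fps_nth (inverse ?\<phi>) k * of_real (1 + d/2) ^ k) \<le> C"
    by (auto elim: BseqE)
  show ?thesis
  proof
    show "C > 0" "0 < 1 / (1 + d/2)" "1 / (1 + d/2) < 1"
      using C d(1) by auto
    show "\<bar>ma_coeff p \<beta> k\<bar> \<le> C * (1 / (1 + d/2)) ^ k" for k
    proof -
      have "\<bar>ma_coeff p \<beta> k\<bar> * (1 + d/2) ^ k =
          norm (fps_nth (inverse ?\<phi>) k * of_real (1 + d/2) ^ k)"
        using d(1) unfolding norm_mult norm_power norm_of_real of_real_ma_coeff[symmetric] by simp
      also have "\<dots> \<le> C" by (rule C)
      finally show ?thesis
        using d(1) by (simp add: power_divide field_simps)
    qed
  qed
qed

text \<open>Each induction step replaces the value of \<open>u\<close> at lag \<open>m\<close> by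
  the recursion. The remainder collects the products with \<open>k < m \<le> k + j\<close>, so
  \<open>u\<close> occurs in it only at the \<open>p\<close> lags from \<open>m\<close> to
  \<open>m + p - 1\<close>.\<close>

lemma ar_solution_expansion:
  fixes u e :: "int \<Rightarrow> real"
  assumes rec: "\<And>s. u s = (\<Sum>j=1..p. \<beta> j * u (s - int j)) + e s" and "m \<ge> 1"
  shows "u t = (\<Sum>k<m. ma_coeff p \<beta> k * e (t - int k)) +
     (\<Sum>j=1..p. \<Sum>k\<in>{m - j..<m}. \<beta> j * ma_coeff p \<beta> k * u (t - int k - int j))"
  using \<open>m \<ge> 1\<close>
proof (induction m rule: dec_induct)
  case base
  have "{1 - j..<1} = {0::nat}" if "j \<in> {1..p}" for j using that by auto
  then have "(\<Sum>j=1..p. \<Sum>k\<in>{1 - j..<1}. \<beta> j * ma_coeff p \<beta> k * u (t - int k - int j))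
     = (\<Sum>j=1..p. \<beta> j * u (t - int j))"
    by (intro sum.cong) (auto simp: ma_coeff_0)
  then show ?case by (simp add: rec[of t] ma_coeff_0)
next
  case (step m)
  define g where "g j k = \<beta> j * ma_coeff p \<beta> k * u (t - int k - int j)" for j k
  define J where "J = {j\<in>{1..p}. j \<le> m}"
  \<comment> \<open>Moving the window on adds \<open>k = m\<close> and drops
    \<open>k = m - j\<close>. For \<open>j > m\<close>, truncated subtraction lets both windows
    start at \<open>0\<close>, and nothing is dropped.\<close>
  have 1: "(\<Sum>k\<in>{Suc m - j..<Suc m}. g j k) = (\<Sum>k\<in>{m - j..<m}. g j k) + g j m
      - (if j \<le> m then g j (m - j) else 0)" if "j \<in> {1..p}" for j
  proof (cases "j \<le> m")
    case True
    then have "(\<Sum>k\<in>{m - j..<m}. g j k) = g j (m - j) + (\<Sum>k\<in>{Suc m - j..<m}. g j k)"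
      using that by (subst sum.atLeast_Suc_lessThan) (auto simp: Suc_diff_le)
    moreover have "(\<Sum>k\<in>{Suc m - j..<Suc m}. g j k) = (\<Sum>k\<in>{Suc m - j..<m}. g j k) + g j m"
      using True that by (intro sum.atLeastLessThan_Suc) auto
    ultimately show ?thesis using True by simp
  next
    case False
    then show ?thesis using that by (simp add: sum.atLeastLessThan_Suc)
  qed
  \<comment> \<open>All dropped terms sit at lag \<open>m\<close>; the recursion of the weights adds
    them up to one multiple of \<open>u\<close> there.\<close>
  have 2: "(\<Sum>j=1..p. if j \<le> m then g j (m - j) else 0) = ma_coeff p \<beta> m * u (t - int m)"
  proof -
    have "(\<Sum>j=1..p. if j \<le> m then g j (m - j) else 0) = (\<Sum>j\<in>J. g j (m - j))"
      unfolding J_def by (rule sum.inter_filter[symmetric]) simp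
    also have "\<dots> = (\<Sum>j\<in>J. \<beta> j * ma_coeff p \<beta> (m - j) * u (t - int m))"
      by (intro sum.cong) (auto simp: J_def g_def of_nat_diff)
    also have "\<dots> = ma_coeff p \<beta> m * u (t - int m)"
      using step(1) by (subst ma_coeff_rec) (auto simp: J_def sum_distrib_right)
    finally show ?thesis .
  qed
  have 3: "ma_coeff p \<beta> m * e (t - int m) = ma_coeff p \<beta> m * u (t - int m) - (\<Sum>j=1..p. g j m)"
    using rec[of "t - int m"] by (simp add: g_def algebra_simps sum_distrib_left)
  have "(\<Sum>j=1..p. \<Sum>k\<in>{Suc m - j..<Suc m}. g j k) =
      (\<Sum>j=1..p. \<Sum>k\<in>{m - j..<m}. g j k) + (\<Sum>j=1..p. g j m) - ma_coeff p \<beta> m * u (t - int m)"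
    unfolding 2[symmetric] sum.distrib[symmetric] sum_subtractf[symmetric]
    by (intro sum.cong 1) auto
  with step 3 show ?case by (simp add: g_def)
qed

section \<open>Decoupling of the outliers\<close>

text \<open>
  The argument is a case distinction on the number of indices with \<open>z j = 1\<close>: with none the Taylor
  bound applies, with one the two sides differ by a shift of \<open>D1 / a\<close>, and with two or more
  everything is absorbed into the pair sum.
\<close>

lemma outlier_decoupling:
  fixes f :: "real \<Rightarrow> real" and z x B :: "'i \<Rightarrow> real"
  assumes J: "finite J" and z: "\<And>j. j \<in> J \<Longrightarrow> z j \<in> {0, 1}"
    and lip: "\<And>s t. \<bar>f s - f t\<bar> \<le> L * \<bar>s - t\<bar>" and osc: "\<And>s t. \<bar>f s - f t\<bar> \<le> 1"
    and f0: "f 0 = 0" and taylor: "\<And>s. \<bar>f s - g * s\<bar> \<le> L * s\<^sup>2 + K * \<bar>s\<bar>"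
    and g: "\<bar>g\<bar> \<le> L" and a: "a > 0" and K: "K \<ge> 0"
    and D: "\<bar>D1 - D0\<bar> \<le> C * (\<Sum>j\<in>J. z j * \<bar>x j\<bar>)"
  shows "\<bar>f (D1 / a + (\<Sum>j\<in>J. B j * (z j * x j))) - (\<Sum>j\<in>J. z j * f (B j * x j)) - g * D0 / a\<bar>
    \<le> L * (D0 / a)\<^sup>2 + K * (\<bar>D0\<bar> / a) +
       (\<Sum>j\<in>J. z j * (2 * L * (\<bar>D0\<bar> / a) + min 1 (L * C * \<bar>x j\<bar> / a))) +
       2 * (\<Sum>i\<in>J. \<Sum>j\<in>J - {i}. z i * z j)"
    (is "\<bar>?f - ?S - _\<bar> \<le> ?Q + ?K + ?M + ?P")
proof -
  define S where "S = {j \<in> J. z j = 1}"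
  have S: "finite S" "S \<subseteq> J" using J by (auto simp: S_def)
  have L: "L \<ge> 0" using g by linarith
  have sumS: "(\<Sum>j\<in>J. z j * h j) = (\<Sum>j\<in>S. h j)" for h
    using z S J by (intro sum.mono_neutral_cong_right) (auto simp: S_def)
  have sumS': "(\<Sum>j\<in>J. B j * (z j * h j)) = (\<Sum>j\<in>S. B j * h j)" for h
    using z S J by (intro sum.mono_neutral_cong_right) (auto simp: S_def)
  have fle: "\<bar>f s\<bar> \<le> 1" for s using osc[of s 0] f0 by simp
  have sq: "0 \<le> L * (D0 / a)\<^sup>2" and nn: "0 \<le> K * (\<bar>D0\<bar> / a)" "0 \<le> \<bar>D0\<bar> / a"
    using L K a by auto
  have gD: "\<bar>g * D0 / a\<bar> \<le> L * (\<bar>D0\<bar> / a)"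
    using g a by (simp add: abs_mult divide_right_mono mult_right_mono)
  have pair_nn: "0 \<le> z i * z j" if "i \<in> J" "j \<in> J" for i j
    using z[OF that(1)] z[OF that(2)] by auto
  then have Pnn: "0 \<le> ?P" by (intro mult_nonneg_nonneg[of 2] sum_nonneg) auto
  have LD: "0 \<le> L * (\<bar>D0\<bar> / a)" using L nn(2) by (rule mult_nonneg_nonneg)
  consider "card S = 0" | "card S = 1" | "card S \<ge> 2" by linarith
  then show ?thesis
  proof cases
    case 1
    then have "S = {}" using S(1) by simp
    then have "D1 = D0" using D \<open>S = {}\<close> by (simp add: sumS)
    moreover have "\<bar>f (D0 / a) - g * (D0 / a)\<bar> \<le> ?Q + ?K"
      using taylor[of "D0 / a"] a by simp
    ultimately show ?thesis using \<open>S = {}\<close> Pnn by (simp add: sumS sumS')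
  next
    case 2
    then obtain k where k: "S = {k}" by (rule card_1_singletonE)
    let ?m = "min 1 (L * C * \<bar>x k\<bar> / a)"
    have "\<bar>f (D1 / a + B k * x k) - f (B k * x k)\<bar> \<le> L * (\<bar>D0\<bar> / a) + ?m"
    proof -
      have "\<bar>D1 / a\<bar> \<le> (\<bar>D0\<bar> + C * \<bar>x k\<bar>) / a"
        using D a by (simp add: k sumS divide_right_mono)
      then have "L * \<bar>D1 / a\<bar> \<le> L * (\<bar>D0\<bar> / a) + L * C * \<bar>x k\<bar> / a"
        using mult_left_mono[of "\<bar>D1 / a\<bar>" "(\<bar>D0\<bar> + C * \<bar>x k\<bar>) / a" L] L
        by (simp add: add_divide_distrib distrib_left)
      then have "L * \<bar>D1 / a + B k * x k - B k * x k\<bar> \<le> L * (\<bar>D0\<bar> / a) + L * C * \<bar>x k\<bar> / a"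
        by simp
      then show ?thesis
        using LD lip[of "D1 / a + B k * x k" "B k * x k"] osc[of "D1 / a + B k * x k" "B k * x k"]
        by linarith
    qed
    then show ?thesis
      using gD sq nn(1) LD Pnn abs_triangle_ineq4[of "f (D1 / a + B k * x k) - f (B k * x k)" "g * D0 / a"]
      unfolding sumS sumS' k by simp
  next
    case 3
    let ?c = "real (card S)"
    have "(\<Sum>i\<in>J. \<Sum>j\<in>J - {i}. z i * z j) = (\<Sum>i\<in>J. z i * (?c - 1))"
    proof (rule sum.cong[OF refl])
      fix i assume i: "i \<in> J"
      have "z i * (\<Sum>j\<in>J - {i}. z j) = z i * ((\<Sum>j\<in>J. z j * 1) - z i)"
        using J i by (simp add: sum_diff1)
      also have "\<dots> = z i * (?c - 1)"
        using z[OF i] unfolding sumS by auto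
      finally show "(\<Sum>j\<in>J - {i}. z i * z j) = z i * (?c - 1)"
        by (simp add: sum_distrib_left)
    qed
    \<comment> \<open>The double sum counts ordered pairs of distinct outliers. From two outliers
      on, twice this number exceeds \<open>1 + ?c\<close>, which covers \<open>f\<close> on the left
      and all \<open>?c\<close> summands of \<open>?S\<close>.\<close>
    then have P: "?P = 2 * (?c * (?c - 1))" by (simp add: sumS)
    have "2 * (?c * 1) \<le> 2 * (?c * (?c - 1))"
      using 3 by (intro mult_left_mono) auto
    moreover have "2 \<le> ?c" using 3 by simp
    ultimately have "1 + ?c \<le> ?P" unfolding P by linarith
    moreover have "\<bar>?S\<bar> \<le> ?c"
      unfolding sumS using fle by (intro order.trans[OF sum_abs] sum_bounded_above[THEN order.trans]) auto
    moreover have "L * (\<bar>D0\<bar> / a) \<le> ?M"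
    proof -
      have "L * (\<bar>D0\<bar> / a) \<le> 1 * (2 * L * (\<bar>D0\<bar> / a))" using LD by simp
      also have "\<dots> \<le> ?c * (2 * L * (\<bar>D0\<bar> / a))"
        using 3 L nn by (intro mult_right_mono mult_nonneg_nonneg) auto
      also have "\<dots> \<le> (\<Sum>j\<in>S. 2 * L * (\<bar>D0\<bar> / a) + min 1 (L * C * \<bar>x j\<bar> / a))"
      proof (cases "C \<ge> 0")
        case True
        have "(\<Sum>j\<in>S. 2 * L * (\<bar>D0\<bar> / a) + 0) \<le> (\<Sum>j\<in>S. 2 * L * (\<bar>D0\<bar> / a) + min 1 (L * C * \<bar>x j\<bar> / a))"
          using True L a by (intro sum_mono add_left_mono) auto
        then show ?thesis by simp
      next
        \<comment> \<open>With a negative \<open>C\<close>, the bound \<open>D\<close> leaves only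
          outlier sizes equal to zero, and then every minimum is zero.\<close>
        case False
        have "0 \<le> \<bar>D1 - D0\<bar>" by simp
        also note D
        finally have "(\<Sum>j\<in>S. \<bar>x j\<bar>) \<le> 0"
          using False by (simp add: sumS zero_le_mult_iff)
        moreover have "\<bar>x j\<bar> \<le> (\<Sum>j\<in>S. \<bar>x j\<bar>)" if "j \<in> S" for j
          using S(1) that by (intro member_le_sum) auto
        ultimately have "x j = 0" if "j \<in> S" for j using that by fastforce
        then show ?thesis by simp
      qed
      finally show ?thesis by (simp add: sumS)
    qed
    ultimately show ?thesis using fle[of "D1 / a + (\<Sum>j\<in>J. B j * (z j * x j))"] gD sq nn by linarith
  qed
qed

section \<open>Independence and second moments\<close>

lemma abs_le_one_plus_square: "\<bar>s\<bar> \<le> 1 + s\<^sup>2" for s :: real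
proof -
  have "0 \<le> (\<bar>s\<bar> - 1)\<^sup>2" by simp
  also have "\<dots> = s\<^sup>2 + 1 - 2 * \<bar>s\<bar>" by (simp add: power2_diff)
  finally show ?thesis by linarith
qed

lemma (in prob_space) expectation_abs_le_sqrt:
  fixes X :: "'a \<Rightarrow> real"
  assumes "X \<in> borel_measurable M" "integrable M (\<lambda>\<omega>. (X \<omega>)\<^sup>2)"
  shows "expectation (\<lambda>\<omega>. \<bar>X \<omega>\<bar>) \<le> sqrt (expectation (\<lambda>\<omega>. (X \<omega>)\<^sup>2))"
proof -
  have int: "integrable M X" using assms by (rule square_integrable_imp_integrable)
  have "0 \<le> variance (\<lambda>\<omega>. \<bar>X \<omega>\<bar>)" by (rule variance_positive)
  also have "\<dots> = expectation (\<lambda>\<omega>. (X \<omega>)\<^sup>2) - (expectation (\<lambda>\<omega>. \<bar>X \<omega>\<bar>))\<^sup>2"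
    using int assms by (subst variance_eq) auto
  finally show ?thesis by (intro real_le_rsqrt) simp
qed

lemma expectation_sum_square_orthogonal:
  fixes X :: "'i \<Rightarrow> 'a \<Rightarrow> real"
  assumes "finite S" "\<And>s t. s \<in> S \<Longrightarrow> t \<in> S \<Longrightarrow> integrable M (\<lambda>\<omega>. X s \<omega> * X t \<omega>)"
    and orth: "\<And>s t. s \<in> S \<Longrightarrow> t \<in> S \<Longrightarrow> s \<noteq> t \<Longrightarrow> (\<integral>\<omega>. X s \<omega> * X t \<omega> \<partial>M) = 0"
  shows "integrable M (\<lambda>\<omega>. (\<Sum>s\<in>S. X s \<omega>)\<^sup>2)"
    and "(\<integral>\<omega>. (\<Sum>s\<in>S. X s \<omega>)\<^sup>2 \<partial>M) = (\<Sum>s\<in>S. \<integral>\<omega>. (X s \<omega>)\<^sup>2 \<partial>M)"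
proof -
  have eq: "(\<Sum>s\<in>S. X s \<omega>)\<^sup>2 = (\<Sum>s\<in>S. \<Sum>t\<in>S. X s \<omega> * X t \<omega>)" for \<omega>
    by (simp add: power2_eq_square sum_product)
  show "integrable M (\<lambda>\<omega>. (\<Sum>s\<in>S. X s \<omega>)\<^sup>2)"
    unfolding eq using assms(2) by (intro Bochner_Integration.integrable_sum)
  have "(\<integral>\<omega>. (\<Sum>s\<in>S. X s \<omega>)\<^sup>2 \<partial>M) = (\<Sum>s\<in>S. \<Sum>t\<in>S. \<integral>\<omega>. X s \<omega> * X t \<omega> \<partial>M)"
    unfolding eq using assms(2) by (simp add: Bochner_Integration.integral_sum)
  also have "\<dots> = (\<Sum>s\<in>S. \<Sum>t\<in>S. if t = s then \<integral>\<omega>. X s \<omega> * X s \<omega> \<partial>M else 0)"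
    using orth by (intro sum.cong) auto
  also have "\<dots> = (\<Sum>s\<in>S. \<integral>\<omega>. (X s \<omega>)\<^sup>2 \<partial>M)"
    using assms(1) by (simp add: power2_eq_square)
  finally show "(\<integral>\<omega>. (\<Sum>s\<in>S. X s \<omega>)\<^sup>2 \<partial>M) = (\<Sum>s\<in>S. \<integral>\<omega>. (X s \<omega>)\<^sup>2 \<partial>M)" .
qed

text \<open>A finite set of pairs splits into fibres over its first components. The events of one
  fibre intersect in the preimage of a cylinder set of that block, so independence of the blocks
  separates the fibres and independence inside a block separates the times. The model states
  independence in these two layers, while the moment computations mix variables of several
  blocks.\<close>

lemma (in prob_space) indep_vars_flatten:
  assumes blocks: "indep_vars (\<lambda>_. PiM UNIV (\<lambda>_. N)) (\<lambda>k \<omega> t. X k t \<omega>) K"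
    and within: "\<And>k. k \<in> K \<Longrightarrow> indep_vars (\<lambda>_. N) (X k) UNIV"
  shows "indep_vars (\<lambda>_. N) (\<lambda>(k, t). X k t) (K \<times> UNIV)"
  unfolding indep_vars_def2
proof (intro conjI ballI indep_setsI)
  have X: "X k t \<in> measurable M N" if "k \<in> K" for k t
    using within[OF that] by (simp add: indep_vars_def2)
  then show "(\<lambda>(k, t). X k t) i \<in> measurable M N" if "i \<in> K \<times> UNIV" for i
    using that by auto
  then show "{(\<lambda>(k, t). X k t) i -` A \<inter> space M |A. A \<in> sets N} \<subseteq> events" if "i \<in> K \<times> UNIV" for i
    using that by (auto intro: measurable_sets)
  fix A J
  assume J: "J \<noteq> {}" "J \<subseteq> K \<times> UNIV" "finite J"
    and AF: "\<forall>j\<in>J. A j \<in> {(\<lambda>(k, t). X k t) j -` A \<inter> space M |A. A \<in> sets N}"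
  define S where "S j = (SOME S. S \<in> sets N \<and> A j = X (fst j) (snd j) -` S \<inter> space M)" for j
  have SA: "S j \<in> sets N \<and> A j = X (fst j) (snd j) -` S j \<inter> space M" if "j \<in> J" for j
  proof -
    have "A j \<in> {X (fst j) (snd j) -` A \<inter> space M |A. A \<in> sets N}"
      using AF that by (simp add: case_prod_beta)
    then have "\<exists>S. S \<in> sets N \<and> A j = X (fst j) (snd j) -` S \<inter> space M"
      by (simp add: conj_commute)
    then show ?thesis unfolding S_def by (rule someI_ex)
  qed
  have S: "S j \<in> sets N" and A: "A j = X (fst j) (snd j) -` S j \<inter> space M" if "j \<in> J" for j
    using SA[OF that] by (rule conjunct1, rule conjunct2)
  define J1 where "J1 = fst ` J"
  define J2 where "J2 k = {t. (k, t) \<in> J}" for k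
  have JS: "J = Sigma J1 J2" by (force simp: J1_def J2_def)
  have J1: "J1 \<noteq> {}" "finite J1" "J1 \<subseteq> K" using J by (auto simp: J1_def)
  have J2: "finite (J2 k)" for k
    using finite_imageI[OF J(3), of snd] by (rule finite_subset[rotated]) (force simp: J2_def)
  have J2ne: "J2 k \<noteq> {}" if "k \<in> J1" for k using that by (force simp: J1_def J2_def)
  define B where "B k = {f \<in> space (PiM UNIV (\<lambda>_. N)). \<forall>t\<in>J2 k. f t \<in> S (k, t)}" for k
  have B: "B k \<in> sets (PiM UNIV (\<lambda>_. N))" for k
  proof -
    have "B k = space (PiM UNIV (\<lambda>_. N)) \<inter> (\<Inter>t\<in>J2 k. (\<lambda>f. f t) -` S (k, t) \<inter> space (PiM UNIV (\<lambda>_. N)))"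
      by (auto simp: B_def)
    also have "\<dots> \<in> sets (PiM UNIV (\<lambda>_. N))"
    proof (cases "J2 k = {}")
      case False
      then show ?thesis using J2 S
        by (intro sets.Int sets.top sets.finite_INT measurable_sets[OF measurable_component_singleton])
          (auto simp: J2_def)
    qed auto
    finally show ?thesis .
  qed
  have pre: "(\<lambda>\<omega> t. X k t \<omega>) -` B k \<inter> space M = (\<Inter>t\<in>J2 k. A (k, t))" if "k \<in> J1" for k
  proof -
    have "k \<in> K" using that J1 by auto
    then have sp: "X k t \<omega> \<in> space N" if "\<omega> \<in> space M" for t \<omega>
      using X that by (metis measurable_space)
    then have "(\<lambda>\<omega> t. X k t \<omega>) -` B k \<inter> space M =
        {\<omega> \<in> space M. \<forall>t\<in>J2 k. X k t \<omega> \<in> S (k, t)}"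
      by (auto simp: B_def space_PiM)
    also have "\<dots> = (\<Inter>t\<in>J2 k. A (k, t))"
    proof -
      have "A (k, t) = {\<omega> \<in> space M. X k t \<omega> \<in> S (k, t)}" if "t \<in> J2 k" for t
        using A[of "(k, t)"] that by (auto simp: J2_def)
      then show ?thesis using J2ne[OF that] by auto
    qed
    finally show ?thesis .
  qed
  have "(\<Inter>j\<in>J. A j) = (\<Inter>k\<in>J1. (\<lambda>\<omega> t. X k t \<omega>) -` B k \<inter> space M)"
    using pre by (subst JS) auto
  then have "prob (\<Inter>j\<in>J. A j) = (\<Prod>k\<in>J1. prob ((\<lambda>\<omega> t. X k t \<omega>) -` B k \<inter> space M))"
    using indep_varsD[OF blocks J1 B] by simp
  also have "\<dots> = (\<Prod>k\<in>J1. \<Prod>t\<in>J2 k. prob (A (k, t)))"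
  proof (rule prod.cong[OF refl])
    fix k assume k: "k \<in> J1"
    then have "k \<in> K" using J1 by auto
    have "prob (\<Inter>t\<in>J2 k. X k t -` S (k, t) \<inter> space M) =
        (\<Prod>t\<in>J2 k. prob (X k t -` S (k, t) \<inter> space M))"
      using J2 J2ne[OF k] S by (intro indep_varsD[OF within[OF \<open>k \<in> K\<close>]]) (auto simp: J2_def)
    moreover have "A (k, t) = X k t -` S (k, t) \<inter> space M" if "t \<in> J2 k" for t
      using A[of "(k, t)"] that by (auto simp: J2_def)
    ultimately show "prob ((\<lambda>\<omega> t. X k t \<omega>) -` B k \<inter> space M) = (\<Prod>t\<in>J2 k. prob (A (k, t)))"
      unfolding pre[OF k] by simp
  qed
  also have "\<dots> = (\<Prod>j\<in>J. prob (A j))"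
    unfolding JS using J1 J2 by (subst prod.Sigma) auto
  finally show "prob (\<Inter>j\<in>J. A j) = (\<Prod>j\<in>J. prob (A j))" .
qed

text \<open>This freezing argument takes the place of conditional expectations. As \<open>e\<close>
  is independent of \<open>N\<close>, the pair of \<open>e\<close> and the identity map into
  \<open>N\<close> has a product law. Fubini integrates over \<open>e\<close> first, with the
  threshold held fixed, and the inner integral vanishes because \<open>A\<close> is the distribution
  function of \<open>e\<close>.\<close>

lemma (in prob_space) expectation_predictable_indicator:
  fixes e F C :: "'a \<Rightarrow> real"
  assumes e[measurable]: "e \<in> borel_measurable M"
    and N: "space N = space M" "sets N \<subseteq> events"
    and indep: "indep_set {e -` B \<inter> space M |B. B \<in> sets borel} (sets N)"
    and F: "F \<in> borel_measurable N" "\<And>\<omega>. \<bar>F \<omega>\<bar> \<le> K" and C: "C \<in> borel_measurable N"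
    and cdf: "\<And>s. cdf (distr M borel e) s = A s"
  shows "integrable M (\<lambda>\<omega>. F \<omega> * (indicator {..C \<omega>} (e \<omega>) - A (C \<omega>)))"
    and "expectation (\<lambda>\<omega>. F \<omega> * (indicator {..C \<omega>} (e \<omega>) - A (C \<omega>))) = 0"
proof -
  have id: "(\<lambda>\<omega>. \<omega>) \<in> measurable M N"
    using N by (auto simp: measurable_def dest: sets.sets_into_space)
  define P where "P = distr M borel e"
  define Q where "Q = distr M N (\<lambda>\<omega>. \<omega>)"
  interpret P: real_distribution P unfolding P_def by (rule real_distribution_distr[OF e])
  interpret Q: prob_space Q unfolding Q_def by (rule prob_space_distr[OF id])
  interpret PQ: pair_prob_space P Q ..
  have [measurable]: "A \<in> borel_measurable borel"
    using cdf P.cdf_nondecreasing by (intro borel_measurable_mono monoI) (simp add: P_def)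
  have [measurable_cong]: "sets Q = sets N" by (simp add: Q_def)
  have [measurable]: "(\<lambda>\<omega>. A (C \<omega>)) \<in> borel_measurable N"
    using C by measurable
  note [measurable] = F(1) C
  have A01: "0 \<le> A s" "A s \<le> 1" for s
    using P.cdf_nonneg P.cdf_bounded_prob cdf by (auto simp: P_def)
  define h where "h = (\<lambda>(s, \<omega>). F \<omega> * (indicator {..C \<omega>} s - A (C \<omega>)))"
  have h[measurable]: "h \<in> borel_measurable (borel \<Otimes>\<^sub>M N)"
    unfolding h_def indicator_def atMost_iff by measurable
  have hb: "\<bar>h x\<bar> \<le> K" for x
  proof -
    have "\<bar>h x\<bar> \<le> K * 1"
      unfolding h_def case_prod_beta abs_mult using A01
      by (intro mult_mono F abs_ge_zero order.trans[OF abs_ge_zero F(2)]) (auto simp: indicator_def)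
    then show ?thesis by simp
  qed
  have pair[measurable]: "(\<lambda>\<omega>. (e \<omega>, \<omega>)) \<in> measurable M (borel \<Otimes>\<^sub>M N)"
    by (intro measurable_Pair e id)
  have joint: "P \<Otimes>\<^sub>M Q = distr M (borel \<Otimes>\<^sub>M N) (\<lambda>\<omega>. (e \<omega>, \<omega>))"
  proof (rule pair_measure_eqI)
    show "sigma_finite_measure P" "sigma_finite_measure Q" by unfold_locales
    show "sets (P \<Otimes>\<^sub>M Q) = sets (distr M (borel \<Otimes>\<^sub>M N) (\<lambda>\<omega>. (e \<omega>, \<omega>)))"
      by (simp add: P_def Q_def cong: sets_pair_measure_cong)
    fix S T assume "S \<in> sets P" "T \<in> sets Q"
    then have S: "S \<in> sets borel" and T: "T \<in> sets N" by (auto simp: P_def Q_def)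
    then have "prob ((e -` S \<inter> space M) \<inter> T) = prob (e -` S \<inter> space M) * prob T"
      using indep by (auto simp: indep_sets2_eq)
    moreover have "T \<subseteq> space M" using T N(1) sets.sets_into_space by metis
    then have "(\<lambda>\<omega>. (e \<omega>, \<omega>)) -` (S \<times> T) \<inter> space M = (e -` S \<inter> space M) \<inter> T"
      "(\<lambda>\<omega>. \<omega>) -` T \<inter> space M = T" by auto
    ultimately show "emeasure P S * emeasure Q T =
        emeasure (distr M (borel \<Otimes>\<^sub>M N) (\<lambda>\<omega>. (e \<omega>, \<omega>))) (S \<times> T)"
      using S T by (simp add: P_def Q_def emeasure_distr emeasure_eq_measure ennreal_mult)
  qed
  have hPQ: "integrable (P \<Otimes>\<^sub>M Q) h"
  proof (rule PQ.P.integrable_const_bound[where B=K])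
    show "AE x in P \<Otimes>\<^sub>M Q. norm (h x) \<le> K" using hb by simp
    show "h \<in> borel_measurable (P \<Otimes>\<^sub>M Q)" unfolding joint by simp
  qed
  then show "integrable M (\<lambda>\<omega>. F \<omega> * (indicator {..C \<omega>} (e \<omega>) - A (C \<omega>)))"
    using integrable_distr[OF pair, of h] unfolding joint by (simp add: h_def)
  have "expectation (\<lambda>\<omega>. F \<omega> * (indicator {..C \<omega>} (e \<omega>) - A (C \<omega>))) = (\<integral>x. h x \<partial>(P \<Otimes>\<^sub>M Q))"
    unfolding joint integral_distr[OF pair h] by (simp add: h_def)
  also have "\<dots> = (\<integral>\<omega>. \<integral>s. h (s, \<omega>) \<partial>P \<partial>Q)"
    using PQ.integral_snd[of "\<lambda>s \<omega>. h (s, \<omega>)"] hPQ by simp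
  also have "\<dots> = (\<integral>\<omega>. 0 \<partial>Q)"
  proof (rule Bochner_Integration.integral_cong[OF refl])
    fix \<omega>
    have "(\<integral>s. h (s, \<omega>) \<partial>P) = F \<omega> * (\<integral>s. indicator {..C \<omega>} s - A (C \<omega>) \<partial>P)"
      by (simp add: h_def)
    also have "(\<integral>s. indicator {..C \<omega>} s - A (C \<omega>) \<partial>P) = measure P {..C \<omega>} - A (C \<omega>)"
      using P.prob_space by (subst Bochner_Integration.integral_diff)
        (auto intro!: integrable_real_indicator simp: P.emeasure_eq_measure)
    also have "\<dots> = 0" using cdf[of "C \<omega>"] by (simp add: P_def cdf_def)
    finally show "(\<integral>s. h (s, \<omega>) \<partial>P) = 0" by simp
  qed
  finally show "expectation (\<lambda>\<omega>. F \<omega> * (indicator {..C \<omega>} (e \<omega>) - A (C \<omega>))) = 0" by simp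
qed

text \<open>Equal distribution functions identify \<open>P\<close> with the two-stage law that draws
  from \<open>H\<close> with probability \<open>r\<close> and from \<open>G\<close> otherwise, and
  an integral over that law can be taken stage by stage. The bound is free of \<open>r\<close>, so
  it holds for all sample sizes and alternatives at once.\<close>

lemma mixture_second_moment_le:
  assumes "real_distribution P" "real_distribution G" "real_distribution H"
    and mix: "\<And>s. cdf P s = mixture_df (cdf G) (cdf H) r s" and r: "0 \<le> r" "r \<le> 1"
    and G: "integrable G (\<lambda>s. s\<^sup>2)" and H: "integrable H (\<lambda>s. s\<^sup>2)"
  shows "(\<integral>s. s\<^sup>2 \<partial>P) \<le> (\<integral>s. s\<^sup>2 \<partial>G) + (\<integral>s. s\<^sup>2 \<partial>H)"
proof -
  interpret P: real_distribution P by fact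
  interpret G: real_distribution G by fact
  interpret H: real_distribution H by fact
  let ?b = "measure_pmf (bernoulli_pmf r)"
  define N where "N = (\<lambda>b. if b then H else G)"
  define Q where "Q = ?b \<bind> N"
  have N: "N \<in> measurable ?b (prob_algebra borel)"
    by (auto simp: N_def space_prob_algebra G.prob_space_axioms H.prob_space_axioms)
  have b: "?b \<in> space (prob_algebra (count_space UNIV))"
    by (simp add: space_prob_algebra measure_pmf.prob_space_axioms)
  have N': "N \<in> measurable (count_space UNIV) (prob_algebra borel)"
    using N by (simp add: measurable_def)
  have emQ: "emeasure Q S = (1 - ennreal r) * emeasure G S + ennreal r * emeasure H S"
    if "S \<in> sets borel" for S
    unfolding Q_def emeasure_bind_prob_algebra[OF b N' that] using r
    by (simp add: N_def nn_integral_bernoulli_pmf ennreal_minus mult.commute add.commute flip: ennreal_1)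
  have "Q \<in> space (prob_algebra borel)"
    unfolding Q_def
    by (rule measurable_space[OF measurable_bind_prob_space[OF measurable_const[OF b, of "count_space UNIV"] N'], of undefined]) simp
  then interpret Q: prob_space Q by (simp add: space_prob_algebra)
  have setsQ: "sets Q = sets borel"
    using \<open>Q \<in> space (prob_algebra borel)\<close> by (simp add: space_prob_algebra)
  interpret Q: real_distribution Q by standard (rule setsQ)
  have "cdf Q s = cdf P s" for s
  proof -
    have "ennreal (cdf Q s) = (1 - ennreal r) * ennreal (cdf G s) + ennreal r * ennreal (cdf H s)"
      using emQ[of "{..s}"] by (simp add: cdf_def Q.emeasure_eq_measure G.emeasure_eq_measure H.emeasure_eq_measure)
    also have "\<dots> = ennreal ((1 - r) * cdf G s + r * cdf H s)"
      using r G.cdf_nonneg H.cdf_nonneg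
      by (subst ennreal_plus) (auto simp: ennreal_mult ennreal_minus simp flip: ennreal_1)
    also have "(1 - r) * cdf G s + r * cdf H s = cdf P s"
      by (simp add: mix mixture_df_def)
    finally show ?thesis using Q.cdf_nonneg P.cdf_nonneg by simp
  qed
  then have "P = Q"
    using cdf_unique[of P Q] P.real_distribution_axioms Q.real_distribution_axioms by (auto simp: fun_eq_iff)
  have "(\<integral>\<^sup>+s. ennreal (s\<^sup>2) \<partial>P) = (\<integral>\<^sup>+b. \<integral>\<^sup>+s. ennreal (s\<^sup>2) \<partial>N b \<partial>?b)"
    unfolding \<open>P = Q\<close> Q_def using N
    by (intro nn_integral_bind[where B=borel] measurable_prob_algebraD) auto
  also have "\<dots> \<le> (\<integral>\<^sup>+b. (\<integral>\<^sup>+s. ennreal (s\<^sup>2) \<partial>G) + (\<integral>\<^sup>+s. ennreal (s\<^sup>2) \<partial>H) \<partial>?b)"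
    by (intro nn_integral_mono) (simp add: N_def)
  also have "\<dots> = ennreal ((\<integral>s. s\<^sup>2 \<partial>G) + (\<integral>s. s\<^sup>2 \<partial>H))"
    using G H by (simp add: nn_integral_eq_integral measure_pmf.emeasure_space_1)
  finally have "(\<integral>\<^sup>+s. ennreal (s\<^sup>2) \<partial>P) \<le> ennreal ((\<integral>s. s\<^sup>2 \<partial>G) + (\<integral>s. s\<^sup>2 \<partial>H))" .
  moreover have "(\<integral>s. s\<^sup>2 \<partial>P) = enn2real (\<integral>\<^sup>+s. ennreal (s\<^sup>2) \<partial>P)"
    by (intro integral_eq_nn_integral) auto
  ultimately show ?thesis
    by (simp add: enn2real_leI)
qed

section \<open>Smooth distribution functions\<close>

text \<open>By assumption only the second derivative is bounded. The Taylor bound over a step of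
  length one, together with values between 0 and 1, bounds the first derivative by one more than the
  bound of the second; this enlarged constant serves all estimates.\<close>

lemma smooth_cdf_bounds:
  assumes "real_distribution D" "twice_diff_bounded (cdf D)"
  obtains L where "L \<ge> 0" "\<And>x. \<bar>deriv (cdf D) x\<bar> \<le> L" "\<And>x y. \<bar>cdf D x - cdf D y\<bar> \<le> L * \<bar>x - y\<bar>"
    "\<And>x s. \<bar>cdf D (x + s) - cdf D x - deriv (cdf D) x * s\<bar> \<le> L * s\<^sup>2"
proof -
  interpret real_distribution D by fact
  let ?F = "cdf D"
  from assms(2) obtain L where L: "\<And>x. \<bar>deriv (deriv ?F) x\<bar> \<le> L"
    unfolding twice_diff_bounded_def bounded_iff by auto
  have L0: "0 \<le> L" using L[of 0] by linarith
  have d1: "(?F has_real_derivative deriv ?F x) (at x)" for x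
    using assms(2) by (auto simp: twice_diff_bounded_def DERIV_deriv_iff_real_differentiable)
  have d2: "(deriv ?F has_real_derivative deriv (deriv ?F) x) (at x)" for x
    using assms(2) by (auto simp: twice_diff_bounded_def DERIV_deriv_iff_real_differentiable)
  have mvt: "\<exists>\<xi>. \<bar>\<xi> - x\<bar> \<le> \<bar>y - x\<bar> \<and> f y - f x = f' \<xi> * (y - x)"
    if der: "\<And>x. (f has_real_derivative f' x) (at x)" for f f' :: "real \<Rightarrow> real" and x y
  proof (cases x y rule: linorder_cases)
    case less
    then obtain \<xi> where "x < \<xi>" "\<xi> < y" "f y - f x = (y - x) * f' \<xi>"
      using MVT2[OF less der] by blast
    then show ?thesis by (intro exI[of _ \<xi>]) (auto simp: mult.commute)
  next
    case greater
    then obtain \<xi> where "y < \<xi>" "\<xi> < x" "f x - f y = (x - y) * f' \<xi>"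
      using MVT2[OF greater der] by blast
    then show ?thesis by (intro exI[of _ \<xi>]) (auto simp: algebra_simps)
  qed auto
  have lip: "\<bar>deriv ?F y - deriv ?F x\<bar> \<le> L * \<bar>y - x\<bar>" for x y
    using mvt[OF d2, of x y] L by (auto simp: abs_mult mult_right_mono)
  have taylor: "\<bar>?F (x + s) - ?F x - deriv ?F x * s\<bar> \<le> L * s\<^sup>2" for x s
  proof -
    obtain \<xi> where \<xi>: "\<bar>\<xi> - x\<bar> \<le> \<bar>s\<bar>" "?F (x + s) - ?F x = deriv ?F \<xi> * s"
      using mvt[OF d1, of x "x + s"] by auto
    then have "\<bar>?F (x + s) - ?F x - deriv ?F x * s\<bar> = \<bar>deriv ?F \<xi> - deriv ?F x\<bar> * \<bar>s\<bar>"
      by (simp add: left_diff_distrib flip: abs_mult)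
    also have "\<dots> \<le> (L * \<bar>s\<bar>) * \<bar>s\<bar>"
      using \<xi>(1) lip[of \<xi> x] L0 by (intro mult_right_mono order.trans[OF lip mult_left_mono]) auto
    finally show ?thesis by (simp add: power2_eq_square)
  qed
  have bound: "\<bar>deriv ?F x\<bar> \<le> L + 1" for x
    using taylor[of x 1] cdf_nonneg[of x] cdf_nonneg[of "x + 1"] cdf_bounded_prob[of x]
      cdf_bounded_prob[of "x + 1"] by simp
  have "\<bar>?F x - ?F y\<bar> \<le> (L + 1) * \<bar>x - y\<bar>" for x y
    using mvt[OF d1, of y x] bound by (auto simp: abs_mult mult_right_mono)
  moreover have "\<bar>?F (x + s) - ?F x - deriv ?F x * s\<bar> \<le> (L + 1) * s\<^sup>2" for x s
    by (rule order.trans[OF taylor]) (simp add: distrib_right)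
  ultimately show ?thesis
    using bound L0 by (intro that[of "L + 1"]) auto
qed

lemma deriv_symmetric_cdf:
  fixes F :: "real \<Rightarrow> real"
  assumes sym: "\<And>s. F (- s) = 1 - F s" and diff: "\<And>x. F differentiable (at x)"
  shows "deriv F (- x) = deriv F x"
proof -
  have d: "(F has_real_derivative deriv F y) (at y)" for y
    using diff by (simp add: DERIV_deriv_iff_real_differentiable)
  have "((\<lambda>s. F (- s)) has_real_derivative deriv F (- x) * - 1) (at x)"
    by (rule DERIV_chain2[OF d]) (auto intro!: derivative_eq_intros)
  moreover have "((\<lambda>s. F (- s)) has_real_derivative - deriv F x) (at x)"
    unfolding sym by (auto intro!: derivative_eq_intros d)
  ultimately show ?thesis
    using DERIV_unique by fastforce
qed

text \<open>With slopes \<open>g\<close> and \<open>h\<close> at \<open>x\<close>, the mixture has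
  slope \<open>g + r * (h - g)\<close>, which is within \<open>2 * L * r\<close> of
  \<open>g\<close>. Keeping \<open>g\<close> as the slope makes the linear term the same for all
  sample sizes and alternatives and moves the difference into an error of order
  \<open>r * \<bar>s\<bar>\<close>.\<close>

lemma mixture_df_bounds:
  fixes g h L :: real
  assumes r: "0 \<le> r" "r \<le> 1"
    and G: "\<And>x y. \<bar>G x - G y\<bar> \<le> L * \<bar>x - y\<bar>" "\<And>s. \<bar>G (x + s) - G x - g * s\<bar> \<le> L * s\<^sup>2" "\<bar>g\<bar> \<le> L"
      "\<And>s. 0 \<le> G s" "\<And>s. G s \<le> 1"
    and H: "\<And>x y. \<bar>H x - H y\<bar> \<le> L * \<bar>x - y\<bar>" "\<And>s. \<bar>H (x + s) - H x - h * s\<bar> \<le> L * s\<^sup>2" "\<bar>h\<bar> \<le> L"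
      "\<And>s. 0 \<le> H s" "\<And>s. H s \<le> 1"
  shows "\<bar>mixture_df G H r a - mixture_df G H r b\<bar> \<le> L * \<bar>a - b\<bar>"
    and "\<bar>mixture_df G H r (x + s) - mixture_df G H r x - g * s\<bar> \<le> L * s\<^sup>2 + (2 * L * r) * \<bar>s\<bar>"
    and "\<bar>mixture_df G H r a - G a\<bar> \<le> r"
proof -
  have "\<bar>mixture_df G H r a - mixture_df G H r b\<bar> = \<bar>(1 - r) * (G a - G b) + r * (H a - H b)\<bar>"
    by (simp add: mixture_df_def algebra_simps)
  also have "\<dots> \<le> (1 - r) * \<bar>G a - G b\<bar> + r * \<bar>H a - H b\<bar>"
    using r by (intro order.trans[OF abs_triangle_ineq]) (simp add: abs_mult)
  also have "\<dots> \<le> (1 - r) * (L * \<bar>a - b\<bar>) + r * (L * \<bar>a - b\<bar>)"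
    using r by (intro add_mono mult_left_mono G H) auto
  finally show "\<bar>mixture_df G H r a - mixture_df G H r b\<bar> \<le> L * \<bar>a - b\<bar>"
    by (simp add: algebra_simps)
  have "\<bar>mixture_df G H r (x + s) - mixture_df G H r x - g * s\<bar> =
      \<bar>(1 - r) * (G (x + s) - G x - g * s) + r * (H (x + s) - H x - h * s) + r * ((h - g) * s)\<bar>"
    by (simp add: mixture_df_def algebra_simps)
  also have "\<dots> \<le> (1 - r) * \<bar>G (x + s) - G x - g * s\<bar> + r * \<bar>H (x + s) - H x - h * s\<bar> + r * (\<bar>h - g\<bar> * \<bar>s\<bar>)"
    using r by (intro order.trans[OF abs_triangle_ineq] add_mono) (simp_all add: abs_mult)
  also have "\<dots> \<le> (1 - r) * (L * s\<^sup>2) + r * (L * s\<^sup>2) + r * ((2 * L) * \<bar>s\<bar>)"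
    using r G(3) H(3) by (intro add_mono mult_left_mono mult_right_mono G H) auto
  finally show "\<bar>mixture_df G H r (x + s) - mixture_df G H r x - g * s\<bar> \<le> L * s\<^sup>2 + (2 * L * r) * \<bar>s\<bar>"
    by (simp add: algebra_simps)
  have "\<bar>mixture_df G H r a - G a\<bar> = r * \<bar>H a - G a\<bar>"
    using r by (simp add: mixture_df_def algebra_simps flip: abs_mult_pos abs_mult)
      (metis abs_mult abs_of_nonneg right_diff_distrib)
  also have "\<dots> \<le> r * 1"
    using r G(4,5)[of a] H(4,5)[of a] by (intro mult_left_mono) auto
  finally show "\<bar>mixture_df G H r a - G a\<bar> \<le> r" by simp
qed

section \<open>The joint law of innovations, indicators and outlier sizes\<close>

context outlier_ar_model
begin

definition noise :: "nat \<times> int \<Rightarrow> 'a \<Rightarrow> real" where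
  "noise = (\<lambda>(k, t). ([\<epsilon>, z, \<xi>] ! k) t)"

definition noise_index :: "(nat \<times> int) set" where
  "noise_index = {..<3} \<times> UNIV"

lemma noise_simps: "noise (0, t) = \<epsilon> t" "noise (1, t) = z t" "noise (Suc 0, t) = z t" "noise (2, t) = \<xi> t"
  by (simp_all add: noise_def numeral_2_eq_2)

lemma indep_noise: "indep_vars (\<lambda>_. borel) noise noise_index"
  unfolding noise_def noise_index_def
proof (rule indep_vars_flatten)
  show "indep_vars (\<lambda>_. borel) (([\<epsilon>, z, \<xi>] ! k)) UNIV" if "k \<in> {..<3}" for k
  proof -
    have "k = 0 \<or> k = 1 \<or> k = 2" using that by auto
    then show ?thesis
      using innovations_indep indicators_indep outliers_indep by (auto simp: numeral_2_eq_2)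
  qed
qed (rule sequences_indep)

lemma measurable_innovation [measurable]: "\<epsilon> t \<in> borel_measurable M"
  and measurable_indicator [measurable]: "z t \<in> borel_measurable M"
  and measurable_outlier [measurable]: "\<xi> t \<in> borel_measurable M"
  using innovations_indep indicators_indep outliers_indep by (simp_all add: indep_vars_def2)

lemma expectation_prod_noise:
  assumes I: "finite I" "I \<subseteq> noise_index" and h: "\<And>i. i \<in> I \<Longrightarrow> h i \<in> borel_measurable borel"
    and int: "\<And>i. i \<in> I \<Longrightarrow> integrable M (\<lambda>\<omega>. h i (noise i \<omega>))"
  shows "integrable M (\<lambda>\<omega>. \<Prod>i\<in>I. h i (noise i \<omega>))"
    and "expectation (\<lambda>\<omega>. \<Prod>i\<in>I. h i (noise i \<omega>)) = (\<Prod>i\<in>I. expectation (\<lambda>\<omega>. (h i (noise i \<omega>) :: real)))"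
proof -
  have "indep_vars (\<lambda>_. borel) (\<lambda>i \<omega>. h i (noise i \<omega>)) I"
    using indep_vars_subset[OF indep_noise I(2)] h by (rule indep_vars_compose2)
  then show "integrable M (\<lambda>\<omega>. \<Prod>i\<in>I. h i (noise i \<omega>))"
    and "expectation (\<lambda>\<omega>. \<Prod>i\<in>I. h i (noise i \<omega>)) = (\<Prod>i\<in>I. expectation (\<lambda>\<omega>. h i (noise i \<omega>)))"
    using I(1) int by (auto intro: indep_vars_integrable indep_vars_lebesgue_integral)
qed

lemma indicator_prob_bounds: "0 \<le> q" "q \<le> 1"
  using indicators_law(1)[of 0, symmetric] by auto

text \<open>The model prescribes the probabilities of the values 1 and 0 only. They add up to one,
  so other values form a null set, and pathwise arguments about outliers hold almost surely.\<close>

lemma AE_indicator: "AE \<omega> in M. z t \<omega> \<in> {0, 1}"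
proof -
  have "prob ({\<omega> \<in> space M. z t \<omega> = 0} \<union> {\<omega> \<in> space M. z t \<omega> = 1}) =
      prob {\<omega> \<in> space M. z t \<omega> = 0} + prob {\<omega> \<in> space M. z t \<omega> = 1}"
    by (rule finite_measure_Union) auto
  also have "\<dots> = 1" by (simp add: indicators_law)
  finally have "AE \<omega> in M. \<omega> \<in> {\<omega> \<in> space M. z t \<omega> = 0} \<union> {\<omega> \<in> space M. z t \<omega> = 1}"
    by (intro AE_prob_1)
  then show ?thesis by eventually_elim auto
qed

lemma integrable_indicator_variable: "integrable M (z t)"
  using AE_indicator[of t] by (intro integrable_const_bound[where B=1]) (auto elim!: AE_mp)

lemma expectation_indicator: "expectation (z t) = q"
proof -
  have "expectation (z t) = expectation (indicator {\<omega> \<in> space M. z t \<omega> = 1})"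
    using AE_indicator[of t] by (intro integral_cong_AE) (auto elim!: AE_mp simp: indicator_def)
  then show ?thesis by (simp add: indicators_law)
qed

lemma expectation_innovations:
  assumes "s \<noteq> t"
  shows "integrable M (\<lambda>\<omega>. \<epsilon> s \<omega> * \<epsilon> t \<omega>)" "expectation (\<lambda>\<omega>. \<epsilon> s \<omega> * \<epsilon> t \<omega>) = 0"
proof -
  have "integrable M (\<lambda>\<omega>. (\<lambda>x. x) (noise i \<omega>))" if "i \<in> {(0, s), (0, t)}" for i
    using that innovations_mean by (auto simp: noise_simps)
  from expectation_prod_noise[of "{(0, s), (0, t)}" "\<lambda>_ x. x", OF _ _ _ this]
  show "integrable M (\<lambda>\<omega>. \<epsilon> s \<omega> * \<epsilon> t \<omega>)" "expectation (\<lambda>\<omega>. \<epsilon> s \<omega> * \<epsilon> t \<omega>) = 0"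
    using assms innovations_mean by (auto simp: noise_simps noise_index_def)
qed

lemma expectation_indicators:
  assumes "s \<noteq> t"
  shows "integrable M (\<lambda>\<omega>. z s \<omega> * z t \<omega>)" "expectation (\<lambda>\<omega>. z s \<omega> * z t \<omega>) = q\<^sup>2"
proof -
  have "integrable M (\<lambda>\<omega>. (\<lambda>x. x) (noise i \<omega>))" if "i \<in> {(1, s), (1, t)}" for i
    using that integrable_indicator_variable by (auto simp: noise_simps)
  from expectation_prod_noise[of "{(1, s), (1, t)}" "\<lambda>_ x. x", OF _ _ _ this]
  show "integrable M (\<lambda>\<omega>. z s \<omega> * z t \<omega>)" "expectation (\<lambda>\<omega>. z s \<omega> * z t \<omega>) = q\<^sup>2"
    using assms by (auto simp: noise_simps noise_index_def expectation_indicator power2_eq_square)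
qed

lemma expectation_outlier:
  assumes h: "h \<in> borel_measurable borel" and b: "\<And>s. \<bar>h s\<bar> \<le> (1::real)"
  shows "integrable M (\<lambda>\<omega>. z t \<omega> * h (\<xi> t \<omega>))"
    and "expectation (\<lambda>\<omega>. z t \<omega> * h (\<xi> t \<omega>)) = q * (\<integral>s. h s \<partial>P\<^sub>\<xi>)"
    and "s \<noteq> t \<Longrightarrow> expectation (\<lambda>\<omega>. (z s \<omega> * h (\<xi> s \<omega>)) * (z t \<omega> * h (\<xi> t \<omega>))) = (q * (\<integral>s. h s \<partial>P\<^sub>\<xi>))\<^sup>2"
proof -
  note [measurable] = h
  \<comment> \<open>Indicators keep their values and sizes pass through \<open>h\<close>, so one
    product formula over noise indices gives both the mean and the product moment at two
    times.\<close>
  define g where "g i = (if fst i = (1::nat) then (\<lambda>x. x) else h)" for i :: "nat \<times> int"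
  have [simp]: "g (Suc 0, t) = (\<lambda>x. x)" "g (2, t) = h" for t by (simp_all add: g_def)
  have hm: "g i \<in> borel_measurable borel" for i by (simp add: g_def)
  have \<xi>: "integrable M (\<lambda>\<omega>. h (\<xi> t \<omega>))" for t
    using b by (intro integrable_const_bound[where B=1]) auto
  have E\<xi>: "expectation (\<lambda>\<omega>. h (\<xi> t \<omega>)) = (\<integral>s. h s \<partial>P\<^sub>\<xi>)" for t
    unfolding outliers_law[of t, symmetric] by (simp add: integral_distr)
  have int: "integrable M (\<lambda>\<omega>. g i (noise i \<omega>))" if "i \<in> {1, 2} \<times> UNIV" for i
    using that \<xi> integrable_indicator_variable by (auto simp: noise_simps)
  note prod = expectation_prod_noise[of _ g, OF _ _ hm int]
  show "integrable M (\<lambda>\<omega>. z t \<omega> * h (\<xi> t \<omega>))"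
    and "expectation (\<lambda>\<omega>. z t \<omega> * h (\<xi> t \<omega>)) = q * (\<integral>s. h s \<partial>P\<^sub>\<xi>)"
    using prod[of "{(1, t), (2, t)}"]
    by (auto simp: noise_simps noise_index_def expectation_indicator E\<xi>)
  show "expectation (\<lambda>\<omega>. (z s \<omega> * h (\<xi> s \<omega>)) * (z t \<omega> * h (\<xi> t \<omega>))) = (q * (\<integral>s. h s \<partial>P\<^sub>\<xi>))\<^sup>2" if "s \<noteq> t"
    using prod(2)[of "{(1, s), (2, s), (1, t), (2, t)}"] that
    by (auto simp: noise_simps noise_index_def expectation_indicator E\<xi> power2_eq_square mult.assoc mult.left_commute)
qed

section \<open>Predictable thresholds\<close>

text \<open>Indicators and sizes of all times are included, even future ones. They are independent
  of the innovations, so leaving out the innovations from time \<open>t\<close> on is enough to make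
  \<open>\<epsilon> t\<close> independent of this past.\<close>

definition past_index :: "int \<Rightarrow> (nat \<times> int) set" where
  "past_index t = noise_index - {0} \<times> {t..}"

definition past :: "int \<Rightarrow> 'a measure" where
  "past t = vimage_algebra (space M) (\<lambda>\<omega>. restrict (\<lambda>i. noise i \<omega>) (past_index t)) (PiM (past_index t) (\<lambda>_. borel))"

lemma measurable_noise: "i \<in> noise_index \<Longrightarrow> noise i \<in> borel_measurable M"
  using indep_noise by (simp add: indep_vars_def2)

lemma past_restrict: "(\<lambda>\<omega>. restrict (\<lambda>i. noise i \<omega>) (past_index t)) \<in> measurable M (PiM (past_index t) (\<lambda>_. borel))"
  by (intro measurable_restrict measurable_noise) (auto simp: past_index_def)

lemma space_past: "space (past t) = space M"
  by (simp add: past_def)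

lemma sets_past: "sets (past t) =
    {(\<lambda>\<omega>. restrict (\<lambda>i. noise i \<omega>) (past_index t)) -` B \<inter> space M |B. B \<in> sets (PiM (past_index t) (\<lambda>_. borel))}"
  unfolding past_def using past_restrict by (intro sets_vimage_algebra2) (auto dest: measurable_space)

lemma sets_past_le: "sets (past t) \<subseteq> events"
  unfolding sets_past using past_restrict by (auto intro: measurable_sets)

lemma measurable_past_noise: "i \<in> past_index t \<Longrightarrow> noise i \<in> borel_measurable (past t)"
proof -
  assume i: "i \<in> past_index t"
  have "(\<lambda>\<omega>. restrict (\<lambda>i. noise i \<omega>) (past_index t)) \<in> measurable (past t) (PiM (past_index t) (\<lambda>_. borel))"
    unfolding past_def using past_restrict by (intro measurable_vimage_algebra1) (auto dest: measurable_space)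
  from measurable_compose[OF this measurable_component_singleton[OF i]]
  show ?thesis using i by simp
qed

lemma measurable_past:
  shows "s < t \<Longrightarrow> \<epsilon> s \<in> borel_measurable (past t)"
    and "z u \<in> borel_measurable (past t)" and "\<xi> u \<in> borel_measurable (past t)"
  using measurable_past_noise[of "(0, s)" t] measurable_past_noise[of "(1, u)" t]
    measurable_past_noise[of "(2, u)" t]
  by (auto simp: noise_simps past_index_def noise_index_def)

text \<open>The index \<open>(0, t)\<close> lies outside \<open>past_index t\<close>, so the
  innovation and the past are functions of disjoint groups of independent variables.\<close>

lemma indep_innovation_past: "indep_set {\<epsilon> t -` B \<inter> space M |B. B \<in> sets borel} (sets (past t))"
proof -
  let ?r = "\<lambda>K \<omega>. restrict (\<lambda>i. noise i \<omega>) K"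
  have "indep_var (PiM {(0, t)} (\<lambda>_. borel)) (?r {(0, t)}) (PiM (past_index t) (\<lambda>_. borel)) (?r (past_index t))"
    by (rule indep_var_restrict[OF indep_noise]) (auto simp: past_index_def noise_index_def)
  then have ind: "indep_set (sigma_sets (space M) {?r {(0, t)} -` A \<inter> space M |A. A \<in> sets (PiM {(0, t)} (\<lambda>_. borel))})
      (sigma_sets (space M) {?r (past_index t) -` A \<inter> space M |A. A \<in> sets (PiM (past_index t) (\<lambda>_. borel))})"
    by (simp add: indep_var_eq)
  have 1: "\<epsilon> t -` B \<inter> space M \<in> sigma_sets (space M) {?r {(0, t)} -` A \<inter> space M |A. A \<in> sets (PiM {(0, t)} (\<lambda>_. borel))}"
    if "B \<in> sets borel" for B
  proof -
    have "\<epsilon> t -` B \<inter> space M = ?r {(0, t)} -` ((\<lambda>f. f (0, t)) -` B \<inter> space (PiM {(0, t)} (\<lambda>_. borel))) \<inter> space M"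
      by (auto simp: noise_simps space_PiM)
    moreover have "(\<lambda>f. f (0, t)) -` B \<inter> space (PiM {(0, t)} (\<lambda>_. borel)) \<in> sets (PiM {(0::nat, t)} (\<lambda>_. borel))"
      using that by (intro measurable_sets[OF measurable_component_singleton]) auto
    ultimately show ?thesis by (intro sigma_sets.Basic) blast
  qed
  have 2: "sets (past t) \<subseteq> sigma_sets (space M) {?r (past_index t) -` A \<inter> space M |A. A \<in> sets (PiM (past_index t) (\<lambda>_. borel))}"
    unfolding sets_past by (rule subsetI) (rule sigma_sets.Basic)
  have mono: "indep_set S' T'" if "indep_set S T" "S' \<subseteq> S" "T' \<subseteq> T" for S S' T T'
    using that unfolding indep_sets2_eq by blast
  show ?thesis
    by (rule mono[OF ind _ 2]) (use 1 in auto)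
qed

lemma expectation_threshold_centered:
  assumes F: "F \<in> borel_measurable (past t)" "\<And>\<omega>. \<bar>F \<omega>\<bar> \<le> K" and c: "c \<in> borel_measurable (past t)"
  shows "integrable M (\<lambda>\<omega>. F \<omega> * (indicator {..c \<omega>} (\<epsilon> t \<omega>) - A (c \<omega>)))"
    and "expectation (\<lambda>\<omega>. F \<omega> * (indicator {..c \<omega>} (\<epsilon> t \<omega>) - A (c \<omega>))) = 0"
  using expectation_predictable_indicator[OF _ space_past sets_past_le indep_innovation_past F c innovations_cdf]
  by auto

end

text \<open>
  The last term makes \<open>lin_shift\<close> with slack \<open>\<eta>\<close> and \<open>- \<eta>\<close> an upper and a lower bracket for all
  coefficients within \<open>\<eta>\<close> of \<open>\<tau>\<close> and \<open>\<theta>\<close>.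
\<close>

definition lin_shift :: "nat \<Rightarrow> real \<Rightarrow> (nat \<Rightarrow> real) \<Rightarrow> real \<Rightarrow> (int \<Rightarrow> real) \<Rightarrow> int \<Rightarrow> real" where
  "lin_shift p \<tau> \<theta> \<eta> X t =
     \<tau> + (\<Sum>j=1..p. \<theta> j * X (t - int j)) + \<eta> * (1 + (\<Sum>j=1..p. \<bar>X (t - int j)\<bar>))"

text \<open>One constant with two roles: multiplied by the Euclidean norm of the vector of 1 and the
  lagged values it bounds the shift, and it is a Lipschitz constant of the shift for the sum of
  absolute changes of the lagged values.\<close>

definition shift_size :: "nat \<Rightarrow> real \<Rightarrow> (nat \<Rightarrow> real) \<Rightarrow> real \<Rightarrow> real" where
  "shift_size p \<tau> \<theta> \<eta> = \<bar>\<tau>\<bar> + \<bar>\<eta>\<bar> + (\<Sum>j=1..p. \<bar>\<theta> j\<bar> + \<bar>\<eta>\<bar>)"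

lemma shift_size_nonneg: "0 \<le> shift_size p \<tau> \<theta> \<eta>"
  by (auto simp: shift_size_def intro!: add_nonneg_nonneg sum_nonneg)

lemma lin_shift_square_le:
  "(lin_shift p \<tau> \<theta> \<eta> X t)\<^sup>2 \<le> (shift_size p \<tau> \<theta> \<eta>)\<^sup>2 * (1 + (\<Sum>j=1..p. (X (t - int j))\<^sup>2))"
proof -
  define S where "S = sqrt (1 + (\<Sum>j=1..p. (X (t - int j))\<^sup>2))"
  have S2: "S\<^sup>2 = 1 + (\<Sum>j=1..p. (X (t - int j))\<^sup>2)"
    unfolding S_def by (intro real_sqrt_pow2 add_nonneg_nonneg sum_nonneg) auto
  have S1: "1 \<le> S"
    unfolding S_def by (simp add: sum_nonneg)
  have XS: "\<bar>X (t - int j)\<bar> \<le> S" if "j \<in> {1..p}" for j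
  proof -
    have "(X (t - int j))\<^sup>2 \<le> (\<Sum>j=1..p. (X (t - int j))\<^sup>2)"
      using that by (intro member_le_sum) auto
    then show ?thesis unfolding S_def by (intro real_le_rsqrt) simp
  qed
  have "\<bar>lin_shift p \<tau> \<theta> \<eta> X t\<bar> \<le>
      \<bar>\<tau>\<bar> + (\<Sum>j=1..p. \<bar>\<theta> j\<bar> * \<bar>X (t - int j)\<bar>) + \<bar>\<eta>\<bar> * (1 + (\<Sum>j=1..p. \<bar>X (t - int j)\<bar>))"
    unfolding lin_shift_def
    by (intro order.trans[OF abs_triangle_ineq] add_mono order_refl order.trans[OF sum_abs])
      (auto simp: abs_mult sum_nonneg intro!: sum_mono)
  also have "\<dots> \<le> \<bar>\<tau>\<bar> * S + (\<Sum>j=1..p. \<bar>\<theta> j\<bar> * S) + \<bar>\<eta>\<bar> * (S + (\<Sum>j=1..p. S))"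
    using S1 XS by (intro add_mono sum_mono mult_left_mono) (auto simp: mult_le_cancel_left1)
  also have "\<dots> = shift_size p \<tau> \<theta> \<eta> * S"
    by (simp add: shift_size_def algebra_simps sum.distrib sum_distrib_left)
  finally have "\<bar>lin_shift p \<tau> \<theta> \<eta> X t\<bar>\<^sup>2 \<le> (shift_size p \<tau> \<theta> \<eta> * S)\<^sup>2"
    by (intro power_mono) auto
  then show ?thesis by (simp add: power_mult_distrib S2)
qed

lemma lin_shift_diff_le:
  "\<bar>lin_shift p \<tau> \<theta> \<eta> (\<lambda>s. X s + w s) t - lin_shift p \<tau> \<theta> \<eta> X t\<bar>
     \<le> shift_size p \<tau> \<theta> \<eta> * (\<Sum>j=1..p. \<bar>w (t - int j)\<bar>)"
proof -
  have "lin_shift p \<tau> \<theta> \<eta> (\<lambda>s. X s + w s) t - lin_shift p \<tau> \<theta> \<eta> X t =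
      (\<Sum>j=1..p. \<theta> j * w (t - int j) + \<eta> * (\<bar>X (t - int j) + w (t - int j)\<bar> - \<bar>X (t - int j)\<bar>))"
    by (simp add: lin_shift_def algebra_simps sum.distrib sum_subtractf sum_distrib_left)
  also have "\<bar>\<dots>\<bar> \<le> (\<Sum>j=1..p. (\<bar>\<theta> j\<bar> + \<bar>\<eta>\<bar>) * \<bar>w (t - int j)\<bar>)"
  proof (intro order.trans[OF sum_abs] sum_mono)
    fix j
    have "\<bar>\<eta>\<bar> * \<bar>\<bar>X (t - int j) + w (t - int j)\<bar> - \<bar>X (t - int j)\<bar>\<bar> \<le> \<bar>\<eta>\<bar> * \<bar>w (t - int j)\<bar>"
      by (intro mult_left_mono) auto
    then show "\<bar>\<theta> j * w (t - int j) + \<eta> * (\<bar>X (t - int j) + w (t - int j)\<bar> - \<bar>X (t - int j)\<bar>)\<bar>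
        \<le> (\<bar>\<theta> j\<bar> + \<bar>\<eta>\<bar>) * \<bar>w (t - int j)\<bar>"
      by (intro order.trans[OF abs_triangle_ineq]) (simp add: abs_mult distrib_right)
  qed
  also have "\<dots> \<le> (\<Sum>j=1..p. shift_size p \<tau> \<theta> \<eta> * \<bar>w (t - int j)\<bar>)"
  proof (intro sum_mono mult_right_mono)
    fix j assume "j \<in> {1..p}"
    then have "\<bar>\<theta> j\<bar> + \<bar>\<eta>\<bar> \<le> (\<Sum>j=1..p. \<bar>\<theta> j\<bar> + \<bar>\<eta>\<bar>)"
      by (intro member_le_sum) auto
    then show "\<bar>\<theta> j\<bar> + \<bar>\<eta>\<bar> \<le> shift_size p \<tau> \<theta> \<eta>" by (simp add: shift_size_def)
  qed auto
  finally show ?thesis by (simp add: sum_distrib_left)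
qed

section \<open>Martingale sums with predictable thresholds, and moments of the truncated moving
  average\<close>

context outlier_ar_model
begin

lemma cdf_innovation_bounds: "0 \<le> A s" "A s \<le> 1" "mono A"
proof -
  interpret D: real_distribution "distr M borel (\<epsilon> 0)" by simp
  show "0 \<le> A s" "A s \<le> 1" "mono A"
    using D.cdf_nonneg[of s] D.cdf_bounded_prob[of s] D.cdf_nondecreasing
    by (auto simp: innovations_cdf mono_def)
qed

lemma measurable_A [measurable]: "A \<in> borel_measurable borel"
  using cdf_innovation_bounds(3) by (rule borel_measurable_mono)

text \<open>The \<open>X t\<close> are martingale differences, hence orthogonal, and the second
  moment of the sum is the sum of the second moments. Each of these is controlled by the probability
  that the innovation falls between the thresholds \<open>x\<close> and \<open>x + c t\<close>, so
  it is small when the threshold moves little.\<close>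

lemma expectation_centered_indicator_sum:
  fixes c :: "int \<Rightarrow> 'a \<Rightarrow> real" and x :: real
  assumes T: "finite T" and c: "\<And>s t. s \<le> t \<Longrightarrow> c s \<in> borel_measurable (past t)"
  defines "X \<equiv> \<lambda>t \<omega>. indicator {..x + c t \<omega>} (\<epsilon> t \<omega>) - indicator {..x} (\<epsilon> t \<omega>) - (A (x + c t \<omega>) - A x)"
  shows "integrable M (\<lambda>\<omega>. (\<Sum>t\<in>T. X t \<omega>)\<^sup>2)"
    and "expectation (\<lambda>\<omega>. (\<Sum>t\<in>T. X t \<omega>)\<^sup>2) \<le> (\<Sum>t\<in>T. expectation (\<lambda>\<omega>. \<bar>A (x + c t \<omega>) - A x\<bar>))"
proof -
  have pastM: "f \<in> borel_measurable M" if "f \<in> borel_measurable (past t)" for f :: "'a \<Rightarrow> real" and t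
    using that space_past[of t] sets_past_le[of t] by (auto simp: measurable_def)
  have cM[measurable]: "c t \<in> borel_measurable M" for t
    using c[of t t] by (intro pastM) auto
  have A1: "\<bar>A s - A u\<bar> \<le> 1" for s u
    using cdf_innovation_bounds(1)[of s] cdf_innovation_bounds(2)[of s]
      cdf_innovation_bounds(1)[of u] cdf_innovation_bounds(2)[of u] by auto
  have Xb: "\<bar>X t \<omega>\<bar> \<le> 2" for t \<omega>
    using A1[of "x + c t \<omega>" x] by (auto simp: X_def indicator_def)
  have XM[measurable]: "X t \<in> borel_measurable M" for t
    unfolding X_def indicator_def atMost_iff by measurable
  have Xpast: "X s \<in> borel_measurable (past t)" if "s < t" for s t
  proof -
    have [measurable]: "c s \<in> borel_measurable (past t)" "\<epsilon> s \<in> borel_measurable (past t)"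
      using c that measurable_past(1) by auto
    show ?thesis unfolding X_def indicator_def atMost_iff by measurable
  qed
  \<comment> \<open>This is conditional mean zero in weak form: \<open>X t\<close> is orthogonal to
    every bounded function of the past. Below, \<open>F\<close> is first an earlier
    \<open>X s\<close> and then a predictable factor in the variance bound.\<close>
  have FX: "integrable M (\<lambda>\<omega>. F \<omega> * X t \<omega>)" "expectation (\<lambda>\<omega>. F \<omega> * X t \<omega>) = 0"
    if F: "F \<in> borel_measurable (past t)" "\<And>\<omega>. \<bar>F \<omega>\<bar> \<le> K" for F t K
  proof -
    have [measurable]: "c t \<in> borel_measurable (past t)" using c by auto
    have *: "F \<omega> * X t \<omega> = F \<omega> * (indicator {..x + c t \<omega>} (\<epsilon> t \<omega>) - A (x + c t \<omega>)) -
        F \<omega> * (indicator {..x} (\<epsilon> t \<omega>) - A x)" for \<omega>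
      by (simp add: X_def algebra_simps)
    note 1 = expectation_threshold_centered[OF F, of "\<lambda>\<omega>. x + c t \<omega>"] expectation_threshold_centered[OF F, of "\<lambda>\<omega>. x"]
    show "integrable M (\<lambda>\<omega>. F \<omega> * X t \<omega>)" "expectation (\<lambda>\<omega>. F \<omega> * X t \<omega>) = 0"
      unfolding * using 1 by simp_all
  qed
  have XX: "integrable M (\<lambda>\<omega>. X s \<omega> * X t \<omega>)" for s t
  proof (rule integrable_const_bound[where B="2 * 2"])
    have "\<bar>X s \<omega>\<bar> * \<bar>X t \<omega>\<bar> \<le> 2 * 2" for \<omega>
      by (intro mult_mono Xb) auto
    then show "AE \<omega> in M. norm (X s \<omega> * X t \<omega>) \<le> 2 * 2"
      by (simp add: abs_mult)
  qed simp
  have orth: "expectation (\<lambda>\<omega>. X s \<omega> * X t \<omega>) = 0" if "s \<noteq> t" for s t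
  proof (cases "s < t")
    case True
    then show ?thesis using FX(2)[OF Xpast Xb] by simp
  next
    case False
    then show ?thesis using FX(2)[OF Xpast Xb, of t s] that by (simp add: mult.commute)
  qed
  show "integrable M (\<lambda>\<omega>. (\<Sum>t\<in>T. X t \<omega>)\<^sup>2)"
    using T XX orth by (rule expectation_sum_square_orthogonal)
  have "expectation (\<lambda>\<omega>. (\<Sum>t\<in>T. X t \<omega>)\<^sup>2) = (\<Sum>t\<in>T. expectation (\<lambda>\<omega>. (X t \<omega>)\<^sup>2))"
    using T XX orth by (rule expectation_sum_square_orthogonal)
  also have "\<dots> \<le> (\<Sum>t\<in>T. expectation (\<lambda>\<omega>. \<bar>A (x + c t \<omega>) - A x\<bar>))"
  proof (rule sum_mono)
    fix t
    have [measurable]: "c t \<in> borel_measurable (past t)" using c by auto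
    let ?D = "\<lambda>\<omega>. A (x + c t \<omega>) - A x"
    define F where "F \<omega> = (if c t \<omega> \<ge> 0 then 1 else - 1) - 2 * ?D \<omega>" for \<omega>
    have F: "F \<in> borel_measurable (past t)" unfolding F_def by measurable
    have Fb: "\<bar>F \<omega>\<bar> \<le> 3" for \<omega> using A1[of "x + c t \<omega>" x] by (auto simp: F_def)
    \<comment> \<open>The indicator difference \<open>I\<close> satisfies \<open>I\<^sup>2 = \<sigma> I\<close> with a predictable sign \<open>\<sigma>\<close>, so the second
      moment of \<open>X\<close> is bounded without computing a conditional variance.\<close>
    have pw: "(X t \<omega>)\<^sup>2 \<le> F \<omega> * X t \<omega> + \<bar>?D \<omega>\<bar>" for \<omega>
    proof -
      define I where "I = (indicator {..x + c t \<omega>} (\<epsilon> t \<omega>) - indicator {..x} (\<epsilon> t \<omega>) :: real)"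
      define \<sigma> where "\<sigma> = (if c t \<omega> \<ge> 0 then 1 else - 1 :: real)"
      have 1: "I\<^sup>2 = \<sigma> * I" by (auto simp: I_def \<sigma>_def indicator_def)
      have 2: "\<sigma> * ?D \<omega> \<le> \<bar>?D \<omega>\<bar>" "- (?D \<omega>)\<^sup>2 \<le> 0" by (auto simp: \<sigma>_def)
      have "(X t \<omega>)\<^sup>2 = I\<^sup>2 - 2 * ?D \<omega> * X t \<omega> - (?D \<omega>)\<^sup>2"
        by (simp add: X_def I_def power2_eq_square algebra_simps)
      also have "\<dots> = F \<omega> * X t \<omega> + \<sigma> * ?D \<omega> - (?D \<omega>)\<^sup>2"
        unfolding 1 by (simp add: F_def X_def I_def \<sigma>_def algebra_simps)
      finally show ?thesis using 2 by linarith
    qed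
    have Dint: "integrable M (\<lambda>\<omega>. \<bar>?D \<omega>\<bar>)"
      using A1 by (intro integrable_const_bound[where B=1]) auto
    have "expectation (\<lambda>\<omega>. (X t \<omega>)\<^sup>2) \<le> expectation (\<lambda>\<omega>. F \<omega> * X t \<omega> + \<bar>?D \<omega>\<bar>)"
      using XX[of t t] FX(1)[OF F Fb] Dint pw
      by (intro integral_mono) (auto simp: power2_eq_square)
    also have "\<dots> = expectation (\<lambda>\<omega>. \<bar>?D \<omega>\<bar>)"
      using FX[OF F Fb] Dint by simp
    finally show "expectation (\<lambda>\<omega>. (X t \<omega>)\<^sup>2) \<le> expectation (\<lambda>\<omega>. \<bar>?D \<omega>\<bar>)" .
  qed
  finally show "expectation (\<lambda>\<omega>. (\<Sum>t\<in>T. X t \<omega>)\<^sup>2) \<le> (\<Sum>t\<in>T. expectation (\<lambda>\<omega>. \<bar>A (x + c t \<omega>) - A x\<bar>))" .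
qed

definition ma :: "nat \<Rightarrow> int \<Rightarrow> 'a \<Rightarrow> real" where
  "ma m t \<omega> = (\<Sum>k<m. ma_coeff p \<beta> k * \<epsilon> (t - int k) \<omega>)"

lemma measurable_ma [measurable]: "ma m t \<in> borel_measurable M"
  unfolding ma_def by measurable

lemma measurable_past_ma: "s < t \<Longrightarrow> ma m s \<in> borel_measurable (past t)"
  unfolding ma_def by (intro borel_measurable_sum borel_measurable_times measurable_past) auto

lemma ma_second_moment:
  assumes "\<And>t. expectation (\<lambda>\<omega>. (\<epsilon> t \<omega>)\<^sup>2) \<le> s2"
  shows "integrable M (\<lambda>\<omega>. (ma m t \<omega>)\<^sup>2)"
    and "expectation (\<lambda>\<omega>. (ma m t \<omega>)\<^sup>2) \<le> s2 * (\<Sum>k<m. (ma_coeff p \<beta> k)\<^sup>2)"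
proof -
  let ?X = "\<lambda>k \<omega>. ma_coeff p \<beta> k * \<epsilon> (t - int k) \<omega>"
  have int: "integrable M (\<lambda>\<omega>. ?X i \<omega> * ?X j \<omega>)" for i j
  proof -
    have "integrable M (\<lambda>\<omega>. \<epsilon> (t - int i) \<omega> * \<epsilon> (t - int j) \<omega>)"
    proof (cases "i = j")
      case True
      then show ?thesis using innovations_variance(1) by (simp add: power2_eq_square)
    next
      case False
      then show ?thesis by (intro expectation_innovations) auto
    qed
    then have "integrable M (\<lambda>\<omega>. (ma_coeff p \<beta> i * ma_coeff p \<beta> j) * (\<epsilon> (t - int i) \<omega> * \<epsilon> (t - int j) \<omega>))"
      by (rule integrable_mult_right)
    then show ?thesis by (simp add: mult_ac)
  qed
  have orth: "expectation (\<lambda>\<omega>. ?X i \<omega> * ?X j \<omega>) = 0" if "i \<noteq> j" for i j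
  proof -
    have "expectation (\<lambda>\<omega>. (ma_coeff p \<beta> i * ma_coeff p \<beta> j) * (\<epsilon> (t - int i) \<omega> * \<epsilon> (t - int j) \<omega>)) = 0"
      using that expectation_innovations(2)[of "t - int i" "t - int j"] by simp
    then show ?thesis by (simp add: mult_ac)
  qed
  show "integrable M (\<lambda>\<omega>. (ma m t \<omega>)\<^sup>2)"
    unfolding ma_def using int orth by (intro expectation_sum_square_orthogonal) auto
  have "expectation (\<lambda>\<omega>. (ma m t \<omega>)\<^sup>2) = (\<Sum>k<m. expectation (\<lambda>\<omega>. (?X k \<omega>)\<^sup>2))"
    unfolding ma_def using int orth by (intro expectation_sum_square_orthogonal) auto
  also have "\<dots> = (\<Sum>k<m. (ma_coeff p \<beta> k)\<^sup>2 * expectation (\<lambda>\<omega>. (\<epsilon> (t - int k) \<omega>)\<^sup>2))"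
    by (simp add: power_mult_distrib)
  also have "\<dots> \<le> (\<Sum>k<m. (ma_coeff p \<beta> k)\<^sup>2 * s2)"
    using assms by (intro sum_mono mult_left_mono) auto
  finally show "expectation (\<lambda>\<omega>. (ma m t \<omega>)\<^sup>2) \<le> s2 * (\<Sum>k<m. (ma_coeff p \<beta> k)\<^sup>2)"
    by (simp add: sum_distrib_left mult.commute)
qed

end

section \<open>Asymptotic linearity for a fixed shift\<close>

text \<open>One sample size and one fixed shift. \<open>g\<close> stands for the density of the null
  distribution \<open>G\<close> at \<open>x\<close> and \<open>r\<close> for the weight of the
  alternative, while \<open>L\<close> and \<open>V\<close> are meant to be shared by all models.
  Estimates that are explicit in these constants stay uniform when the parameters vary.\<close>

locale shifted_ar_model = outlier_ar_model M p \<beta> \<nu> A q P\<^sub>\<xi> n \<epsilon> z \<xi> v y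
  for M :: "'a measure" and p :: nat and \<beta> :: "nat \<Rightarrow> real" and \<nu> :: real
    and A :: "real \<Rightarrow> real" and q :: real and P\<^sub>\<xi> :: "real measure" and n :: nat
    and \<epsilon> z \<xi> v y :: "int \<Rightarrow> 'a \<Rightarrow> real" +
  fixes G :: "real \<Rightarrow> real" and g L r V \<gamma> x \<tau> \<eta> :: real and \<theta> :: "nat \<Rightarrow> real" and m :: nat
  assumes n: "n \<ge> 1"
    and A_lip: "\<And>s t. \<bar>A s - A t\<bar> \<le> L * \<bar>s - t\<bar>"
    and A_taylor: "\<And>s. \<bar>A (x + s) - A x - g * s\<bar> \<le> L * s\<^sup>2 + (2 * L * r) * \<bar>s\<bar>"
    and A_G: "\<And>s. \<bar>A s - G s\<bar> \<le> r"
    and g: "\<bar>g\<bar> \<le> L" and r: "0 \<le> r" and \<gamma>: "0 \<le> \<gamma>"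
    and G: "G \<in> borel_measurable borel" "\<And>s. 0 \<le> G s" "\<And>s. G s \<le> 1"
    and V: "\<And>t. integrable M (\<lambda>\<omega>. (ma m t \<omega>)\<^sup>2)" "\<And>t. expectation (\<lambda>\<omega>. (ma m t \<omega>)\<^sup>2) \<le> V"
begin

text \<open>
  The suffix \<open>0\<close> in \<open>d0\<close> means that the outliers are left out. The solution \<open>v\<close> is replaced by \<open>ma m\<close>
  throughout, which is a finite sum of past innovations and hence predictable without any limit.
\<close>

definition a :: real where "a = sqrt (real n)"
definition B :: "nat \<Rightarrow> real" where "B = \<beta>(0 := -1)"
definition C :: real where "C = shift_size p \<tau> \<theta> \<eta>"
definition D :: real where "D = C\<^sup>2 * (1 + real p * V)"
definition d0 :: "int \<Rightarrow> 'a \<Rightarrow> real" where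
  "d0 t \<omega> = lin_shift p \<tau> \<theta> \<eta> (\<lambda>s. ma m s \<omega>) t"
definition d :: "int \<Rightarrow> 'a \<Rightarrow> real" where
  "d t \<omega> = lin_shift p \<tau> \<theta> \<eta> (\<lambda>s. ma m s \<omega> + z s \<omega> * \<xi> s \<omega>) t"
definition c :: "int \<Rightarrow> 'a \<Rightarrow> real" where
  "c t \<omega> = d t \<omega> / a + (\<Sum>j=0..p. B j * (z (t - int j) \<omega> * \<xi> (t - int j) \<omega>))"
definition f :: "real \<Rightarrow> real" where "f s = A (x + s) - A x"

lemma sqrt_n: "a \<ge> 1" "a > 0" "a\<^sup>2 = real n" "a * a = real n"
  using n by (auto simp: a_def)

lemma L_nonneg: "0 \<le> L" and C_nonneg: "0 \<le> C" and D_nonneg: "0 \<le> D"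
proof -
  show "0 \<le> L" using g by linarith
  show "0 \<le> C" by (simp add: C_def shift_size_nonneg)
  have "0 \<le> expectation (\<lambda>\<omega>. (ma m 0 \<omega>)\<^sup>2)" by (rule integral_nonneg_AE) simp
  with V(2)[of 0] have "0 \<le> V" by linarith
  then show "0 \<le> D" by (simp add: D_def)
qed

lemma measurable_d0 [measurable]: "d0 t \<in> borel_measurable M"
  and measurable_d [measurable]: "d t \<in> borel_measurable M"
  and measurable_c [measurable]: "c t \<in> borel_measurable M"
  and measurable_f [measurable]: "f \<in> borel_measurable borel"
proof -
  show [measurable]: "d0 t \<in> borel_measurable M" "d t \<in> borel_measurable M"
    unfolding d0_def d_def lin_shift_def by measurable
  show "c t \<in> borel_measurable M" unfolding c_def by measurable
  show "f \<in> borel_measurable borel" unfolding f_def by measurable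
qed

lemma measurable_threshold [measurable]:
  "(\<lambda>\<omega>. indicator {..x + c t \<omega>} (\<epsilon> t \<omega>) :: real) \<in> borel_measurable M"
  "(\<lambda>\<omega>. indicator {..x} (\<epsilon> t \<omega>) :: real) \<in> borel_measurable M"
  "(\<lambda>\<omega>. f (c t \<omega>)) \<in> borel_measurable M"
proof -
  show "(\<lambda>\<omega>. indicator {..x + c t \<omega>} (\<epsilon> t \<omega>) :: real) \<in> borel_measurable M"
    unfolding indicator_def atMost_iff by measurable
  show "(\<lambda>\<omega>. indicator {..x} (\<epsilon> t \<omega>) :: real) \<in> borel_measurable M"
    by measurable
  show "(\<lambda>\<omega>. f (c t \<omega>)) \<in> borel_measurable M"
    by (rule measurable_compose[OF measurable_c measurable_f])
qed

lemma measurable_past_c: "s \<le> t \<Longrightarrow> c s \<in> borel_measurable (past t)"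
proof -
  assume "s \<le> t"
  then have [measurable]: "ma m (s - int j) \<in> borel_measurable (past t)" if "j \<in> {1..p}" for j
    using that by (intro measurable_past_ma) auto
  note [measurable] = measurable_past(2,3)
  show ?thesis unfolding c_def d_def lin_shift_def by measurable
qed

lemma f_bounds: "\<bar>f s\<bar> \<le> 1" "\<bar>f s - f t\<bar> \<le> 1" "f 0 = 0" "\<bar>f s - f t\<bar> \<le> L * \<bar>s - t\<bar>"
  using cdf_innovation_bounds(1,2)[of "x + s"] cdf_innovation_bounds(1,2)[of "x + t"]
    cdf_innovation_bounds(1,2)[of x] A_lip[of "x + s" "x + t"] by (auto simp: f_def)

lemma d0_moments:
  shows "integrable M (\<lambda>\<omega>. (d0 t \<omega>)\<^sup>2)" "expectation (\<lambda>\<omega>. (d0 t \<omega>)\<^sup>2) \<le> D"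
    and "integrable M (\<lambda>\<omega>. \<bar>d0 t \<omega>\<bar>)" "expectation (\<lambda>\<omega>. \<bar>d0 t \<omega>\<bar>) \<le> 1 + D"
proof -
  have le: "(d0 t \<omega>)\<^sup>2 \<le> C\<^sup>2 * (1 + (\<Sum>j=1..p. (ma m (t - int j) \<omega>)\<^sup>2))" for \<omega>
    unfolding d0_def C_def by (rule lin_shift_square_le)
  have int: "integrable M (\<lambda>\<omega>. C\<^sup>2 * (1 + (\<Sum>j=1..p. (ma m (t - int j) \<omega>)\<^sup>2)))"
    using V(1) by simp
  show 1: "integrable M (\<lambda>\<omega>. (d0 t \<omega>)\<^sup>2)"
    using le by (intro Bochner_Integration.integrable_bound[OF int]) (auto intro!: AE_I2 order.trans[OF _ abs_ge_self])
  have "expectation (\<lambda>\<omega>. (d0 t \<omega>)\<^sup>2) \<le> expectation (\<lambda>\<omega>. C\<^sup>2 * (1 + (\<Sum>j=1..p. (ma m (t - int j) \<omega>)\<^sup>2)))"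
    using 1 int le by (rule integral_mono)
  also have "\<dots> = C\<^sup>2 * (1 + (\<Sum>j=1..p. expectation (\<lambda>\<omega>. (ma m (t - int j) \<omega>)\<^sup>2)))"
    using V(1) by (simp add: prob_space)
  also have "\<dots> \<le> C\<^sup>2 * (1 + (\<Sum>j=1..p. V))"
    using V(2) by (intro mult_left_mono add_left_mono sum_mono) auto
  finally show 2: "expectation (\<lambda>\<omega>. (d0 t \<omega>)\<^sup>2) \<le> D" by (simp add: D_def)
  show 3: "integrable M (\<lambda>\<omega>. \<bar>d0 t \<omega>\<bar>)"
    using square_integrable_imp_integrable[OF _ 1] by simp
  note abs_le_one_plus_square
  then have "expectation (\<lambda>\<omega>. \<bar>d0 t \<omega>\<bar>) \<le> expectation (\<lambda>\<omega>. 1 + (d0 t \<omega>)\<^sup>2)"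
    using 1 3 by (intro integral_mono) auto
  with 1 2 show "expectation (\<lambda>\<omega>. \<bar>d0 t \<omega>\<bar>) \<le> 1 + D" by (simp add: prob_space)
qed

lemma AE_indicators: "AE \<omega> in M. \<forall>s. z s \<omega> \<in> {0, 1}"
  unfolding AE_all_countable using AE_indicator by auto

lemma d_diff: "\<forall>s. z s \<omega> \<in> {0, 1} \<Longrightarrow>
    \<bar>d t \<omega> - d0 t \<omega>\<bar> \<le> C * (\<Sum>j=0..p. z (t - int j) \<omega> * \<bar>\<xi> (t - int j) \<omega>\<bar>)"
proof -
  assume z: "\<forall>s. z s \<omega> \<in> {0, 1}"
  have z0: "0 \<le> z s \<omega>" for s using z[rule_format, of s] by auto
  have "\<bar>d t \<omega> - d0 t \<omega>\<bar> \<le> C * (\<Sum>j=1..p. \<bar>z (t - int j) \<omega> * \<xi> (t - int j) \<omega>\<bar>)"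
    unfolding d_def d0_def C_def by (rule lin_shift_diff_le)
  also have "(\<Sum>j=1..p. \<bar>z (t - int j) \<omega> * \<xi> (t - int j) \<omega>\<bar>) = (\<Sum>j=1..p. z (t - int j) \<omega> * \<bar>\<xi> (t - int j) \<omega>\<bar>)"
    using z0 by (simp add: abs_mult)
  also have "\<dots> \<le> (\<Sum>j=0..p. z (t - int j) \<omega> * \<bar>\<xi> (t - int j) \<omega>\<bar>)"
    using z0 by (intro sum_mono2) auto
  finally show ?thesis using C_nonneg by (simp add: mult_left_mono)
qed

text \<open>An outlier of size \<open>s\<close> in the window moves the shift by at most
  \<open>C * \<bar>s\<bar>\<close>, hence \<open>f\<close> by at most
  \<open>L * C * \<bar>s\<bar> / a\<close>, and never by more than one. The cap makes the mean
  finite for every law of the sizes and lets it vanish by dominated convergence.\<close>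

definition tail :: real where "tail = (\<integral>s. min 1 (L * C * \<bar>s\<bar> / a) \<partial>P\<^sub>\<xi>)"

lemma min_tail: "(\<lambda>s. min 1 (L * C * \<bar>s\<bar> / a)) \<in> borel_measurable borel" "\<bar>min 1 (L * C * \<bar>s\<bar> / a)\<bar> \<le> 1"
  "0 \<le> min 1 (L * C * \<bar>s\<bar> / a)"
  using L_nonneg C_nonneg sqrt_n by auto

text \<open>If no outlier reaches time \<open>t\<close>, then \<open>c t = d0 t / a\<close> and the
  Lipschitz bound applies. Otherwise the sum of the \<open>p + 1\<close> indicators is at least one,
  which already bounds \<open>f\<close>.\<close>

lemma expectation_abs_f_c: "expectation (\<lambda>\<omega>. \<bar>f (c t \<omega>)\<bar>) \<le> L * (1 + D) / a + real (p + 1) * q"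
proof -
  have int: "integrable M (\<lambda>\<omega>. L * \<bar>d0 t \<omega>\<bar> / a + (\<Sum>j=0..p. z (t - int j) \<omega>))"
    using d0_moments(3) integrable_indicator_variable by simp
  have "AE \<omega> in M. \<bar>f (c t \<omega>)\<bar> \<le> L * \<bar>d0 t \<omega>\<bar> / a + (\<Sum>j=0..p. z (t - int j) \<omega>)"
    using AE_indicators
  proof eventually_elim
    case (elim \<omega>)
    have z0: "0 \<le> z s \<omega>" for s using spec[OF elim, of s] by auto
    have d0: "0 \<le> L * \<bar>d0 t \<omega>\<bar> / a" using L_nonneg sqrt_n by simp
    show ?case
    proof (cases "\<forall>j\<in>{0..p}. z (t - int j) \<omega> = 0")
      case True
      then have "c t \<omega> = d0 t \<omega> / a" using d_diff[OF elim, of t] by (simp add: c_def)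
      then have "\<bar>f (c t \<omega>)\<bar> \<le> L * \<bar>d0 t \<omega> / a\<bar>" using f_bounds(3) f_bounds(4)[of "c t \<omega>" 0] by simp
      then show ?thesis using True sqrt_n by simp
    next
      case False
      then obtain j where j: "j \<in> {0..p}" "z (t - int j) \<omega> = 1" using elim by auto
      have "z (t - int j) \<omega> \<le> (\<Sum>j=0..p. z (t - int j) \<omega>)"
        using j z0 by (intro member_le_sum) auto
      then show ?thesis using f_bounds(1)[of "c t \<omega>"] d0 j by linarith
    qed
  qed
  then have "expectation (\<lambda>\<omega>. \<bar>f (c t \<omega>)\<bar>) \<le>
      expectation (\<lambda>\<omega>. L * \<bar>d0 t \<omega>\<bar> / a + (\<Sum>j=0..p. z (t - int j) \<omega>))"
    using f_bounds(1) by (intro integral_mono_AE[OF _ int] integrable_const_bound[where B=1]) auto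
  also have "\<dots> = L * expectation (\<lambda>\<omega>. \<bar>d0 t \<omega>\<bar>) / a + real (p + 1) * q"
    using d0_moments(3) integrable_indicator_variable by (simp add: expectation_indicator)
  also have "\<dots> \<le> L * (1 + D) / a + real (p + 1) * q"
    using L_nonneg sqrt_n d0_moments(4) by (intro add_right_mono divide_right_mono mult_left_mono) auto
  finally show ?thesis .
qed

text \<open>The radicand bounds the second moment of a single martingale difference. By
  orthogonality it also bounds the second moment of their sum divided by \<open>a\<close>.\<close>

definition E1 :: real where "E1 = sqrt (L * (1 + D) / a + real (p + 1) * q)"

lemma martingale_part:
  defines "X \<equiv> \<lambda>t \<omega>. indicator {..x + c t \<omega>} (\<epsilon> t \<omega>) - indicator {..x} (\<epsilon> t \<omega>) - f (c t \<omega>)"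
  shows "integrable M (\<lambda>\<omega>. \<bar>(\<Sum>t=1..int n. X t \<omega>) / a\<bar>)"
    and "expectation (\<lambda>\<omega>. \<bar>(\<Sum>t=1..int n. X t \<omega>) / a\<bar>) \<le> E1"
proof -
  let ?S = "\<lambda>\<omega>. \<Sum>t=1..int n. X t \<omega>"
  have XM: "X t \<in> borel_measurable M" for t
    unfolding X_def by (intro borel_measurable_diff measurable_threshold)
  have int: "integrable M (\<lambda>\<omega>. (?S \<omega>)\<^sup>2)"
    unfolding X_def f_def
    by (rule expectation_centered_indicator_sum) (simp_all add: measurable_past_c)
  have S_meas: "?S \<in> borel_measurable M"
    by (intro borel_measurable_sum XM)
  have "integrable M ?S"
    using S_meas int by (rule square_integrable_imp_integrable)
  then show "integrable M (\<lambda>\<omega>. \<bar>?S \<omega> / a\<bar>)"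
    by (intro integrable_abs integrable_divide_zero) simp
  have "expectation (\<lambda>\<omega>. (?S \<omega>)\<^sup>2) \<le> (\<Sum>t=1..int n. expectation (\<lambda>\<omega>. \<bar>f (c t \<omega>)\<bar>))"
    unfolding X_def f_def
    by (rule expectation_centered_indicator_sum) (simp_all add: measurable_past_c)
  also have "\<dots> \<le> (\<Sum>t=1..int n. E1\<^sup>2)"
  proof (rule sum_mono)
    fix t
    have "0 \<le> L * (1 + D) / a + real (p + 1) * q"
      using L_nonneg D_nonneg sqrt_n indicator_prob_bounds by simp
    then show "expectation (\<lambda>\<omega>. \<bar>f (c t \<omega>)\<bar>) \<le> E1\<^sup>2"
      using expectation_abs_f_c[of t] by (simp add: E1_def)
  qed
  also have "\<dots> = (a * E1)\<^sup>2" by (simp add: power_mult_distrib sqrt_n)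
  finally have "sqrt (expectation (\<lambda>\<omega>. (?S \<omega>)\<^sup>2)) \<le> a * E1"
    using sqrt_n L_nonneg D_nonneg indicator_prob_bounds by (intro real_le_lsqrt) (auto simp: E1_def)
  moreover have "expectation (\<lambda>\<omega>. \<bar>?S \<omega>\<bar>) \<le> sqrt (expectation (\<lambda>\<omega>. (?S \<omega>)\<^sup>2))"
    using S_meas int by (rule expectation_abs_le_sqrt)
  ultimately have "expectation (\<lambda>\<omega>. \<bar>?S \<omega>\<bar>) / a \<le> E1"
    using sqrt_n by (simp add: divide_le_eq mult.commute)
  then show "expectation (\<lambda>\<omega>. \<bar>?S \<omega> / a\<bar>) \<le> E1" using sqrt_n by simp
qed

text \<open>The summands stem, in this order, from the Taylor remainder, from the slope of the
  alternative differing from \<open>g\<close>, from single outliers in the window and from pairs of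
  outliers. The free parameter \<open>b\<close> balances \<open>q * b\<close> against
  \<open>D / b\<close>.\<close>

definition E2 :: "real \<Rightarrow> real" where
  "E2 b = L * D / a + 2 * L * r * (1 + D) +
     a * real (p + 1) * (2 * L / a * (q * b + D / b) + q * tail) + 2 * a * real ((p + 1)\<^sup>2) * q\<^sup>2"

definition outlier_effect :: "int \<Rightarrow> 'a \<Rightarrow> real" where
  "outlier_effect t \<omega> = (\<Sum>j=0..p. z (t - int j) \<omega> * f (B j * \<xi> (t - int j) \<omega>))"

lemma measurable_outlier_effect [measurable]: "outlier_effect t \<in> borel_measurable M"
  unfolding outlier_effect_def by measurable

text \<open>The pathwise inequality \<open>outlier_decoupling\<close>, with \<open>d\<close> as the
  shift including outliers and \<open>d0\<close> as the one without, holds almost surely. Its right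
  side is integrated term by term; independence enters through the pairs of indicators and through
  each indicator with its own size.\<close>

lemma linearization_step:
  assumes b: "b > 0"
  shows "integrable M (\<lambda>\<omega>. \<bar>f (c t \<omega>) - outlier_effect t \<omega> - g * d0 t \<omega> / a\<bar>)"
    and "expectation (\<lambda>\<omega>. \<bar>f (c t \<omega>) - outlier_effect t \<omega> - g * d0 t \<omega> / a\<bar>) \<le> E2 b / a"
proof -
  let ?m = "\<lambda>s \<omega>. min 1 (L * C * \<bar>\<xi> s \<omega>\<bar> / a)"
  let ?pairs = "\<lambda>\<omega>. \<Sum>i=0..p. \<Sum>j\<in>{0..p} - {i}. z (t - int i) \<omega> * z (t - int j) \<omega>"
  let ?gap = "\<lambda>\<omega>. f (c t \<omega>) - outlier_effect t \<omega> - g * d0 t \<omega> / a"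
  define R where "R \<omega> = L * ((d0 t \<omega>)\<^sup>2 / a\<^sup>2) + 2 * L * r * (\<bar>d0 t \<omega>\<bar> / a) +
       (\<Sum>j=0..p. 2 * L / a * (z (t - int j) \<omega> * b + (d0 t \<omega>)\<^sup>2 / b) +
          z (t - int j) \<omega> * ?m (t - int j) \<omega>) +
       2 * ?pairs \<omega>" for \<omega>
  define K where "K = 2 * L / a * (q * b + D / b) + q * tail"
  have [measurable]: "R \<in> borel_measurable M" unfolding R_def by measurable
  have pw: "AE \<omega> in M. \<bar>?gap \<omega>\<bar> \<le> R \<omega>"
    using AE_indicators
  proof eventually_elim
    case (elim \<omega>)
    have "\<bar>?gap \<omega>\<bar> \<le>
       L * (d0 t \<omega> / a)\<^sup>2 + 2 * L * r * (\<bar>d0 t \<omega>\<bar> / a) +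
       (\<Sum>j=0..p. z (t - int j) \<omega> * (2 * L * (\<bar>d0 t \<omega>\<bar> / a) + ?m (t - int j) \<omega>)) +
       2 * ?pairs \<omega>"
      unfolding c_def outlier_effect_def
    proof (rule outlier_decoupling)
      show "z (t - int j) \<omega> \<in> {0, 1}" for j using elim by auto
      show "\<bar>f s - g * s\<bar> \<le> L * s\<^sup>2 + 2 * L * r * \<bar>s\<bar>" for s using A_taylor[of s] by (simp add: f_def)
      show "\<bar>d t \<omega> - d0 t \<omega>\<bar> \<le> C * (\<Sum>j=0..p. z (t - int j) \<omega> * \<bar>\<xi> (t - int j) \<omega>\<bar>)"
        using elim by (rule d_diff)
    qed (use f_bounds g sqrt_n L_nonneg r in auto)
    also have "\<dots> \<le> R \<omega>"
      unfolding R_def power_divide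
    proof (intro add_mono order_refl sum_mono)
      fix j
      have zj: "z (t - int j) \<omega> \<in> {0, 1}" using elim by auto
      \<comment> \<open>This avoids the independence of indicators and innovations; \<open>b\<close> is later of order \<open>n\<^sup>1\<^sup>/\<^sup>4\<close>.\<close>
      have amgm: "\<bar>s\<bar> \<le> b + s\<^sup>2 / b" for s
      proof (cases "\<bar>s\<bar> \<le> b")
        case True
        then show ?thesis using b by (intro add_increasing2) auto
      next
        case False
        then have "\<bar>s\<bar> * b \<le> \<bar>s\<bar> * \<bar>s\<bar>" by (intro mult_left_mono) auto
        then have "\<bar>s\<bar> \<le> s\<^sup>2 / b" using b by (simp add: le_divide_eq power2_eq_square)
        then show ?thesis using b by linarith
      qed
      have "z (t - int j) \<omega> * \<bar>d0 t \<omega>\<bar> \<le> z (t - int j) \<omega> * b + (d0 t \<omega>)\<^sup>2 / b"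
        using zj amgm[of "d0 t \<omega>"] b by auto
      then have "2 * L / a * (z (t - int j) \<omega> * \<bar>d0 t \<omega>\<bar>) \<le> 2 * L / a * (z (t - int j) \<omega> * b + (d0 t \<omega>)\<^sup>2 / b)"
        using L_nonneg sqrt_n by (intro mult_left_mono) auto
      then show "z (t - int j) \<omega> * (2 * L * (\<bar>d0 t \<omega>\<bar> / a) + ?m (t - int j) \<omega>)
          \<le> 2 * L / a * (z (t - int j) \<omega> * b + (d0 t \<omega>)\<^sup>2 / b) + z (t - int j) \<omega> * ?m (t - int j) \<omega>"
        by (simp add: distrib_left mult.commute mult.left_commute)
    qed
    finally show ?case .
  qed
  have zz: "integrable M (\<lambda>\<omega>. z (t - int i) \<omega> * z (t - int j) \<omega>)"
    "expectation (\<lambda>\<omega>. z (t - int i) \<omega> * z (t - int j) \<omega>) = q\<^sup>2" if "j \<in> {0..p} - {i}" for i j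
    using that by (auto intro!: expectation_indicators)
  have tl: "integrable M (\<lambda>\<omega>. z s \<omega> * ?m s \<omega>)"
    "expectation (\<lambda>\<omega>. z s \<omega> * ?m s \<omega>) = q * tail" for s
    unfolding tail_def using min_tail(1,2) by (rule expectation_outlier)+
  have dz: "integrable M (\<lambda>\<omega>. z s \<omega> * b + (d0 t \<omega>)\<^sup>2 / b)"
    "expectation (\<lambda>\<omega>. z s \<omega> * b + (d0 t \<omega>)\<^sup>2 / b) = q * b + expectation (\<lambda>\<omega>. (d0 t \<omega>)\<^sup>2) / b" for s
    using integrable_indicator_variable d0_moments(1) by (simp_all add: expectation_indicator)
  have I1: "integrable M (\<lambda>\<omega>. L * ((d0 t \<omega>)\<^sup>2 / a\<^sup>2))" "integrable M (\<lambda>\<omega>. 2 * L * r * (\<bar>d0 t \<omega>\<bar> / a))"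
    using d0_moments by simp_all
  have I2: "integrable M (\<lambda>\<omega>. 2 * L / a * (z s \<omega> * b + (d0 t \<omega>)\<^sup>2 / b) + z s \<omega> * ?m s \<omega>)" for s
    by (intro Bochner_Integration.integrable_add integrable_mult_right dz tl)
  have I3: "integrable M (\<lambda>\<omega>. \<Sum>j\<in>{0..p} - {i}. z (t - int i) \<omega> * z (t - int j) \<omega>)" for i
    by (intro Bochner_Integration.integrable_sum zz)
  have I4: "integrable M (\<lambda>\<omega>. \<Sum>j=0..p. 2 * L / a * (z (t - int j) \<omega> * b + (d0 t \<omega>)\<^sup>2 / b) +
      z (t - int j) \<omega> * ?m (t - int j) \<omega>)"
    "integrable M (\<lambda>\<omega>. 2 * ?pairs \<omega>)"
    by (intro Bochner_Integration.integrable_sum integrable_mult_right I2 I3)+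
  have R: "integrable M R"
    unfolding R_def by (intro Bochner_Integration.integrable_add I1 I4)
  show int: "integrable M (\<lambda>\<omega>. \<bar>?gap \<omega>\<bar>)"
  proof (rule Bochner_Integration.integrable_bound[OF R])
    show "(\<lambda>\<omega>. \<bar>?gap \<omega>\<bar>) \<in> borel_measurable M"
      by measurable
    show "AE \<omega> in M. norm \<bar>?gap \<omega>\<bar> \<le> norm (R \<omega>)"
      using pw by eventually_elim simp
  qed
  have "expectation (\<lambda>\<omega>. \<bar>?gap \<omega>\<bar>) \<le> expectation R"
    using int R pw by (rule integral_mono_AE)
  also have "expectation R = L * (expectation (\<lambda>\<omega>. (d0 t \<omega>)\<^sup>2) / a\<^sup>2) + 2 * L * r * (expectation (\<lambda>\<omega>. \<bar>d0 t \<omega>\<bar>) / a) +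
       (\<Sum>j=0..p. 2 * L / a * (q * b + expectation (\<lambda>\<omega>. (d0 t \<omega>)\<^sup>2) / b) + q * tail) +
       2 * (\<Sum>i=0..p. \<Sum>j\<in>{0..p} - {i}. q\<^sup>2)"
  proof -
    have "expectation R = expectation (\<lambda>\<omega>. L * ((d0 t \<omega>)\<^sup>2 / a\<^sup>2)) + expectation (\<lambda>\<omega>. 2 * L * r * (\<bar>d0 t \<omega>\<bar> / a)) +
        (\<Sum>j=0..p. expectation (\<lambda>\<omega>. 2 * L / a * (z (t - int j) \<omega> * b + (d0 t \<omega>)\<^sup>2 / b) +
          z (t - int j) \<omega> * ?m (t - int j) \<omega>)) +
        2 * (\<Sum>i=0..p. \<Sum>j\<in>{0..p} - {i}. expectation (\<lambda>\<omega>. z (t - int i) \<omega> * z (t - int j) \<omega>))"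
      unfolding R_def
      by (simp only: Bochner_Integration.integral_add Bochner_Integration.integrable_add I1 I4
        Bochner_Integration.integral_sum I2 I3 zz integral_mult_right_zero cong: sum.cong)
    also have "\<dots> = L * (expectation (\<lambda>\<omega>. (d0 t \<omega>)\<^sup>2) / a\<^sup>2) + 2 * L * r * (expectation (\<lambda>\<omega>. \<bar>d0 t \<omega>\<bar>) / a) +
       (\<Sum>j=0..p. 2 * L / a * (q * b + expectation (\<lambda>\<omega>. (d0 t \<omega>)\<^sup>2) / b) + q * tail) +
       2 * (\<Sum>i=0..p. \<Sum>j\<in>{0..p} - {i}. q\<^sup>2)"
      by (simp only: Bochner_Integration.integral_add integrable_mult_right dz tl zz integral_mult_right_zero
        integral_divide_zero cong: sum.cong)
    finally show ?thesis .
  qed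
  also have "\<dots> \<le> L * (D / a\<^sup>2) + 2 * L * r * ((1 + D) / a) + real (p + 1) * K + 2 * (real ((p + 1)\<^sup>2) * q\<^sup>2)"
  proof -
    have "L * (expectation (\<lambda>\<omega>. (d0 t \<omega>)\<^sup>2) / a\<^sup>2) \<le> L * (D / a\<^sup>2)"
      by (rule mult_left_mono[OF divide_right_mono[OF d0_moments(2)] L_nonneg]) simp
    moreover have "2 * L * r * (expectation (\<lambda>\<omega>. \<bar>d0 t \<omega>\<bar>) / a) \<le> 2 * L * r * ((1 + D) / a)"
      by (rule mult_left_mono[OF divide_right_mono[OF d0_moments(4)]]) (use sqrt_n(2) L_nonneg r in auto)
    moreover have "2 * L / a * (q * b + expectation (\<lambda>\<omega>. (d0 t \<omega>)\<^sup>2) / b) \<le> 2 * L / a * (q * b + D / b)"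
      by (rule mult_left_mono[OF add_left_mono[OF divide_right_mono[OF d0_moments(2)]]]) (use sqrt_n(2) L_nonneg b in auto)
    then have "(\<Sum>j=0..p. 2 * L / a * (q * b + expectation (\<lambda>\<omega>. (d0 t \<omega>)\<^sup>2) / b) + q * tail) \<le> (\<Sum>j=0..p. K)"
      unfolding K_def by (intro sum_mono add_right_mono)
    moreover have "(\<Sum>j=0..p. K) = real (p + 1) * K" by simp
    moreover have "(\<Sum>i=0..p. \<Sum>j\<in>{0..p} - {i}. q\<^sup>2) \<le> (\<Sum>i=0..p. \<Sum>j\<in>{0..p}. q\<^sup>2)"
      by (intro sum_mono sum_mono2) auto
    moreover have "(\<Sum>i=0..p. \<Sum>j\<in>{0..p}. q\<^sup>2) = real ((p + 1)\<^sup>2) * q\<^sup>2"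
      by (simp add: power2_eq_square algebra_simps)
    ultimately show ?thesis by linarith
  qed
  also have "\<dots> = E2 b / a"
    using sqrt_n(2) unfolding E2_def K_def[symmetric] by (simp add: power2_eq_square field_simps)
  finally show "expectation (\<lambda>\<omega>. \<bar>?gap \<omega>\<bar>) \<le> E2 b / a" .
qed

text \<open>The triangle inequality suffices here: each term has mean at most
  \<open>E2 b / a\<close>, and \<open>n\<close> of them divided by \<open>a\<close> give
  \<open>E2 b\<close> because \<open>a * a = n\<close>.\<close>

lemma linearization_part:
  assumes b: "b > 0"
  defines "X \<equiv> \<lambda>t \<omega>. f (c t \<omega>) - outlier_effect t \<omega> - g * d0 t \<omega> / a"
  shows "integrable M (\<lambda>\<omega>. \<bar>(\<Sum>t=1..int n. X t \<omega>) / a\<bar>)"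
    and "expectation (\<lambda>\<omega>. \<bar>(\<Sum>t=1..int n. X t \<omega>) / a\<bar>) \<le> E2 b"
proof -
  have [measurable]: "X t \<in> borel_measurable M" for t unfolding X_def by measurable
  have X: "integrable M (\<lambda>\<omega>. \<bar>X t \<omega>\<bar>)" "expectation (\<lambda>\<omega>. \<bar>X t \<omega>\<bar>) \<le> E2 b / a" for t
    using linearization_step[OF b, of t] by (simp_all only: X_def)
  have XI: "integrable M (X t)" for t
    using X(1)[of t] by (subst integrable_abs_iff[symmetric]) auto
  show 1: "integrable M (\<lambda>\<omega>. \<bar>(\<Sum>t=1..int n. X t \<omega>) / a\<bar>)"
    by (intro integrable_abs integrable_divide_zero Bochner_Integration.integrable_sum XI)
  have 2: "integrable M (\<lambda>\<omega>. (\<Sum>t=1..int n. \<bar>X t \<omega>\<bar>) / a)"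
    by (intro integrable_abs integrable_divide_zero Bochner_Integration.integrable_sum XI)
  have "expectation (\<lambda>\<omega>. \<bar>(\<Sum>t=1..int n. X t \<omega>) / a\<bar>) \<le> expectation (\<lambda>\<omega>. (\<Sum>t=1..int n. \<bar>X t \<omega>\<bar>) / a)"
    using 1 2
  proof (rule integral_mono)
    fix \<omega>
    show "\<bar>(\<Sum>t=1..int n. X t \<omega>) / a\<bar> \<le> (\<Sum>t=1..int n. \<bar>X t \<omega>\<bar>) / a"
      using sqrt_n(2) by (simp add: abs_divide divide_right_mono)
  qed
  also have "\<dots> = (\<Sum>t=1..int n. expectation (\<lambda>\<omega>. \<bar>X t \<omega>\<bar>)) / a"
    using X(1) by simp
  also have "\<dots> \<le> (\<Sum>t=1..int n. E2 b / a) / a"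
    using X(2) sqrt_n by (intro divide_right_mono sum_mono) auto
  also have "\<dots> = E2 b" using sqrt_n n by (simp add: field_simps)
  finally show "expectation (\<lambda>\<omega>. \<bar>(\<Sum>t=1..int n. X t \<omega>) / a\<bar>) \<le> E2 b" .
qed

text \<open>For each of the \<open>p + 1\<close> lags: the fluctuation of the outlier sum, the gap
  between the normalized expected number of outliers and \<open>\<gamma>\<close>, and the cost of
  replacing \<open>A\<close> by \<open>G\<close>.\<close>

definition E3 :: real where
  "E3 = real (p + 1) * (sqrt q + \<bar>a * q - \<gamma>\<bar> + 2 * \<gamma> * r)"

text \<open>The lags are separated first, since for a fixed lag the terms \<open>Y j t\<close> are
  uncorrelated over time. Their centred sum has second moment at most \<open>n * q\<close>, because
  \<open>Y j t\<close> is bounded by its indicator, and is therefore of order \<open>sqrt q\<close>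
  after division by \<open>a\<close>. The mean that remains is \<open>a * q * \<phi> j\<close>,
  where \<open>\<phi> j\<close> is within \<open>2 * r\<close> of the corresponding increment of
  \<open>G\<close>.\<close>

lemma outlier_part:
  shows "integrable M (\<lambda>\<omega>. \<bar>(\<Sum>t=1..int n. outlier_effect t \<omega>) / a - \<gamma> * Delta p \<beta> G P\<^sub>\<xi> x\<bar>)"
    and "expectation (\<lambda>\<omega>. \<bar>(\<Sum>t=1..int n. outlier_effect t \<omega>) / a - \<gamma> * Delta p \<beta> G P\<^sub>\<xi> x\<bar>) \<le> E3"
proof -
  let ?gap = "\<lambda>\<omega>. (\<Sum>t=1..int n. outlier_effect t \<omega>) / a - \<gamma> * Delta p \<beta> G P\<^sub>\<xi> x"
  interpret P\<xi>: prob_space P\<^sub>\<xi>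
    unfolding outliers_law[of 0, symmetric] by (rule prob_space_distr) simp
  have [measurable_cong]: "sets P\<^sub>\<xi> = sets borel" unfolding outliers_law[of 0, symmetric] by simp
  note [measurable] = G(1)
  define \<phi> where "\<phi> j = (\<integral>s. f (B j * s) \<partial>P\<^sub>\<xi>)" for j
  define Y where "Y j t \<omega> = z (t - int j) \<omega> * f (B j * \<xi> (t - int j) \<omega>)" for j t \<omega>
  have [measurable]: "Y j t \<in> borel_measurable M" for j t unfolding Y_def by measurable
  have hm: "(\<lambda>s. f (B j * s)) \<in> borel_measurable borel" "\<bar>f (B j * s)\<bar> \<le> 1" for j s
    using f_bounds(1) by auto
  have YI: "integrable M (Y j t)" for j t
    unfolding Y_def[abs_def] by (rule expectation_outlier(1)[OF hm])
  have EY: "expectation (Y j t) = q * \<phi> j" for j t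
    unfolding Y_def[abs_def] \<phi>_def by (rule expectation_outlier(2)[OF hm])
  have YY: "expectation (\<lambda>\<omega>. Y j s \<omega> * Y j t \<omega>) = (q * \<phi> j)\<^sup>2" if "s \<noteq> t" for j s t
    unfolding Y_def \<phi>_def by (rule expectation_outlier(3)[OF hm]) (use that in simp)
  have YB: "AE \<omega> in M. \<bar>Y j t \<omega>\<bar> \<le> z (t - int j) \<omega> \<and> z (t - int j) \<omega> \<le> 1" for j t
    using AE_indicator[of "t - int j"]
    by eventually_elim (use f_bounds(1) in \<open>auto simp: Y_def\<close>)
  have YYI: "integrable M (\<lambda>\<omega>. Y j s \<omega> * Y j t \<omega>)" for j s t
  proof (rule integrable_const_bound[where B=1])
    show "AE \<omega> in M. norm (Y j s \<omega> * Y j t \<omega>) \<le> 1"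
      using YB[of j s] YB[of j t]
    proof eventually_elim
      case (elim \<omega>)
      then have "\<bar>Y j s \<omega>\<bar> * \<bar>Y j t \<omega>\<bar> \<le> 1 * 1" by (intro mult_mono) auto
      then show ?case by (simp add: abs_mult)
    qed
  qed simp
  have EY2: "expectation (\<lambda>\<omega>. (Y j t \<omega>)\<^sup>2) \<le> q" for j t
  proof -
    have "expectation (\<lambda>\<omega>. (Y j t \<omega>)\<^sup>2) \<le> expectation (z (t - int j))"
    proof (rule integral_mono_AE)
      show "AE \<omega> in M. (Y j t \<omega>)\<^sup>2 \<le> z (t - int j) \<omega>"
        using YB[of j t]
      proof eventually_elim
        case (elim \<omega>)
        then have "\<bar>Y j t \<omega>\<bar> * \<bar>Y j t \<omega>\<bar> \<le> z (t - int j) \<omega> * 1" by (intro mult_mono) auto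
        then show ?case by (simp add: power2_eq_square)
      qed
    qed (use YYI[of j t t] integrable_indicator_variable in \<open>auto simp: power2_eq_square\<close>)
    then show ?thesis by (simp add: expectation_indicator)
  qed
  define S where "S j \<omega> = (\<Sum>t=1..int n. Y j t \<omega> - q * \<phi> j)" for j \<omega>
  have [measurable]: "S j \<in> borel_measurable M" for j unfolding S_def by measurable
  have cov: "integrable M (\<lambda>\<omega>. (Y j s \<omega> - q * \<phi> j) * (Y j t \<omega> - q * \<phi> j))"
    "expectation (\<lambda>\<omega>. (Y j s \<omega> - q * \<phi> j) * (Y j t \<omega> - q * \<phi> j)) =
      expectation (\<lambda>\<omega>. Y j s \<omega> * Y j t \<omega>) - (q * \<phi> j)\<^sup>2" for j s t
  proof -
    have *: "(Y j s \<omega> - q * \<phi> j) * (Y j t \<omega> - q * \<phi> j) =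
        Y j s \<omega> * Y j t \<omega> - q * \<phi> j * Y j s \<omega> - q * \<phi> j * Y j t \<omega> + (q * \<phi> j)\<^sup>2" for \<omega>
      by (simp add: algebra_simps power2_eq_square)
    show "integrable M (\<lambda>\<omega>. (Y j s \<omega> - q * \<phi> j) * (Y j t \<omega> - q * \<phi> j))"
      unfolding * using YYI YI by simp
    show "expectation (\<lambda>\<omega>. (Y j s \<omega> - q * \<phi> j) * (Y j t \<omega> - q * \<phi> j)) =
      expectation (\<lambda>\<omega>. Y j s \<omega> * Y j t \<omega>) - (q * \<phi> j)\<^sup>2"
      unfolding * using YYI YI EY by (simp add: prob_space power2_eq_square)
  qed
  have Sint: "integrable M (\<lambda>\<omega>. (S j \<omega>)\<^sup>2)" for j
    unfolding S_def by (rule expectation_sum_square_orthogonal) (use cov YY in auto)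
  have S2: "expectation (\<lambda>\<omega>. (S j \<omega>)\<^sup>2) \<le> real n * q" for j
  proof -
    have "expectation (\<lambda>\<omega>. (S j \<omega>)\<^sup>2) = (\<Sum>t=1..int n. expectation (\<lambda>\<omega>. (Y j t \<omega> - q * \<phi> j)\<^sup>2))"
      unfolding S_def by (rule expectation_sum_square_orthogonal) (use cov YY in auto)
    also have "\<dots> \<le> (\<Sum>t=1..int n. q)"
    proof (rule sum_mono)
      fix t
      show "expectation (\<lambda>\<omega>. (Y j t \<omega> - q * \<phi> j)\<^sup>2) \<le> q"
        using cov(2)[of j t t] EY2[of j t] zero_le_power2[of "q * \<phi> j"]
        unfolding power2_eq_square[of "Y j t _ - _"] power2_eq_square[of "Y j t _"] by linarith
    qed
    finally show ?thesis by simp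
  qed
  have SI: "integrable M (S j)" for j
    by (rule square_integrable_imp_integrable[OF _ Sint]) measurable
  have ES: "expectation (\<lambda>\<omega>. \<bar>S j \<omega>\<bar>) \<le> a * sqrt q" for j
  proof -
    have "expectation (\<lambda>\<omega>. \<bar>S j \<omega>\<bar>) \<le> sqrt (expectation (\<lambda>\<omega>. (S j \<omega>)\<^sup>2))"
      by (rule expectation_abs_le_sqrt[OF _ Sint]) measurable
    also have "\<dots> \<le> sqrt (real n * q)" using S2 by simp
    finally show ?thesis by (simp add: real_sqrt_mult a_def)
  qed
  define \<phi>0 where "\<phi>0 j = (\<integral>s. G (x + B j * s) \<partial>P\<^sub>\<xi>) - G x" for j
  have \<phi>: "\<bar>\<phi> j\<bar> \<le> 1" for j
  proof -
    have "\<bar>\<phi> j\<bar> \<le> (\<integral>s. \<bar>f (B j * s)\<bar> \<partial>P\<^sub>\<xi>)" unfolding \<phi>_def by (rule integral_abs_bound)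
    also have "\<dots> \<le> (\<integral>s. 1 \<partial>P\<^sub>\<xi>)"
      using hm by (intro integral_mono P\<xi>.integrable_const_bound[where B=1]) auto
    finally show ?thesis by (simp add: P\<xi>.prob_space)
  qed
  have \<phi>\<phi>0: "\<bar>\<phi> j - \<phi>0 j\<bar> \<le> 2 * r" for j
  proof -
    have i1: "integrable P\<^sub>\<xi> (\<lambda>s. f (B j * s))"
      using hm by (intro P\<xi>.integrable_const_bound[where B=1]) auto
    have i2: "integrable P\<^sub>\<xi> (\<lambda>s. G (x + B j * s))"
      using G by (intro P\<xi>.integrable_const_bound[where B=1]) auto
    have i3: "integrable P\<^sub>\<xi> (\<lambda>s. G (x + B j * s) - G x)"
      by (rule Bochner_Integration.integrable_diff[OF i2 P\<xi>.integrable_const])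
    have "\<phi> j - \<phi>0 j = (\<integral>s. f (B j * s) - (G (x + B j * s) - G x) \<partial>P\<^sub>\<xi>)"
      unfolding \<phi>_def \<phi>0_def Bochner_Integration.integral_diff[OF i1 i3]
        Bochner_Integration.integral_diff[OF i2 P\<xi>.integrable_const]
      by (simp add: P\<xi>.prob_space)
    then have "\<bar>\<phi> j - \<phi>0 j\<bar> \<le> (\<integral>s. \<bar>f (B j * s) - (G (x + B j * s) - G x)\<bar> \<partial>P\<^sub>\<xi>)"
      by (simp only: integral_abs_bound)
    also have "\<dots> \<le> (\<integral>s. 2 * r \<partial>P\<^sub>\<xi>)"
    proof (rule integral_mono)
      fix s
      show "\<bar>f (B j * s) - (G (x + B j * s) - G x)\<bar> \<le> 2 * r"
        using A_G[of "x + B j * s"] A_G[of x] unfolding f_def by linarith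
      show "integrable P\<^sub>\<xi> (\<lambda>s. \<bar>f (B j * s) - (G (x + B j * s) - G x)\<bar>)"
        by (intro integrable_abs Bochner_Integration.integrable_diff i1 i3)
    qed (rule P\<xi>.integrable_const)
    finally show ?thesis by (simp add: P\<xi>.prob_space)
  qed
  have dec: "?gap \<omega> =
      (\<Sum>j=0..p. S j \<omega> / a + (a * q * \<phi> j - \<gamma> * \<phi>0 j))" for \<omega>
  proof -
    have "(\<Sum>t=1..int n. outlier_effect t \<omega>) = (\<Sum>j=0..p. \<Sum>t=1..int n. Y j t \<omega>)"
      unfolding outlier_effect_def Y_def by (rule sum.swap)
    also have "\<dots> = (\<Sum>j=0..p. S j \<omega> + a * (a * q * \<phi> j))"
      by (simp add: S_def sum_subtractf mult.assoc[symmetric] sqrt_n(4))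
    finally have "(\<Sum>t=1..int n. outlier_effect t \<omega>) / a = (\<Sum>j=0..p. S j \<omega> / a + a * q * \<phi> j)"
      using sqrt_n by (simp add: sum_divide_distrib add_divide_distrib)
    moreover have "Delta p \<beta> G P\<^sub>\<xi> x = (\<Sum>j=0..p. \<phi>0 j)"
      by (simp add: Delta_def \<phi>0_def B_def)
    ultimately show ?thesis
      by (simp add: sum_distrib_left sum_subtractf sum.distrib)
  qed
  show "integrable M (\<lambda>\<omega>. \<bar>?gap \<omega>\<bar>)"
    unfolding dec
    by (intro integrable_abs Bochner_Integration.integrable_sum Bochner_Integration.integrable_add
        integrable_divide_zero SI integrable_const)
  have const: "\<bar>a * q * \<phi> j - \<gamma> * \<phi>0 j\<bar> \<le> \<bar>a * q - \<gamma>\<bar> + 2 * \<gamma> * r" for j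
  proof -
    have "a * q * \<phi> j - \<gamma> * \<phi>0 j = (a * q - \<gamma>) * \<phi> j + \<gamma> * (\<phi> j - \<phi>0 j)" by (simp add: algebra_simps)
    then have "\<bar>a * q * \<phi> j - \<gamma> * \<phi>0 j\<bar> \<le> \<bar>a * q - \<gamma>\<bar> * \<bar>\<phi> j\<bar> + \<gamma> * \<bar>\<phi> j - \<phi>0 j\<bar>"
      using \<gamma> abs_triangle_ineq[of "(a * q - \<gamma>) * \<phi> j" "\<gamma> * (\<phi> j - \<phi>0 j)"] by (simp add: abs_mult)
    also have "\<dots> \<le> \<bar>a * q - \<gamma>\<bar> * 1 + \<gamma> * (2 * r)"
      using \<gamma> \<phi> \<phi>\<phi>0 by (intro add_mono mult_left_mono) auto
    finally show ?thesis by simp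
  qed
  have I: "integrable M (\<lambda>\<omega>. \<bar>S j \<omega>\<bar> / a + (\<bar>a * q - \<gamma>\<bar> + 2 * \<gamma> * r))" for j
    by (intro integrable_abs Bochner_Integration.integrable_add integrable_divide_zero SI integrable_const)
  have EI: "expectation (\<lambda>\<omega>. \<bar>S j \<omega>\<bar> / a + (\<bar>a * q - \<gamma>\<bar> + 2 * \<gamma> * r)) =
      expectation (\<lambda>\<omega>. \<bar>S j \<omega>\<bar>) / a + (\<bar>a * q - \<gamma>\<bar> + 2 * \<gamma> * r)" for j
    using integrable_abs[OF SI[of j]] by (simp add: prob_space)
  have "expectation (\<lambda>\<omega>. \<bar>?gap \<omega>\<bar>)
      \<le> expectation (\<lambda>\<omega>. \<Sum>j=0..p. \<bar>S j \<omega>\<bar> / a + (\<bar>a * q - \<gamma>\<bar> + 2 * \<gamma> * r))"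
    unfolding dec
  proof (rule integral_mono)
    fix \<omega>
    show "\<bar>\<Sum>j=0..p. S j \<omega> / a + (a * q * \<phi> j - \<gamma> * \<phi>0 j)\<bar> \<le>
        (\<Sum>j=0..p. \<bar>S j \<omega>\<bar> / a + (\<bar>a * q - \<gamma>\<bar> + 2 * \<gamma> * r))"
      using const sqrt_n by (intro order.trans[OF sum_abs] sum_mono order.trans[OF abs_triangle_ineq] add_mono) auto
    show "integrable M (\<lambda>\<omega>. \<Sum>j=0..p. \<bar>S j \<omega>\<bar> / a + (\<bar>a * q - \<gamma>\<bar> + 2 * \<gamma> * r))"
      by (intro Bochner_Integration.integrable_sum I)
    show "integrable M (\<lambda>\<omega>. \<bar>\<Sum>j=0..p. S j \<omega> / a + (a * q * \<phi> j - \<gamma> * \<phi>0 j)\<bar>)"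
      by (intro integrable_abs Bochner_Integration.integrable_sum Bochner_Integration.integrable_add
        integrable_divide_zero SI integrable_const)
  qed
  also have "\<dots> = (\<Sum>j=0..p. expectation (\<lambda>\<omega>. \<bar>S j \<omega>\<bar>) / a + (\<bar>a * q - \<gamma>\<bar> + 2 * \<gamma> * r))"
    by (simp only: Bochner_Integration.integral_sum[OF I] EI)
  also have "\<dots> \<le> (\<Sum>j=0..p. sqrt q + (\<bar>a * q - \<gamma>\<bar> + 2 * \<gamma> * r))"
    using ES sqrt_n by (intro sum_mono add_right_mono) (simp add: divide_le_eq mult.commute)
  also have "\<dots> = E3" by (simp add: E3_def)
  finally show "expectation (\<lambda>\<omega>. \<bar>?gap \<omega>\<bar>) \<le> E3" .
qed

text \<open>Adding and subtracting \<open>f (c t)\<close> and \<open>outlier_effect t\<close>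
  telescopes the error into the martingale, linearization and outlier parts. The mean of
  \<open>d0\<close> is left as a random term, since symmetrization removes it later.\<close>

lemma asymptotic_linearity:
  assumes b: "b > 0"
  defines "Z \<equiv> \<lambda>\<omega>. (\<Sum>t=1..int n. indicator {..x + c t \<omega>} (\<epsilon> t \<omega>) - indicator {..x} (\<epsilon> t \<omega>)) / a
      - \<gamma> * Delta p \<beta> G P\<^sub>\<xi> x - g * ((\<Sum>t=1..int n. d0 t \<omega>) / real n)"
  shows "integrable M (\<lambda>\<omega>. \<bar>Z \<omega>\<bar>)" "expectation (\<lambda>\<omega>. \<bar>Z \<omega>\<bar>) \<le> E1 + E2 b + E3"
proof -
  define X1 where "X1 \<omega> = (\<Sum>t=1..int n. indicator {..x + c t \<omega>} (\<epsilon> t \<omega>) - indicator {..x} (\<epsilon> t \<omega>) - f (c t \<omega>)) / a" for \<omega>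
  define X2 where "X2 \<omega> = (\<Sum>t=1..int n. f (c t \<omega>) - outlier_effect t \<omega> - g * d0 t \<omega> / a) / a" for \<omega>
  define X3 where "X3 \<omega> = (\<Sum>t=1..int n. outlier_effect t \<omega>) / a - \<gamma> * Delta p \<beta> G P\<^sub>\<xi> x" for \<omega>
  have Z: "Z \<omega> = X1 \<omega> + X2 \<omega> + X3 \<omega>" for \<omega>
  proof -
    have "g * ((\<Sum>t=1..int n. d0 t \<omega>) / real n) = (\<Sum>t=1..int n. g * d0 t \<omega> / a) / a"
      unfolding sqrt_n(4)[symmetric] by (simp add: sum_divide_distrib[symmetric] sum_distrib_left[symmetric])
    then show ?thesis
      by (simp add: Z_def X1_def X2_def X3_def sum_subtractf diff_divide_distrib)
  qed
  have 1: "integrable M (\<lambda>\<omega>. \<bar>X1 \<omega>\<bar>)" "expectation (\<lambda>\<omega>. \<bar>X1 \<omega>\<bar>) \<le> E1"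
    unfolding X1_def by (rule martingale_part)+
  have 2: "integrable M (\<lambda>\<omega>. \<bar>X2 \<omega>\<bar>)" "expectation (\<lambda>\<omega>. \<bar>X2 \<omega>\<bar>) \<le> E2 b"
    unfolding X2_def using b by (rule linearization_part)+
  have 3: "integrable M (\<lambda>\<omega>. \<bar>X3 \<omega>\<bar>)" "expectation (\<lambda>\<omega>. \<bar>X3 \<omega>\<bar>) \<le> E3"
    unfolding X3_def by (rule outlier_part)+
  have ZM: "Z \<in> borel_measurable M"
    unfolding Z_def
    by (intro borel_measurable_diff borel_measurable_divide borel_measurable_sum borel_measurable_times
        measurable_threshold measurable_d0 borel_measurable_const)
  have i: "integrable M (\<lambda>\<omega>. \<bar>X1 \<omega>\<bar> + \<bar>X2 \<omega>\<bar> + \<bar>X3 \<omega>\<bar>)"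
    by (intro Bochner_Integration.integrable_add 1 2 3)
  have le: "\<bar>Z \<omega>\<bar> \<le> \<bar>X1 \<omega>\<bar> + \<bar>X2 \<omega>\<bar> + \<bar>X3 \<omega>\<bar>" for \<omega> unfolding Z by linarith
  show int: "integrable M (\<lambda>\<omega>. \<bar>Z \<omega>\<bar>)"
  proof (rule Bochner_Integration.integrable_bound[OF i])
    show "(\<lambda>\<omega>. \<bar>Z \<omega>\<bar>) \<in> borel_measurable M" using ZM by (rule borel_measurable_abs)
    show "AE \<omega> in M. norm \<bar>Z \<omega>\<bar> \<le> norm (\<bar>X1 \<omega>\<bar> + \<bar>X2 \<omega>\<bar> + \<bar>X3 \<omega>\<bar>)"
      using le by (intro AE_I2) simp
  qed
  have "expectation (\<lambda>\<omega>. \<bar>Z \<omega>\<bar>) \<le> expectation (\<lambda>\<omega>. \<bar>X1 \<omega>\<bar> + \<bar>X2 \<omega>\<bar> + \<bar>X3 \<omega>\<bar>)"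
    using int i le by (rule integral_mono)
  also have "\<dots> \<le> E1 + E2 b + E3" using 1 2 3 by simp
  finally show "expectation (\<lambda>\<omega>. \<bar>Z \<omega>\<bar>) \<le> E1 + E2 b + E3" .
qed

end

section \<open>Causal approximation of the stationary solution\<close>

lemma ma_coeff_square_sums_bounded:
  assumes roots: "\<And>r::complex.
      r ^ p - (\<Sum>j=1..p. complex_of_real (\<beta> j) * r ^ (p - j)) = 0 \<Longrightarrow> norm r < 1"
  obtains K where "K \<ge> 0" "\<And>m. (\<Sum>k<m. (ma_coeff p \<beta> k)\<^sup>2) \<le> K"
proof -
  obtain C r where C: "C > 0" "0 < r" "r < 1" "\<And>k. \<bar>ma_coeff p \<beta> k\<bar> \<le> C * r ^ k"
    using ma_coeff_geometric[OF roots] by blast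
  have r2: "0 < r\<^sup>2" "r\<^sup>2 < 1" using C by (auto simp: abs_square_less_1)
  show ?thesis
  proof
    show "0 \<le> C\<^sup>2 / (1 - r\<^sup>2)" using r2 by simp
    show "(\<Sum>k<m. (ma_coeff p \<beta> k)\<^sup>2) \<le> C\<^sup>2 / (1 - r\<^sup>2)" for m
    proof -
      have "(\<Sum>k<m. (ma_coeff p \<beta> k)\<^sup>2) \<le> (\<Sum>k<m. C\<^sup>2 * (r\<^sup>2) ^ k)"
      proof (rule sum_mono)
        fix k
        have "\<bar>ma_coeff p \<beta> k\<bar>\<^sup>2 \<le> (C * r ^ k)\<^sup>2" using C(4) by (intro power_mono) auto
        also have "\<dots> = C\<^sup>2 * (r\<^sup>2) ^ k" by (simp add: power_mult_distrib power_mult[symmetric] mult.commute)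
        finally show "(ma_coeff p \<beta> k)\<^sup>2 \<le> C\<^sup>2 * (r\<^sup>2) ^ k" by simp
      qed
      also have "\<dots> = C\<^sup>2 * ((1 - (r\<^sup>2) ^ m) / (1 - r\<^sup>2))"
        using r2 by (simp add: sum_distrib_left[symmetric] sum_gp_strict)
      also have "\<dots> \<le> C\<^sup>2 * (1 / (1 - r\<^sup>2))"
        using r2 by (intro mult_left_mono divide_right_mono) auto
      finally show ?thesis by simp
    qed
  qed
qed

context outlier_ar_model
begin

lemma prob_solution_stationary:
  "prob {\<omega> \<in> space M. \<bar>v s \<omega> - \<mu>\<bar> > h} = prob {\<omega> \<in> space M. \<bar>v 0 \<omega> - \<mu>\<bar> > h}"
proof -
  note [measurable] = solution_measurable
  define S where "S = {w \<in> space (PiM UNIV (\<lambda>_::int. borel)). \<bar>w 0 - \<mu>\<bar> > (h::real)}"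
  have S: "S \<in> sets (PiM UNIV (\<lambda>_::int. borel))" unfolding S_def by measurable
  have path: "(\<lambda>\<omega> t. v (t + k) \<omega>) \<in> measurable M (PiM UNIV (\<lambda>_. borel))" for k
    by (rule measurable_PiM_single') auto
  have "prob {\<omega> \<in> space M. \<bar>v k \<omega> - \<mu>\<bar> > h} = measure (distr M (PiM UNIV (\<lambda>_. borel)) (\<lambda>\<omega> t. v (t + k) \<omega>)) S" for k
    unfolding measure_distr[OF path S] by (rule arg_cong[where f=prob]) (auto simp: S_def space_PiM)
  from this[of s] this[of 0] show ?thesis
    using stationary by (simp add: strictly_stationary_def)
qed

lemma tail_prob_small:
  fixes X :: "'a \<Rightarrow> real"
  assumes X: "X \<in> borel_measurable M" and e: "e > 0"
  obtains h where "h > 0" "prob {\<omega> \<in> space M. \<bar>X \<omega>\<bar> > h} < e"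
proof -
  note [measurable] = X
  interpret D: real_distribution "distr M borel (\<lambda>\<omega>. \<bar>X \<omega>\<bar>)" by simp
  have eq: "prob {\<omega> \<in> space M. \<bar>X \<omega>\<bar> > h} = 1 - cdf (distr M borel (\<lambda>\<omega>. \<bar>X \<omega>\<bar>)) h" for h
  proof -
    have "cdf (distr M borel (\<lambda>\<omega>. \<bar>X \<omega>\<bar>)) h = prob {\<omega> \<in> space M. \<bar>X \<omega>\<bar> \<le> h}"
      unfolding cdf_def by (subst measure_distr) (auto intro!: arg_cong[where f=prob])
    moreover have "{\<omega> \<in> space M. \<bar>X \<omega>\<bar> > h} = space M - {\<omega> \<in> space M. \<bar>X \<omega>\<bar> \<le> h}" by auto
    ultimately show ?thesis by (simp add: prob_compl)
  qed
  have "\<forall>\<^sub>F h in at_top. cdf (distr M borel (\<lambda>\<omega>. \<bar>X \<omega>\<bar>)) h > 1 - e"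
    using D.cdf_lim_at_top_prob e by (intro order_tendstoD(1)) auto
  then have "\<forall>\<^sub>F h in at_top. cdf (distr M borel (\<lambda>\<omega>. \<bar>X \<omega>\<bar>)) h > 1 - e \<and> h > 0"
    by (intro eventually_conj eventually_gt_at_top)
  from eventually_happens'[OF trivial_limit_at_top_linorder this]
  show ?thesis using that eq by fastforce
qed

text \<open>
  The remainder involves \<open>v\<close> at \<open>p\<close> lags beyond \<open>m\<close> with geometrically small coefficients, and by
  stationarity \<open>v\<close> is tight.
\<close>

lemma ma_approximation:
  assumes roots: "\<And>r::complex.
      r ^ p - (\<Sum>j=1..p. complex_of_real (\<beta> j) * r ^ (p - j)) = 0 \<Longrightarrow> norm r < 1"
    and mu: "\<nu> = (1 - (\<Sum>j=1..p. \<beta> j)) * \<mu>"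
    and T: "finite T" and \<kappa>: "\<kappa> > 0" and e: "e > 0"
  obtains m where "prob {\<omega> \<in> space M. \<exists>t\<in>T. \<bar>v t \<omega> - \<mu> - ma m t \<omega>\<bar> > \<kappa>} \<le> e"
proof -
  note [measurable] = solution_measurable
  obtain C r where C: "C > 0" "0 < r" "r < 1" "\<And>k. \<bar>ma_coeff p \<beta> k\<bar> \<le> C * r ^ k"
    using ma_coeff_geometric[OF roots] by blast
  \<comment> \<open>The union bound at the end runs over \<open>card T * p\<close> events, one for
    each time and lag; the added 1 keeps the division meaningful.\<close>
  define N where "N = real (card T) * real p + 1"
  have N: "N > 0" by (auto simp: N_def intro!: add_nonneg_pos)
  obtain h where h: "h > 0" "prob {\<omega> \<in> space M. \<bar>v 0 \<omega> - \<mu>\<bar> > h} < e / N"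
    using tail_prob_small[of "\<lambda>\<omega>. v 0 \<omega> - \<mu>" "e / N"] e N by auto
  define b where "b = 1 + (\<Sum>j=1..p. \<bar>\<beta> j\<bar>)"
  have b: "b > 0" by (auto simp: b_def intro!: add_pos_nonneg sum_nonneg)
  have \<beta>b: "\<bar>\<beta> j\<bar> \<le> b" if "j \<in> {1..p}" for j
    using member_le_sum[of j "{1..p}" "\<lambda>j. \<bar>\<beta> j\<bar>"] that by (simp add: b_def)
  \<comment> \<open>The remainder consists of at most \<open>p * p\<close> products, each at most
    \<open>b * (C * r ^ k) * h\<close>; the added 1 makes \<open>Q\<close> positive.\<close>
  define Q where "Q = real p * real p * b * C * h + 1"
  have Q: "Q > 0" using b C h by (auto simp: Q_def intro!: add_nonneg_pos)
  obtain k where k: "r ^ k < \<kappa> / Q"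
    using real_arch_pow_inv[of "\<kappa> / Q" r] \<kappa> Q C by auto
  \<comment> \<open>A weight in the remainder has index at least \<open>m - p\<close>, so this
    choice bounds all of them by \<open>C * r ^ k\<close>.\<close>
  define m where "m = p + k + 1"
  define u where "u t \<omega> = v t \<omega> - \<mu>" for t \<omega>
  have rec: "AE \<omega> in M. \<forall>t. u t \<omega> = (\<Sum>j=1..p. \<beta> j * u (t - int j) \<omega>) + \<epsilon> t \<omega>"
    unfolding AE_all_countable
  proof
    fix t
    show "AE \<omega> in M. u t \<omega> = (\<Sum>j=1..p. \<beta> j * u (t - int j) \<omega>) + \<epsilon> t \<omega>"
      using recursion[of t]
      by eventually_elim
        (simp add: u_def mu algebra_simps sum_subtractf sum_distrib_left sum_distrib_right)
  qed
  have small: "\<bar>u t \<omega> - ma m t \<omega>\<bar> \<le> \<kappa>"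
    if rec: "\<forall>t. u t \<omega> = (\<Sum>j=1..p. \<beta> j * u (t - int j) \<omega>) + \<epsilon> t \<omega>"
      and le: "\<And>l. l \<in> {m..<m + p} \<Longrightarrow> \<bar>u (t - int l) \<omega>\<bar> \<le> h" for t \<omega>
  proof -
    have exp: "u t \<omega> - ma m t \<omega> =
        (\<Sum>j=1..p. \<Sum>k\<in>{m - j..<m}. \<beta> j * ma_coeff p \<beta> k * u (t - int k - int j) \<omega>)"
      using ar_solution_expansion[of "\<lambda>s. u s \<omega>" \<beta> p "\<lambda>s. \<epsilon> s \<omega>" m t, OF spec[OF rec]]
      unfolding ma_def by (simp add: m_def)
    have "\<bar>u t \<omega> - ma m t \<omega>\<bar> \<le> (\<Sum>j=1..p. \<Sum>l\<in>{m - j..<m}. b * (C * r ^ k) * h)"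
      unfolding exp
    proof (intro order.trans[OF sum_abs] sum_mono)
      fix j l assume j: "j \<in> {1..p}" and l: "l \<in> {m - j..<m}"
      have "C * r ^ l \<le> C * r ^ k"
        using C(1-3) j l by (intro mult_left_mono power_decreasing) (auto simp: m_def)
      then have \<psi>: "\<bar>ma_coeff p \<beta> l\<bar> \<le> C * r ^ k" by (rule order.trans[OF C(4)])
      have "l + j \<in> {m..<m + p}" using j l by auto
      from le[OF this] have "\<bar>u (t - int l - int j) \<omega>\<bar> \<le> h"
        by (simp add: diff_diff_eq)
      then show "\<bar>\<beta> j * ma_coeff p \<beta> l * u (t - int l - int j) \<omega>\<bar> \<le> b * (C * r ^ k) * h"
        unfolding abs_mult using \<beta>b[OF j] \<psi> b C by (intro mult_mono) auto
    qed
    also have "\<dots> \<le> (\<Sum>j=1..p. real p * (b * (C * r ^ k) * h))"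
      using b C h by (intro sum_mono) (auto intro!: mult_right_mono)
    also have "\<dots> = (Q - 1) * r ^ k" by (simp add: Q_def algebra_simps)
    also have "\<dots> \<le> Q * r ^ k" using C by (intro mult_right_mono) auto
    also have "\<dots> \<le> \<kappa>" using k Q by (simp add: less_divide_eq mult.commute)
    finally show ?thesis .
  qed
  let ?I = "T \<times> {m..<m + p}"
  let ?E = "\<lambda>i. {\<omega> \<in> space M. \<bar>v (fst i - int (snd i)) \<omega> - \<mu>\<bar> > h}"
  have "prob {\<omega> \<in> space M. \<exists>t\<in>T. \<bar>v t \<omega> - \<mu> - ma m t \<omega>\<bar> > \<kappa>} \<le> prob (\<Union>i\<in>?I. ?E i)"
  proof (rule finite_measure_mono_AE)
    show "AE \<omega> in M. \<omega> \<in> {\<omega> \<in> space M. \<exists>t\<in>T. \<bar>v t \<omega> - \<mu> - ma m t \<omega>\<bar> > \<kappa>} \<longrightarrow> \<omega> \<in> (\<Union>i\<in>?I. ?E i)"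
      using rec
    proof eventually_elim
      case (elim \<omega>)
      show ?case
      proof
        assume "\<omega> \<in> {\<omega> \<in> space M. \<exists>t\<in>T. \<bar>v t \<omega> - \<mu> - ma m t \<omega>\<bar> > \<kappa>}"
        then obtain t where t: "\<omega> \<in> space M" "t \<in> T" "\<not> \<bar>u t \<omega> - ma m t \<omega>\<bar> \<le> \<kappa>"
          by (auto simp: u_def)
        have "\<exists>l\<in>{m..<m + p}. \<not> \<bar>u (t - int l) \<omega>\<bar> \<le> h"
        proof (rule ccontr)
          assume "\<not> (\<exists>l\<in>{m..<m + p}. \<not> \<bar>u (t - int l) \<omega>\<bar> \<le> h)"
          with t(3) small[OF elim, of t] show False by blast
        qed
        then obtain l where l: "l \<in> {m..<m + p}" "\<bar>u (t - int l) \<omega>\<bar> > h" by (auto simp: not_le)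
        show "\<omega> \<in> (\<Union>i\<in>?I. ?E i)"
          by (rule UN_I[of "(t, l)"]) (use t l in \<open>simp_all add: u_def\<close>)
      qed
    qed
    show "(\<Union>i\<in>?I. ?E i) \<in> events" using T by (intro sets.finite_UN) auto
  qed
  also have "\<dots> \<le> (\<Sum>i\<in>?I. prob (?E i))"
    using T by (intro finite_measure_subadditive_finite) auto
  also have "\<dots> = real (card ?I) * prob {\<omega> \<in> space M. \<bar>v 0 \<omega> - \<mu>\<bar> > h}"
  proof -
    have "prob (?E i) = prob {\<omega> \<in> space M. \<bar>v 0 \<omega> - \<mu>\<bar> > h}" for i
      by (rule prob_solution_stationary)
    then show ?thesis by (simp only: sum_constant)
  qed
  also have "\<dots> \<le> N * (e / N)"
    using h N by (intro mult_mono) (auto simp: N_def card_cartesian_product)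
  also have "\<dots> = e" using N by simp
  finally show ?thesis by (rule that)
qed

end

section \<open>Bracketing the residual empirical process\<close>

lemma finite_grid:
  fixes K h :: real
  assumes h: "h > 0" and K: "K \<ge> 0"
  obtains \<G> :: "(real \<times> (nat \<Rightarrow> real)) set" where "finite \<G>"
    "\<And>\<tau> \<theta>. \<bar>\<tau>\<bar> \<le> K \<Longrightarrow> (\<And>j. j \<in> {1..p} \<Longrightarrow> \<bar>\<theta> j\<bar> \<le> K) \<Longrightarrow>
       \<exists>(\<tau>', \<theta>')\<in>\<G>. \<bar>\<tau> - \<tau>'\<bar> \<le> h \<and> (\<forall>j\<in>{1..p}. \<bar>\<theta> j - \<theta>' j\<bar> \<le> h)"
proof -
  define S where "S = (\<lambda>i. h * real_of_int i) ` {- \<lceil>K / h\<rceil> - 1..\<lceil>K / h\<rceil> + 1}"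
  have S: "finite S" by (simp add: S_def)
  have near: "h * real_of_int \<lfloor>s / h\<rfloor> \<in> S \<and> \<bar>s - h * real_of_int \<lfloor>s / h\<rfloor>\<bar> \<le> h" if "\<bar>s\<bar> \<le> K" for s
  proof
    have "s / h \<le> K / h" "- (K / h) \<le> s / h"
      using that h by (auto simp: abs_le_iff field_simps)
    then have "\<lfloor>s / h\<rfloor> \<le> \<lceil>K / h\<rceil>" "- \<lceil>K / h\<rceil> - 1 \<le> \<lfloor>s / h\<rfloor>" by linarith+
    then show "h * real_of_int \<lfloor>s / h\<rfloor> \<in> S" by (auto simp: S_def)
    have "s - h * real_of_int \<lfloor>s / h\<rfloor> = h * (s / h - real_of_int \<lfloor>s / h\<rfloor>)"
      using h by (simp add: right_diff_distrib)
    moreover have "0 \<le> s / h - real_of_int \<lfloor>s / h\<rfloor>" "s / h - real_of_int \<lfloor>s / h\<rfloor> \<le> 1" by linarith+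
    ultimately show "\<bar>s - h * real_of_int \<lfloor>s / h\<rfloor>\<bar> \<le> h"
      using h mult_left_mono[of "s / h - real_of_int \<lfloor>s / h\<rfloor>" 1 h] by (simp add: abs_mult)
  qed
  show ?thesis
  proof
    \<comment> \<open>Extensional functions keep the grid finite: only the coordinates
      \<open>1, \<dots>, p\<close> vary.\<close>
    show "finite (S \<times> ({1..p} \<rightarrow>\<^sub>E S))" using S by (intro finite_cartesian_product finite_PiE) auto
    fix \<tau> and \<theta> :: "nat \<Rightarrow> real"
    assume a: "\<bar>\<tau>\<bar> \<le> K" "\<And>j. j \<in> {1..p} \<Longrightarrow> \<bar>\<theta> j\<bar> \<le> K"
    show "\<exists>(\<tau>', \<theta>')\<in>S \<times> ({1..p} \<rightarrow>\<^sub>E S). \<bar>\<tau> - \<tau>'\<bar> \<le> h \<and> (\<forall>j\<in>{1..p}. \<bar>\<theta> j - \<theta>' j\<bar> \<le> h)"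
      by (rule bexI[of _ "(h * real_of_int \<lfloor>\<tau> / h\<rfloor>, \<lambda>j\<in>{1..p}. h * real_of_int \<lfloor>\<theta> j / h\<rfloor>)"])
        (use near a in \<open>auto simp del: of_int_floor_le\<close>)
  qed
qed

text \<open>A product \<open>\<theta> j * u - \<theta>' j * X\<close> splits into
  \<open>(\<theta> j - \<theta>' j) * X\<close> and \<open>\<theta> j * (u - X)\<close>. The slack
  \<open>\<eta> * \<bar>X\<bar>\<close> absorbs the first. The second parts sum to at most
  \<open>\<eta> / 2\<close>, and with the error \<open>\<eta> / 2\<close> of the intercept they use
  up the constant slack \<open>\<eta>\<close>.\<close>

lemma lin_shift_bracket:
  fixes u X :: "int \<Rightarrow> real"
  assumes \<tau>: "\<bar>\<tau> - \<tau>'\<bar> \<le> \<eta> / 2" and \<theta>: "\<And>j. j \<in> {1..p} \<Longrightarrow> \<bar>\<theta> j - \<theta>' j\<bar> \<le> \<eta>"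
    and K: "\<And>j. j \<in> {1..p} \<Longrightarrow> \<bar>\<theta> j\<bar> \<le> K"
    and u: "\<And>j. j \<in> {1..p} \<Longrightarrow> \<bar>u (t - int j) - X (t - int j)\<bar> \<le> \<kappa>"
    and \<kappa>: "real p * (K * \<kappa>) \<le> \<eta> / 2"
  shows "lin_shift p \<tau>' \<theta>' (- \<eta>) X t \<le> \<tau> + (\<Sum>j=1..p. \<theta> j * u (t - int j))"
    and "\<tau> + (\<Sum>j=1..p. \<theta> j * u (t - int j)) \<le> lin_shift p \<tau>' \<theta>' \<eta> X t"
proof -
  define d where "d j = \<theta> j * u (t - int j) - \<theta>' j * X (t - int j)" for j
  have dj: "\<bar>d j\<bar> \<le> \<eta> * \<bar>X (t - int j)\<bar> + K * \<kappa>" if j: "j \<in> {1..p}" for j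
  proof -
    have "d j = (\<theta> j - \<theta>' j) * X (t - int j) + \<theta> j * (u (t - int j) - X (t - int j))"
      by (simp add: d_def algebra_simps)
    then have "\<bar>d j\<bar> \<le> \<bar>\<theta> j - \<theta>' j\<bar> * \<bar>X (t - int j)\<bar> + \<bar>\<theta> j\<bar> * \<bar>u (t - int j) - X (t - int j)\<bar>"
      using abs_triangle_ineq[of "(\<theta> j - \<theta>' j) * X (t - int j)" "\<theta> j * (u (t - int j) - X (t - int j))"]
      by (simp only: abs_mult)
    also have "\<dots> \<le> \<eta> * \<bar>X (t - int j)\<bar> + K * \<kappa>"
    proof (rule add_mono)
      show "\<bar>\<theta> j - \<theta>' j\<bar> * \<bar>X (t - int j)\<bar> \<le> \<eta> * \<bar>X (t - int j)\<bar>"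
        using \<theta>[OF j] by (rule mult_right_mono) simp
      have "0 \<le> K" using K[OF j] by linarith
      then show "\<bar>\<theta> j\<bar> * \<bar>u (t - int j) - X (t - int j)\<bar> \<le> K * \<kappa>"
        by (rule mult_mono[OF K[OF j] u[OF j]]) simp
    qed
    finally show ?thesis .
  qed
  have "\<bar>\<Sum>j=1..p. d j\<bar> \<le> (\<Sum>j=1..p. \<eta> * \<bar>X (t - int j)\<bar> + K * \<kappa>)"
    by (rule order.trans[OF sum_abs sum_mono]) (rule dj)
  also have "\<dots> = \<eta> * (\<Sum>j=1..p. \<bar>X (t - int j)\<bar>) + real p * (K * \<kappa>)"
    by (simp add: sum.distrib sum_distrib_left)
  finally have s1: "\<bar>\<Sum>j=1..p. d j\<bar> \<le> \<eta> * (\<Sum>j=1..p. \<bar>X (t - int j)\<bar>) + \<eta> / 2" using \<kappa> by linarith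
  have s2: "(\<Sum>j=1..p. d j) = (\<Sum>j=1..p. \<theta> j * u (t - int j)) - (\<Sum>j=1..p. \<theta>' j * X (t - int j))"
    by (simp add: d_def sum_subtractf)
  have s3: "lin_shift p \<tau>' \<theta>' \<sigma> X t =
      \<tau>' + (\<Sum>j=1..p. \<theta>' j * X (t - int j)) + \<sigma> + \<sigma> * (\<Sum>j=1..p. \<bar>X (t - int j)\<bar>)" for \<sigma>
    by (simp add: lin_shift_def distrib_left)
  show "lin_shift p \<tau>' \<theta>' (- \<eta>) X t \<le> \<tau> + (\<Sum>j=1..p. \<theta> j * u (t - int j))"
    using s1 s2 \<tau> unfolding s3 mult_minus_left by linarith
  show "\<tau> + (\<Sum>j=1..p. \<theta> j * u (t - int j)) \<le> lin_shift p \<tau>' \<theta>' \<eta> X t"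
    using s1 s2 \<tau> unfolding s3 by linarith
qed

context outlier_ar_model
begin

text \<open>This is the normalized change of the empirical distribution function at \<open>x\<close>
  when the estimated coefficients are frozen at a grid point. The coefficients are arguments rather
  than locale parameters, so that several grid points, both signs of the slack and both
  \<open>x\<close> and \<open>- x\<close> can be treated in one model.\<close>

definition shift_count :: "nat \<Rightarrow> real \<Rightarrow> real \<Rightarrow> (nat \<Rightarrow> real) \<Rightarrow> real \<Rightarrow> 'a \<Rightarrow> real" where
  "shift_count m x \<tau> \<theta> \<eta> \<omega> =
     (\<Sum>t=1..int n. indicator {..x + (lin_shift p \<tau> \<theta> \<eta> (\<lambda>s. ma m s \<omega> + z s \<omega> * \<xi> s \<omega>) t / sqrt (real n) +
         (\<Sum>j=0..p. (\<beta>(0 := -1)) j * (z (t - int j) \<omega> * \<xi> (t - int j) \<omega>)))} (\<epsilon> t \<omega>)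
       - indicator {..x} (\<epsilon> t \<omega>)) / sqrt (real n)"

definition shift_mean :: "nat \<Rightarrow> real \<Rightarrow> (nat \<Rightarrow> real) \<Rightarrow> real \<Rightarrow> 'a \<Rightarrow> real" where
  "shift_mean m \<tau> \<theta> \<eta> \<omega> = (\<Sum>t=1..int n. lin_shift p \<tau> \<theta> \<eta> (\<lambda>s. ma m s \<omega>) t) / real n"

text \<open>The upper and lower brackets have means that differ by \<open>2 * \<eta>\<close> times
  this quantity. Its bounded expectation makes the width of the bracket proportional to
  \<open>\<eta>\<close>.\<close>

definition abs_mean :: "nat \<Rightarrow> 'a \<Rightarrow> real" where
  "abs_mean m \<omega> = (\<Sum>t=1..int n. 1 + (\<Sum>j=1..p. \<bar>ma m (t - int j) \<omega>\<bar>)) / real n"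

lemma measurable_abs_mean [measurable]: "abs_mean m \<in> borel_measurable M"
  unfolding abs_mean_def by measurable

lemma shift_mean_diff: "shift_mean m \<tau> \<theta> \<eta> \<omega> - shift_mean m \<tau> \<theta> (- \<eta>) \<omega> = 2 * \<eta> * abs_mean m \<omega>"
proof -
  have "shift_mean m \<tau> \<theta> \<eta> \<omega> - shift_mean m \<tau> \<theta> (- \<eta>) \<omega> =
      (\<Sum>t=1..int n. 2 * \<eta> * (1 + (\<Sum>j=1..p. \<bar>ma m (t - int j) \<omega>\<bar>))) / real n"
    unfolding shift_mean_def diff_divide_distrib[symmetric] sum_subtractf[symmetric]
    by (intro arg_cong2[where f="(/)"] sum.cong refl) (simp add: lin_shift_def)
  then show ?thesis
    unfolding abs_mean_def by (simp only: sum_distrib_left[symmetric] times_divide_eq_right)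
qed

lemma expectation_abs_mean:
  assumes n: "n \<ge> 1" and V: "\<And>t. integrable M (\<lambda>\<omega>. (ma m t \<omega>)\<^sup>2)" "\<And>t. expectation (\<lambda>\<omega>. (ma m t \<omega>)\<^sup>2) \<le> V"
  shows "integrable M (abs_mean m)" "expectation (abs_mean m) \<le> 1 + real p * (1 + V)"
proof -
  have int: "integrable M (\<lambda>\<omega>. \<bar>ma m t \<omega>\<bar>)" for t
    by (rule integrable_abs[OF square_integrable_imp_integrable[OF measurable_ma V(1)]])
  note abs_le_one_plus_square
  then have le: "expectation (\<lambda>\<omega>. \<bar>ma m t \<omega>\<bar>) \<le> expectation (\<lambda>\<omega>. 1 + (ma m t \<omega>)\<^sup>2)" for t
    using V(1)[of t] int[of t] by (intro integral_mono) auto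
  have E: "expectation (\<lambda>\<omega>. \<bar>ma m t \<omega>\<bar>) \<le> 1 + V" for t
    using le[of t] V[of t] by (simp add: prob_space)
  have I1: "integrable M (\<lambda>\<omega>. \<Sum>j=1..p. \<bar>ma m (t - int j) \<omega>\<bar>)" for t
    by (intro Bochner_Integration.integrable_sum int)
  have I2: "integrable M (\<lambda>\<omega>. 1 + (\<Sum>j=1..p. \<bar>ma m (t - int j) \<omega>\<bar>))" for t
    by (intro Bochner_Integration.integrable_add integrable_const I1)
  show "integrable M (abs_mean m)"
    unfolding abs_mean_def[abs_def] by (intro integrable_divide_zero Bochner_Integration.integrable_sum I2)
  have "expectation (abs_mean m) = (\<Sum>t=1..int n. expectation (\<lambda>\<omega>. 1 + (\<Sum>j=1..p. \<bar>ma m (t - int j) \<omega>\<bar>))) / real n"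
    unfolding abs_mean_def[abs_def] by (simp only: integral_divide_zero Bochner_Integration.integral_sum[OF I2])
  also have "\<dots> \<le> (\<Sum>t=1..int n. 1 + real p * (1 + V)) / real n"
  proof (intro divide_right_mono sum_mono)
    fix t
    have "expectation (\<lambda>\<omega>. 1 + (\<Sum>j=1..p. \<bar>ma m (t - int j) \<omega>\<bar>)) =
        expectation (\<lambda>\<omega>. 1) + (\<Sum>j=1..p. expectation (\<lambda>\<omega>. \<bar>ma m (t - int j) \<omega>\<bar>))"
      by (simp only: Bochner_Integration.integral_add[OF integrable_const I1] Bochner_Integration.integral_sum[OF int])
    also have "\<dots> \<le> 1 + (\<Sum>j=1..p. 1 + V)"
      by (intro add_mono sum_mono E) (simp add: prob_space)
    finally show "expectation (\<lambda>\<omega>. 1 + (\<Sum>j=1..p. \<bar>ma m (t - int j) \<omega>\<bar>)) \<le> 1 + real p * (1 + V)" by simp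
  qed simp
  also have "\<dots> = 1 + real p * (1 + V)" using n by simp
  finally show "expectation (abs_mean m) \<le> 1 + real p * (1 + V)" .
qed

text \<open>Inserting the model into the residual leaves the innovation minus the estimation error
  minus the outlier combination, without remainder: the intercept carries the estimated
  \<open>b\<close>, not \<open>\<beta>\<close>, so the product of the two estimation errors is
  included. Scaling by \<open>a\<close> brings the coefficients to the order one at which they are
  bounded in probability.\<close>

lemma residual_le_iff:
  assumes n: "n \<ge> 1" and mu: "\<nu> = (1 - (\<Sum>j=1..p. \<beta> j)) * \<mu>"
    and t: "t \<in> {1..int n}" and \<omega>: "\<omega> \<in> space M"
    and rec: "v t \<omega> = (\<Sum>j=1..p. \<beta> j * v (t - int j) \<omega>) + \<nu> + \<epsilon> t \<omega>"
  defines "a \<equiv> sqrt (real n)"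
  shows "residual p k b (sample p n y \<omega>) t \<le> x \<longleftrightarrow>
    \<epsilon> t \<omega> \<le> x + ((a * (k - \<mu>) * (1 - (\<Sum>j=1..p. b j)) +
        (\<Sum>j=1..p. a * (b j - \<beta> j) * (v (t - int j) \<omega> - \<mu> + z (t - int j) \<omega> * \<xi> (t - int j) \<omega>))) / a +
        (\<Sum>j=0..p. (\<beta>(0 := -1)) j * (z (t - int j) \<omega> * \<xi> (t - int j) \<omega>)))"
proof -
  define w where "w s = z s \<omega> * \<xi> s \<omega>" for s
  define u where "u s = v s \<omega> - \<mu>" for s
  have a: "a > 0" using n by (simp add: a_def)
  have Y: "sample p n y \<omega> s = u s + w s + \<mu>" if "s \<in> {1 - int p..int n}" for s
    using that observations[OF that \<omega>] by (simp add: sample_def u_def w_def)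
  have Yt: "sample p n y \<omega> t = u t + w t + \<mu>" using t by (intro Y) auto
  have Yj: "sample p n y \<omega> (t - int j) = u (t - int j) + w (t - int j) + \<mu>" if "j \<in> {1..p}" for j
    using t that by (intro Y) auto
  have ut: "u t = (\<Sum>j=1..p. \<beta> j * u (t - int j)) + \<epsilon> t \<omega>"
    unfolding u_def rec mu by (simp add: algebra_simps sum_subtractf sum_distrib_left sum_distrib_right)
  have "residual p k b (sample p n y \<omega>) t =
      (u t + w t - (k - \<mu>)) - (\<Sum>j=1..p. b j * (u (t - int j) + w (t - int j) - (k - \<mu>)))"
    unfolding residual_def Yt using Yj by (auto intro!: sum.cong arg_cong2[where f="(-)"])
  also have "\<dots> = \<epsilon> t \<omega> - ((k - \<mu>) * (1 - (\<Sum>j=1..p. b j)) +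
      (\<Sum>j=1..p. (b j - \<beta> j) * (u (t - int j) + w (t - int j)))) - (- w t + (\<Sum>j=1..p. \<beta> j * w (t - int j)))"
    unfolding ut by (simp add: algebra_simps sum.distrib sum_subtractf sum_distrib_left sum_distrib_right)
  also have "- w t + (\<Sum>j=1..p. \<beta> j * w (t - int j)) = (\<Sum>j=0..p. (\<beta>(0 := -1)) j * w (t - int j))"
  proof -
    have "(\<Sum>j=0..p. (\<beta>(0 := -1)) j * w (t - int j)) = - w t + (\<Sum>j=1..p. (\<beta>(0 := -1)) j * w (t - int j))"
      by (subst sum.atLeast_Suc_atMost) auto
    also have "(\<Sum>j=1..p. (\<beta>(0 := -1)) j * w (t - int j)) = (\<Sum>j=1..p. \<beta> j * w (t - int j))"
      by (intro sum.cong) auto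
    finally show ?thesis by simp
  qed
  finally have res: "residual p k b (sample p n y \<omega>) t = \<epsilon> t \<omega> - ((k - \<mu>) * (1 - (\<Sum>j=1..p. b j)) +
      (\<Sum>j=1..p. (b j - \<beta> j) * (u (t - int j) + w (t - int j)))) - (\<Sum>j=0..p. (\<beta>(0 := -1)) j * w (t - int j))" .
  have "(a * (k - \<mu>) * (1 - (\<Sum>j=1..p. b j)) + (\<Sum>j=1..p. a * (b j - \<beta> j) * (u (t - int j) + w (t - int j)))) / a =
      (k - \<mu>) * (1 - (\<Sum>j=1..p. b j)) + (\<Sum>j=1..p. (b j - \<beta> j) * (u (t - int j) + w (t - int j)))"
    using a by (simp add: mult.assoc sum_distrib_left[symmetric] distrib_left[symmetric])
  with res show ?thesis unfolding u_def[symmetric] w_def[symmetric] by linarith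
qed

end

text \<open>An upper bound for \<open>E1 + E2 + E3\<close> in terms of \<open>s = 1 / a\<close> and
  \<open>T = tail\<close>. The contamination and the weight of the alternative are replaced by their
  largest values \<open>\<Gamma> * s\<close> and \<open>R * s\<close>, which yields uniformity in
  both.\<close>

definition linearity_error :: "nat \<Rightarrow> real \<Rightarrow> real \<Rightarrow> real \<Rightarrow> real \<Rightarrow> real \<Rightarrow> real \<Rightarrow> real" where
  "linearity_error p L D \<Gamma> R T s =
     sqrt ((L * (1 + D) + real (p + 1) * \<Gamma>) * s) +
     ((L * D + 2 * L * R * (1 + D) + 2 * real ((p + 1)\<^sup>2) * \<Gamma>\<^sup>2) * s +
      real (p + 1) * (2 * L * (\<Gamma> + D) * sqrt s + \<Gamma> * T)) +
     real (p + 1) * (sqrt (\<Gamma> * s) + 2 * \<Gamma> * R * s)"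

lemma linearity_error_tendsto:
  assumes "(T \<longlongrightarrow> 0) F" "(s \<longlongrightarrow> 0) F"
  shows "((\<lambda>n. linearity_error p L D \<Gamma> R (T n) (s n)) \<longlongrightarrow> 0) F"
proof -
  have "((\<lambda>n. linearity_error p L D \<Gamma> R (T n) (s n)) \<longlongrightarrow> linearity_error p L D \<Gamma> R 0 0) F"
    unfolding linearity_error_def by (intro tendsto_intros assms)
  then show ?thesis by (simp add: linearity_error_def)
qed

context shifted_ar_model
begin

text \<open>\<open>asymptotic_linearity\<close> is applied with \<open>b = sqrt a\<close>. As
  \<open>q\<close> is of order \<open>1 / a\<close>, both \<open>q * b\<close> and
  \<open>D / b\<close> are then of order \<open>1 / sqrt a\<close>.\<close>

lemma shift_count_error:
  assumes aq: "sqrt (real n) * q = \<gamma>" and \<Gamma>: "\<gamma> \<le> \<Gamma>" and R: "r \<le> R / sqrt (real n)"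
  shows "integrable M (\<lambda>\<omega>. \<bar>shift_count m x \<tau> \<theta> \<eta> \<omega> - \<gamma> * Delta p \<beta> G P\<^sub>\<xi> x - g * shift_mean m \<tau> \<theta> \<eta> \<omega>\<bar>)"
    and "expectation (\<lambda>\<omega>. \<bar>shift_count m x \<tau> \<theta> \<eta> \<omega> - \<gamma> * Delta p \<beta> G P\<^sub>\<xi> x - g * shift_mean m \<tau> \<theta> \<eta> \<omega>\<bar>)
      \<le> linearity_error p L D \<Gamma> R tail (1 / sqrt (real n))"
proof -
  let ?gap = "\<lambda>\<omega>. shift_count m x \<tau> \<theta> \<eta> \<omega> - \<gamma> * Delta p \<beta> G P\<^sub>\<xi> x - g * shift_mean m \<tau> \<theta> \<eta> \<omega>"
  define s where "s = 1 / a"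
  have s: "s > 0" "s \<le> 1" using sqrt_n(1,2) by (simp_all add: s_def)
  have sn: "1 / sqrt (real n) = s" by (simp add: s_def a_def)
  have b: "sqrt a > 0" using sqrt_n by simp
  have eq: "?gap \<omega> =
      (\<Sum>t=1..int n. indicator {..x + c t \<omega>} (\<epsilon> t \<omega>) - indicator {..x} (\<epsilon> t \<omega>)) / a
      - \<gamma> * Delta p \<beta> G P\<^sub>\<xi> x - g * ((\<Sum>t=1..int n. d0 t \<omega>) / real n)" for \<omega>
    by (simp only: shift_count_def shift_mean_def c_def d_def d0_def a_def B_def)
  show "integrable M (\<lambda>\<omega>. \<bar>?gap \<omega>\<bar>)"
    unfolding eq using b by (rule asymptotic_linearity)
  have "expectation (\<lambda>\<omega>. \<bar>?gap \<omega>\<bar>)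
      \<le> E1 + E2 (sqrt a) + E3"
    unfolding eq using b by (rule asymptotic_linearity)
  moreover have q: "q = \<gamma> * s" using aq sqrt_n(2) by (simp add: s_def a_def field_simps)
  have q0: "0 \<le> q" by (rule indicator_prob_bounds)
  have \<Gamma>0: "0 \<le> \<Gamma>" using \<gamma> \<Gamma> by linarith
  have q\<Gamma>: "q \<le> \<Gamma> * s" unfolding q using \<Gamma> s by (intro mult_right_mono) auto
  have rR: "r \<le> R * s" using R by (simp add: s_def a_def)
  have tail0: "0 \<le> tail" unfolding tail_def using min_tail(3) by (intro integral_nonneg_AE AE_I2)
  have "E1 \<le> sqrt ((L * (1 + D) + real (p + 1) * \<Gamma>) * s)"
  proof -
    have "L * (1 + D) / a = L * (1 + D) * s" by (simp add: s_def)
    moreover have "real (p + 1) * q \<le> real (p + 1) * (\<Gamma> * s)" using q\<Gamma> by (rule mult_left_mono) simp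
    ultimately have "L * (1 + D) / a + real (p + 1) * q \<le> (L * (1 + D) + real (p + 1) * \<Gamma>) * s"
      unfolding distrib_right mult.assoc by linarith
    then show ?thesis unfolding E1_def by (rule real_sqrt_le_mono)
  qed
  moreover have "E2 (sqrt a) \<le> (L * D + 2 * L * R * (1 + D) + 2 * real ((p + 1)\<^sup>2) * \<Gamma>\<^sup>2) * s +
      real (p + 1) * (2 * L * (\<Gamma> + D) * sqrt s + \<Gamma> * tail)"
  proof -
    have 1: "2 * L * r * (1 + D) \<le> 2 * L * (R * s) * (1 + D)"
      using L_nonneg D_nonneg rR by (intro mult_right_mono mult_left_mono) auto
    have 2: "a * (2 * L / a * (q * sqrt a + D / sqrt a) + q * tail) \<le> 2 * L * (\<Gamma> + D) * sqrt s + \<Gamma> * tail"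
    proof -
      have "a * (2 * L / a * (q * sqrt a + D / sqrt a) + q * tail) = 2 * L * (q * sqrt a + D / sqrt a) + (a * q) * tail"
        using sqrt_n(2) by (simp add: distrib_left)
      moreover have "(a * q) * tail \<le> \<Gamma> * tail" using aq \<Gamma> tail0 by (simp add: a_def mult_right_mono)
      moreover have "q * sqrt a + D / sqrt a \<le> (\<Gamma> + D) * sqrt s"
      proof -
        have "q * sqrt a \<le> (\<Gamma> * s) * sqrt a" using q\<Gamma> sqrt_n(2) by (intro mult_right_mono) auto
        also have "s * sqrt a = sqrt s"
          using sqrt_n(2) by (simp add: s_def real_sqrt_divide field_simps)
        then have "(\<Gamma> * s) * sqrt a = \<Gamma> * sqrt s" by (simp only: mult.assoc)
        finally show ?thesis by (simp add: distrib_right add_divide_distrib s_def real_sqrt_divide)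
      qed
      then have "2 * L * (q * sqrt a + D / sqrt a) \<le> 2 * L * ((\<Gamma> + D) * sqrt s)"
        using L_nonneg by (intro mult_left_mono) auto
      ultimately show ?thesis by (simp only: mult.assoc)
    qed
    have "real (p + 1) * (a * (2 * L / a * (q * sqrt a + D / sqrt a) + q * tail)) \<le>
        real (p + 1) * (2 * L * (\<Gamma> + D) * sqrt s + \<Gamma> * tail)"
      using 2 by (rule mult_left_mono) simp
    moreover have 3: "a * q\<^sup>2 \<le> \<Gamma>\<^sup>2 * s"
    proof -
      have "a * q\<^sup>2 = \<gamma> * q" using aq by (simp add: power2_eq_square a_def)
      also have "\<dots> \<le> \<Gamma> * (\<Gamma> * s)" using \<gamma> \<Gamma> q0 q\<Gamma> by (intro mult_mono) auto
      finally show ?thesis by (simp add: power2_eq_square)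
    qed
    have "2 * real ((p + 1)\<^sup>2) * (a * q\<^sup>2) \<le> 2 * real ((p + 1)\<^sup>2) * (\<Gamma>\<^sup>2 * s)"
      using 3 by (rule mult_left_mono) simp
    moreover have "L * D / a = L * D * s" by (simp add: s_def)
    moreover have "E2 (sqrt a) = L * D / a + 2 * L * r * (1 + D) +
        real (p + 1) * (a * (2 * L / a * (q * sqrt a + D / sqrt a) + q * tail)) + 2 * real ((p + 1)\<^sup>2) * (a * q\<^sup>2)"
      unfolding E2_def by (simp only: mult_ac)
    moreover have "(L * D + 2 * L * R * (1 + D) + 2 * real ((p + 1)\<^sup>2) * \<Gamma>\<^sup>2) * s =
        L * D * s + 2 * L * (R * s) * (1 + D) + 2 * real ((p + 1)\<^sup>2) * (\<Gamma>\<^sup>2 * s)"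
      by (simp only: distrib_left distrib_right mult_ac)
    ultimately show ?thesis using 1 by linarith
  qed
  moreover have "E3 \<le> real (p + 1) * (sqrt (\<Gamma> * s) + 2 * \<Gamma> * R * s)"
  proof -
    have "\<gamma> * r \<le> \<Gamma> * (R * s)" using \<gamma> \<Gamma> r rR by (intro mult_mono) auto
    moreover have "sqrt q \<le> sqrt (\<Gamma> * s)" using q\<Gamma> by simp
    moreover have "\<bar>a * q - \<gamma>\<bar> = 0" using aq by (simp add: a_def)
    ultimately have "sqrt q + \<bar>a * q - \<gamma>\<bar> + 2 * \<gamma> * r \<le> sqrt (\<Gamma> * s) + 2 * \<Gamma> * R * s"
      unfolding mult.assoc by linarith
    then show ?thesis unfolding E3_def by (rule mult_left_mono) simp
  qed
  ultimately show "expectation (\<lambda>\<omega>. \<bar>?gap \<omega>\<bar>)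
      \<le> linearity_error p L D \<Gamma> R tail (1 / sqrt (real n))"
    unfolding sn linearity_error_def by linarith
qed

text \<open>In this form the bound visibly depends on the grid point through
  \<open>shift_size\<close> alone and has no dependence on \<open>m\<close>.\<close>

lemmas shift_count_error_bound = shift_count_error[unfolded D_def C_def tail_def a_def]

end

section \<open>From fixed shifts to estimated coefficients\<close>

context outlier_ar_model
begin

text \<open>The deterministic core, for one outcome at which all approximations succeed. A grid
  point near the scaled estimation errors brackets the residual counts at \<open>x\<close> and at
  \<open>- x\<close> simultaneously. Pairing the upper bracket at one point with the lower bracket
  at the other leaves the difference of two means of the same shift, up to the sign of its
  slack.\<close>

lemma symmetrized_deviation_le:
  fixes k :: real and b :: "nat \<Rightarrow> real"
  assumes n: "n \<ge> 1" and mu: "\<nu> = (1 - (\<Sum>j=1..p. \<beta> j)) * \<mu>" and \<omega>: "\<omega> \<in> space M"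
    and rec: "\<And>t. t \<in> {1..int n} \<Longrightarrow> v t \<omega> = (\<Sum>j=1..p. \<beta> j * v (t - int j) \<omega>) + \<nu> + \<epsilon> t \<omega>"
  defines "a \<equiv> sqrt (real n)" and "Y \<equiv> sample p n y \<omega>"
  assumes K: "\<bar>a * (k - \<mu>)\<bar> \<le> K" "L2_set (\<lambda>j. a * (b j - \<beta> j)) {1..p} \<le> K"
    and K': "K' = K * (1 + (\<Sum>j=1..p. \<bar>\<beta> j\<bar>) + real p * K)"
    and approx: "\<And>s. s \<in> {1 - int p..int n} \<Longrightarrow> \<bar>v s \<omega> - \<mu> - ma m s \<omega>\<bar> \<le> \<kappa>"
    and \<kappa>: "real p * (K' * \<kappa>) \<le> \<eta> / 2" and \<eta>: "\<eta> > 0"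
    and grid: "\<And>\<tau> \<theta>. \<bar>\<tau>\<bar> \<le> K' \<Longrightarrow> (\<And>j. j \<in> {1..p} \<Longrightarrow> \<bar>\<theta> j\<bar> \<le> K') \<Longrightarrow>
       \<exists>(\<tau>', \<theta>')\<in>\<G>. \<bar>\<tau> - \<tau>'\<bar> \<le> \<eta> / 2 \<and> (\<forall>j\<in>{1..p}. \<bar>\<theta> j - \<theta>' j\<bar> \<le> \<eta> / 2)"
    and lin: "\<And>\<tau> \<theta> \<sigma> x'. (\<tau>, \<theta>) \<in> \<G> \<Longrightarrow> \<sigma> \<in> {\<eta>, - \<eta>} \<Longrightarrow> x' \<in> {x, - x} \<Longrightarrow>
       \<bar>shift_count m x' \<tau> \<theta> \<sigma> \<omega> - \<gamma> * Delta p \<beta> G P\<^sub>\<xi> x' - g * shift_mean m \<tau> \<theta> \<sigma> \<omega>\<bar> \<le> \<delta> / 2"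
    and W: "\<bar>g\<bar> * \<eta> * abs_mean m \<omega> \<le> \<delta> / 2"
  shows "\<bar>a * (symmetrized (empirical_df n (residual p k b Y)) x - symmetrized (empirical_df n (\<lambda>t. \<epsilon> t \<omega>)) x)
      - \<gamma> * Delta_S p \<beta> G P\<^sub>\<xi> x\<bar> \<le> \<delta>"
proof -
  have a: "a \<ge> 1" "a * a = real n" using n by (simp_all add: a_def)
  have K0: "0 \<le> K" using K(1) by linarith
  define \<tau> where "\<tau> = a * (k - \<mu>) * (1 - (\<Sum>j=1..p. b j))"
  define \<theta> where "\<theta> j = a * (b j - \<beta> j)" for j
  have \<theta>K: "\<bar>\<theta> j\<bar> \<le> K" if "j \<in> {1..p}" for j
  proof -
    have "\<bar>\<theta> j\<bar> \<le> L2_set (\<lambda>j. \<bar>\<theta> j\<bar>) {1..p}" using that by (intro member_le_L2_set) auto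
    then show ?thesis using K(2) by (simp add: \<theta>_def L2_set_def)
  qed
  have KK': "K \<le> K'"
  proof -
    have "K * 1 \<le> K'" unfolding K' using K0 by (intro mult_left_mono) (auto intro!: add_increasing2 sum_nonneg)
    then show ?thesis by simp
  qed
  have \<theta>K': "\<bar>\<theta> j\<bar> \<le> K'" if "j \<in> {1..p}" for j using \<theta>K[OF that] KK' by linarith
  \<comment> \<open>The intercept multiplies the scaled error of the mean by one minus the sum of
    the \<open>b j\<close>. Since \<open>a \<ge> 1\<close>, each \<open>b j\<close> is within
    \<open>K\<close> of \<open>\<beta> j\<close>, which explains the form of
    \<open>K'\<close>.\<close>
  have \<tau>K': "\<bar>\<tau>\<bar> \<le> K'"
  proof -
    have "\<bar>b j\<bar> \<le> \<bar>\<beta> j\<bar> + K" if "j \<in> {1..p}" for j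
    proof -
      have "\<bar>b j - \<beta> j\<bar> \<le> a * \<bar>b j - \<beta> j\<bar>" using a(1) by (simp add: mult_le_cancel_right1)
      also have "\<dots> = \<bar>\<theta> j\<bar>" using a(1) by (simp add: \<theta>_def abs_mult)
      also have "\<dots> \<le> K" by (rule \<theta>K[OF that])
      finally show ?thesis by linarith
    qed
    then have "\<bar>\<Sum>j=1..p. b j\<bar> \<le> (\<Sum>j=1..p. \<bar>\<beta> j\<bar> + K)"
      by (intro order.trans[OF sum_abs] sum_mono) auto
    then have "\<bar>1 - (\<Sum>j=1..p. b j)\<bar> \<le> 1 + (\<Sum>j=1..p. \<bar>\<beta> j\<bar>) + real p * K"
      by (simp add: sum.distrib)
    then show ?thesis unfolding \<tau>_def K' abs_mult[of "a * (k - \<mu>)"]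
      using K(1) K0 by (intro mult_mono) auto
  qed
  obtain pr where "pr \<in> \<G>"
    "case pr of (\<tau>', \<theta>') \<Rightarrow> \<bar>\<tau> - \<tau>'\<bar> \<le> \<eta> / 2 \<and> (\<forall>j\<in>{1..p}. \<bar>\<theta> j - \<theta>' j\<bar> \<le> \<eta> / 2)"
    using grid[of \<tau> \<theta>, OF \<tau>K' \<theta>K'] by blast
  then obtain \<tau>' \<theta>' where g1: "(\<tau>', \<theta>') \<in> \<G>" and g2: "\<bar>\<tau> - \<tau>'\<bar> \<le> \<eta> / 2"
    and g3: "\<And>j. j \<in> {1..p} \<Longrightarrow> \<bar>\<theta> j - \<theta>' j\<bar> \<le> \<eta> / 2"
    by (cases pr) auto
  define X where "X s = ma m s \<omega> + z s \<omega> * \<xi> s \<omega>" for s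
  define U where "U s = v s \<omega> - \<mu> + z s \<omega> * \<xi> s \<omega>" for s
  define w where "w t = (\<Sum>j=0..p. (\<beta>(0 := -1)) j * (z (t - int j) \<omega> * \<xi> (t - int j) \<omega>))" for t
  define mid where "mid t = \<tau> + (\<Sum>j=1..p. \<theta> j * U (t - int j))" for t
  have res: "residual p k b Y t \<le> x' \<longleftrightarrow> \<epsilon> t \<omega> \<le> x' + (mid t / a + w t)" if "t \<in> {1..int n}" for t x'
    using residual_le_iff[OF n mu that \<omega> rec[OF that], of k b x']
    by (simp add: Y_def mid_def \<tau>_def \<theta>_def U_def w_def a_def add.assoc)
  have bracket: "lin_shift p \<tau>' \<theta>' (- \<eta>) X t \<le> mid t" "mid t \<le> lin_shift p \<tau>' \<theta>' \<eta> X t"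
    if t: "t \<in> {1..int n}" for t
  proof -
    have 1: "\<bar>\<theta> j - \<theta>' j\<bar> \<le> \<eta>" if "j \<in> {1..p}" for j using g3[OF that] \<eta> by linarith
    have 2: "\<bar>U (t - int j) - X (t - int j)\<bar> \<le> \<kappa>" if "j \<in> {1..p}" for j
      using approx[of "t - int j"] t that by (auto simp: U_def X_def)
    show "lin_shift p \<tau>' \<theta>' (- \<eta>) X t \<le> mid t" "mid t \<le> lin_shift p \<tau>' \<theta>' \<eta> X t"
      unfolding mid_def using lin_shift_bracket[where u=U and X=X and \<theta>=\<theta> and \<theta>'=\<theta>' and t=t, OF g2 1 \<theta>K' 2 \<kappa>] by simp_all
  qed
  define Z where "Z x' = (\<Sum>t=1..int n. indicator {..x'} (residual p k b Y t) - indicator {..x'} (\<epsilon> t \<omega>)) / a" for x' :: real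
  have cmp: "indicator {..s} e \<le> (indicator {..s'} e :: real)" if "s \<le> s'" for s s' e :: real
    using that by (auto simp: indicator_def)
  have ind: "indicator {..x'} (residual p k b Y t) = (indicator {..x' + (mid t / a + w t)} (\<epsilon> t \<omega>) :: real)"
    if "t \<in> {1..int n}" for t x'
    using res[OF that, of x'] by (simp add: indicator_def)
  have Zlow: "shift_count m x' \<tau>' \<theta>' (- \<eta>) \<omega> \<le> Z x'" for x'
    unfolding shift_count_def Z_def a_def[symmetric] X_def[symmetric] w_def[symmetric]
  proof (intro divide_right_mono sum_mono diff_right_mono)
    fix t assume t: "t \<in> {1..int n}"
    have "lin_shift p \<tau>' \<theta>' (- \<eta>) X t / a \<le> mid t / a" using bracket(1)[OF t] a by (intro divide_right_mono) auto
    then show "indicator {..x' + (lin_shift p \<tau>' \<theta>' (- \<eta>) X t / a + w t)} (\<epsilon> t \<omega>) \<le> (indicator {..x'} (residual p k b Y t) :: real)"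
      unfolding ind[OF t] by (intro cmp) simp
  qed (use a in simp)
  have Zup: "Z x' \<le> shift_count m x' \<tau>' \<theta>' \<eta> \<omega>" for x'
    unfolding shift_count_def Z_def a_def[symmetric] X_def[symmetric] w_def[symmetric]
  proof (intro divide_right_mono sum_mono diff_right_mono)
    fix t assume t: "t \<in> {1..int n}"
    have "mid t / a \<le> lin_shift p \<tau>' \<theta>' \<eta> X t / a" using bracket(2)[OF t] a by (intro divide_right_mono) auto
    then show "(indicator {..x'} (residual p k b Y t) :: real) \<le> indicator {..x' + (lin_shift p \<tau>' \<theta>' \<eta> X t / a + w t)} (\<epsilon> t \<omega>)"
      unfolding ind[OF t] by (intro cmp) simp
  qed (use a in simp)
  have ZS: "a * (symmetrized (empirical_df n (residual p k b Y)) x - symmetrized (empirical_df n (\<lambda>t. \<epsilon> t \<omega>)) x) = (Z x - Z (- x)) / 2"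
  proof -
    have Zeq: "Z x' = a * (empirical_df n (residual p k b Y) x' - empirical_df n (\<lambda>t. \<epsilon> t \<omega>) x')" for x'
    proof -
      have "a * (S / real n) = S / a" for S using a by (simp add: a(2)[symmetric])
      then show ?thesis
        by (simp add: Z_def empirical_df_def sum_subtractf diff_divide_distrib[symmetric])
    qed
    show ?thesis unfolding Zeq symmetrized_def by (simp add: field_simps)
  qed
  define D1 where "D1 = \<gamma> * Delta p \<beta> G P\<^sub>\<xi> x"
  define D2 where "D2 = \<gamma> * Delta p \<beta> G P\<^sub>\<xi> (- x)"
  define m1 where "m1 = g * shift_mean m \<tau>' \<theta>' \<eta> \<omega>"
  define m2 where "m2 = g * shift_mean m \<tau>' \<theta>' (- \<eta>) \<omega>"
  have DS: "\<gamma> * Delta_S p \<beta> G P\<^sub>\<xi> x = (D1 - D2) / 2"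
    by (simp add: Delta_S_def D1_def D2_def algebra_simps diff_divide_distrib)
  have m12: "\<bar>m1 - m2\<bar> \<le> \<delta>"
  proof -
    have "0 \<le> abs_mean m \<omega>" unfolding abs_mean_def by (intro divide_nonneg_nonneg sum_nonneg add_nonneg_nonneg) auto
    moreover have "m1 - m2 = g * (2 * \<eta> * abs_mean m \<omega>)"
      unfolding m1_def m2_def right_diff_distrib[symmetric] shift_mean_diff ..
    ultimately have "\<bar>m1 - m2\<bar> = 2 * (\<bar>g\<bar> * \<eta> * abs_mean m \<omega>)" using \<eta> by (simp add: abs_mult)
    then show ?thesis using W by linarith
  qed
  have "\<bar>shift_count m x \<tau>' \<theta>' \<eta> \<omega> - D1 - m1\<bar> \<le> \<delta> / 2" "\<bar>shift_count m x \<tau>' \<theta>' (- \<eta>) \<omega> - D1 - m2\<bar> \<le> \<delta> / 2"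
    "\<bar>shift_count m (- x) \<tau>' \<theta>' \<eta> \<omega> - D2 - m1\<bar> \<le> \<delta> / 2" "\<bar>shift_count m (- x) \<tau>' \<theta>' (- \<eta>) \<omega> - D2 - m2\<bar> \<le> \<delta> / 2"
    using lin[OF g1, of \<eta> x] lin[OF g1, of "- \<eta>" x] lin[OF g1, of \<eta> "- x"] lin[OF g1, of "- \<eta>" "- x"]
    unfolding D1_def D2_def m1_def m2_def by simp_all
  note dev = this[THEN abs_le_D1] this[THEN abs_le_D2]
  \<comment> \<open>Facts 1 to 4 of \<open>dev\<close> are upper and 5 to 8 lower estimates of the
    four deviations. Two of them cost \<open>\<delta> / 2\<close> each and the difference of the
    means costs \<open>\<delta>\<close>; symmetrization halves the total.\<close>
  have "Z x - Z (- x) - (D1 - D2) \<le> 2 * \<delta>"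
    using dev(1,8) Zup[of x] Zlow[of "- x"] m12 by linarith
  moreover have "- (Z x - Z (- x) - (D1 - D2)) \<le> 2 * \<delta>"
    using dev(3,6) Zlow[of x] Zup[of "- x"] m12 by linarith
  ultimately have "\<bar>Z x - Z (- x) - (D1 - D2)\<bar> \<le> 2 * \<delta>" by (rule abs_leI)
  then show ?thesis unfolding ZS DS diff_divide_distrib[symmetric] by simp
qed

text \<open>A union bound over the ways in which \<open>symmetrized_deviation_le\<close> can fail.
  The truncation \<open>m\<close> depends on the law of this particular model and is picked inside
  the proof; therefore \<open>lin\<close> and \<open>V\<close> are required for every
  \<open>m\<close> with constants that do not involve it.\<close>

lemma symmetrized_deviation_prob:
  fixes k :: "'a \<Rightarrow> real" and b :: "'a \<Rightarrow> nat \<Rightarrow> real"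
  assumes n: "n \<ge> 1" and mu: "\<nu> = (1 - (\<Sum>j=1..p. \<beta> j)) * \<mu>"
    and roots: "\<And>r::complex.
      r ^ p - (\<Sum>j=1..p. complex_of_real (\<beta> j) * r ^ (p - j)) = 0 \<Longrightarrow> norm r < 1"
    and k: "k \<in> borel_measurable M" and b: "\<And>j. j \<in> {1..p} \<Longrightarrow> (\<lambda>\<omega>. b \<omega> j) \<in> borel_measurable M"
    and K: "K \<ge> 0" and K': "K' = K * (1 + (\<Sum>j=1..p. \<bar>\<beta> j\<bar>) + real p * K)"
    and \<eta>: "\<eta> > 0" and \<delta>: "\<delta> > 0" and e: "e > 0" and err: "err \<ge> 0"
    and \<G>: "finite \<G>"
    and grid: "\<And>\<tau> \<theta>. \<bar>\<tau>\<bar> \<le> K' \<Longrightarrow> (\<And>j. j \<in> {1..p} \<Longrightarrow> \<bar>\<theta> j\<bar> \<le> K') \<Longrightarrow>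
       \<exists>(\<tau>', \<theta>')\<in>\<G>. \<bar>\<tau> - \<tau>'\<bar> \<le> \<eta> / 2 \<and> (\<forall>j\<in>{1..p}. \<bar>\<theta> j - \<theta>' j\<bar> \<le> \<eta> / 2)"
    and lin: "\<And>m \<tau> \<theta> \<sigma> x'. (\<tau>, \<theta>) \<in> \<G> \<Longrightarrow> \<sigma> \<in> {\<eta>, - \<eta>} \<Longrightarrow> x' \<in> {x, - x} \<Longrightarrow>
       integrable M (\<lambda>\<omega>. \<bar>shift_count m x' \<tau> \<theta> \<sigma> \<omega> - \<gamma> * Delta p \<beta> G P\<^sub>\<xi> x' - g * shift_mean m \<tau> \<theta> \<sigma> \<omega>\<bar>) \<and>
       expectation (\<lambda>\<omega>. \<bar>shift_count m x' \<tau> \<theta> \<sigma> \<omega> - \<gamma> * Delta p \<beta> G P\<^sub>\<xi> x' - g * shift_mean m \<tau> \<theta> \<sigma> \<omega>\<bar>) \<le> err"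
    and V: "\<And>m t. integrable M (\<lambda>\<omega>. (ma m t \<omega>)\<^sup>2)" "\<And>m t. expectation (\<lambda>\<omega>. (ma m t \<omega>)\<^sup>2) \<le> V"
  defines "dev \<equiv> \<lambda>\<omega>. sqrt (real n) *
      (symmetrized (empirical_df n (residual p (k \<omega>) (b \<omega>) (sample p n y \<omega>))) x -
       symmetrized (empirical_df n (\<lambda>t. \<epsilon> t \<omega>)) x) - \<gamma> * Delta_S p \<beta> G P\<^sub>\<xi> x"
  shows "emeasure M {\<omega> \<in> space M. \<bar>dev \<omega>\<bar> > \<delta>} \<le>
     emeasure M {\<omega> \<in> space M. \<bar>sqrt (real n) * (k \<omega> - \<mu>)\<bar> > K} +
     emeasure M {\<omega> \<in> space M. \<bar>L2_set (\<lambda>j. sqrt (real n) * (b \<omega> j - \<beta> j)) {1..p}\<bar> > K} +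
     ennreal (e + real (card \<G>) * (8 * err / \<delta>) + 2 * \<bar>g\<bar> * \<eta> * (1 + real p * (1 + V)) / \<delta>)"
proof -
  note [measurable] = k b solution_measurable
  have K'0: "0 \<le> K'" unfolding K' using K by (intro mult_nonneg_nonneg add_nonneg_nonneg sum_nonneg) auto
  \<comment> \<open>The added 1 keeps the quotient meaningful when \<open>K'\<close> is
    zero.\<close>
  define \<kappa> where "\<kappa> = \<eta> / (2 * (real p * K' + 1))"
  have pK: "0 < real p * K' + 1" using K'0 by (intro add_nonneg_pos) auto
  have \<kappa>0: "\<kappa> > 0" using \<eta> pK by (simp add: \<kappa>_def)
  have \<kappa>: "real p * (K' * \<kappa>) \<le> \<eta> / 2"
  proof -
    have "real p * (K' * \<kappa>) = (real p * K' / (real p * K' + 1)) * (\<eta> / 2)" by (simp add: \<kappa>_def field_simps)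
    also have "\<dots> \<le> 1 * (\<eta> / 2)" using pK \<eta> by (intro mult_right_mono) auto
    finally show ?thesis by simp
  qed
  obtain m where m: "prob {\<omega> \<in> space M. \<exists>t\<in>{1 - int p..int n}. \<bar>v t \<omega> - \<mu> - ma m t \<omega>\<bar> > \<kappa>} \<le> e"
    using ma_approximation[OF roots mu _ \<kappa>0 e] by blast
  define err_at where "err_at = (\<lambda>((\<tau>, \<theta>), \<sigma>, x') \<omega>.
      \<bar>shift_count m x' \<tau> \<theta> \<sigma> \<omega> - \<gamma> * Delta p \<beta> G P\<^sub>\<xi> x' - g * shift_mean m \<tau> \<theta> \<sigma> \<omega>\<bar>)"
  have err_at_eq: "err_at ((\<tau>, \<theta>), \<sigma>, x') \<omega> =
      \<bar>shift_count m x' \<tau> \<theta> \<sigma> \<omega> - \<gamma> * Delta p \<beta> G P\<^sub>\<xi> x' - g * shift_mean m \<tau> \<theta> \<sigma> \<omega>\<bar>" for \<tau> \<theta> \<sigma> x' \<omega>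
    by (simp add: err_at_def)
  define I where "I = \<G> \<times> ({\<eta>, - \<eta>} \<times> {x, - x})"
  have I: "finite I" using \<G> by (simp add: I_def)
  have cardI: "real (card I) \<le> real (card \<G>) * 4"
  proof -
    \<comment> \<open>An inequality, since \<open>x\<close> and \<open>- x\<close> coincide at zero.
      The four combinations of signs and the level \<open>\<delta> / 2\<close> in the Markov
      inequality give the factor 8.\<close>
    have "card {\<eta>, - \<eta>} \<le> 2" "card {x, - x} \<le> 2" by (simp_all add: card_insert_if)
    then have "card {\<eta>, - \<eta>} * card {x, - x} \<le> 2 * 2" by (rule mult_le_mono)
    then have "card \<G> * (card {\<eta>, - \<eta>} * card {x, - x}) \<le> card \<G> * (2 * 2)" by (rule mult_le_mono2)
    then have "card I \<le> card \<G> * 4" unfolding I_def by (simp only: card_cartesian_product)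
    then have "real (card I) \<le> real (card \<G> * 4)" by (rule of_nat_mono)
    then show ?thesis by simp
  qed
  have eI: "integrable M (err_at i)" "expectation (err_at i) \<le> err" if "i \<in> I" for i
    using that lin[of _ _ _ _ m] unfolding I_def err_at_def by auto
  have e0: "0 \<le> err_at i \<omega>" for i \<omega> unfolding err_at_def by (cases i) auto
  define F1 where "F1 = {\<omega> \<in> space M. \<bar>sqrt (real n) * (k \<omega> - \<mu>)\<bar> > K}"
  define F2 where "F2 = {\<omega> \<in> space M. \<bar>L2_set (\<lambda>j. sqrt (real n) * (b \<omega> j - \<beta> j)) {1..p}\<bar> > K}"
  define F3 where "F3 = {\<omega> \<in> space M. \<exists>t\<in>{1 - int p..int n}. \<bar>v t \<omega> - \<mu> - ma m t \<omega>\<bar> > \<kappa>}"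
  define F4 where "F4 i = {\<omega> \<in> space M. err_at i \<omega> \<ge> \<delta> / 2}" for i
  define F5 where "F5 = {\<omega> \<in> space M. \<bar>g\<bar> * \<eta> * abs_mean m \<omega> \<ge> \<delta> / 2}"
  have F1: "F1 \<in> events" unfolding F1_def by measurable
  have F2: "F2 \<in> events" unfolding F2_def L2_set_def by measurable
  have F3: "F3 \<in> events" unfolding F3_def by measurable
  have F4: "F4 i \<in> events" if "i \<in> I" for i
  proof -
    have [measurable]: "err_at i \<in> borel_measurable M" using eI(1)[OF that] by (rule borel_measurable_integrable)
    show ?thesis unfolding F4_def by measurable
  qed
  have F5: "F5 \<in> events" unfolding F5_def by measurable
  have F4U: "(\<Union>i\<in>I. F4 i) \<in> events" using I F4 by (intro sets.finite_UN) auto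
  have P4: "prob (\<Union>i\<in>I. F4 i) \<le> real (card \<G>) * (8 * err / \<delta>)"
  proof -
    have "prob (\<Union>i\<in>I. F4 i) \<le> (\<Sum>i\<in>I. prob (F4 i))"
      using I F4 by (intro finite_measure_subadditive_finite) auto
    also have "\<dots> \<le> (\<Sum>i\<in>I. err / (\<delta> / 2))"
    proof (rule sum_mono)
      fix i assume i: "i \<in> I"
      have "prob (F4 i) \<le> expectation (err_at i) / (\<delta> / 2)"
        unfolding F4_def using eI(1)[OF i] \<delta> e0
        by (intro integral_Markov_inequality_measure[where A="{}"]) auto
      also have "\<dots> \<le> err / (\<delta> / 2)" using eI(2)[OF i] \<delta> by (intro divide_right_mono) auto
      finally show "prob (F4 i) \<le> err / (\<delta> / 2)" .
    qed
    also have "\<dots> = real (card I) * (err / (\<delta> / 2))" by simp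
    also have "\<dots> \<le> (real (card \<G>) * 4) * (err / (\<delta> / 2))"
      using cardI err \<delta> by (intro mult_right_mono) auto
    also have "\<dots> = real (card \<G>) * (8 * err / \<delta>)" by simp
    finally show ?thesis .
  qed
  have P5: "prob F5 \<le> 2 * \<bar>g\<bar> * \<eta> * (1 + real p * (1 + V)) / \<delta>"
  proof -
    note am = expectation_abs_mean[OF n V]
    have am0: "0 \<le> abs_mean m \<omega>" for \<omega>
      unfolding abs_mean_def by (intro divide_nonneg_nonneg sum_nonneg add_nonneg_nonneg) auto
    have "prob F5 \<le> expectation (\<lambda>\<omega>. \<bar>g\<bar> * \<eta> * abs_mean m \<omega>) / (\<delta> / 2)"
      unfolding F5_def using am(1) \<delta> \<eta> am0
      by (intro integral_Markov_inequality_measure[where A="{}"]) auto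
    also have "\<dots> = (\<bar>g\<bar> * \<eta> * expectation (abs_mean m)) / (\<delta> / 2)" by simp
    also have "\<dots> \<le> (\<bar>g\<bar> * \<eta> * (1 + real p * (1 + V))) / (\<delta> / 2)"
      using am(2) \<delta> \<eta> by (intro divide_right_mono mult_left_mono) auto
    also have "\<dots> = 2 * \<bar>g\<bar> * \<eta> * (1 + real p * (1 + V)) / \<delta>" by simp
    finally show ?thesis .
  qed
  have rec: "AE \<omega> in M. \<forall>t. v t \<omega> = (\<Sum>j=1..p. \<beta> j * v (t - int j) \<omega>) + \<nu> + \<epsilon> t \<omega>"
    unfolding AE_all_countable by (intro allI recursion)
  let ?U = "F1 \<union> (F2 \<union> (F3 \<union> ((\<Union>i\<in>I. F4 i) \<union> F5)))"
  have "emeasure M {\<omega> \<in> space M. \<bar>dev \<omega>\<bar> > \<delta>} \<le> emeasure M ?U"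
  \<comment> \<open>Monotonicity asks for measurability of the covering set only, and the almost
    sure form accommodates the exceptional set of the recursion.\<close>
  proof (rule emeasure_mono_AE)
    show "?U \<in> events" using F1 F2 F3 F4U F5 by (intro sets.Un)
    show "AE \<omega> in M. \<omega> \<in> {\<omega> \<in> space M. \<bar>dev \<omega>\<bar> > \<delta>} \<longrightarrow> \<omega> \<in> ?U"
      using rec
    proof eventually_elim
      case (elim \<omega>)
      show ?case
      proof (intro impI, rule ccontr)
        assume bad: "\<omega> \<in> {\<omega> \<in> space M. \<bar>dev \<omega>\<bar> > \<delta>}" and "\<omega> \<notin> ?U"
        then have \<omega>: "\<omega> \<in> space M" and not: "\<omega> \<notin> F1" "\<omega> \<notin> F2" "\<omega> \<notin> F3" "\<omega> \<notin> F5"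
          and not4: "\<And>i. i \<in> I \<Longrightarrow> \<omega> \<notin> F4 i" by auto
        have "\<bar>dev \<omega>\<bar> \<le> \<delta>"
          unfolding dev_def
        proof (rule symmetrized_deviation_le[OF n mu \<omega> spec[OF elim] _ _ K' _ \<kappa> \<eta> grid])
          show "\<bar>sqrt (real n) * (k \<omega> - \<mu>)\<bar> \<le> K" using not(1) \<omega> by (simp add: F1_def)
          show "L2_set (\<lambda>j. sqrt (real n) * (b \<omega> j - \<beta> j)) {1..p} \<le> K" using not(2) \<omega> by (simp add: F2_def)
          show "\<bar>v s \<omega> - \<mu> - ma m s \<omega>\<bar> \<le> \<kappa>" if "s \<in> {1 - int p..int n}" for s
            using not(3) \<omega> that by (auto simp: F3_def not_less)
          show "\<bar>g\<bar> * \<eta> * abs_mean m \<omega> \<le> \<delta> / 2" using not(4) \<omega> by (simp add: F5_def)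
          show "\<bar>shift_count m x' \<tau> \<theta> \<sigma> \<omega> - \<gamma> * Delta p \<beta> G P\<^sub>\<xi> x' - g * shift_mean m \<tau> \<theta> \<sigma> \<omega>\<bar> \<le> \<delta> / 2"
            if "(\<tau>, \<theta>) \<in> \<G>" "\<sigma> \<in> {\<eta>, - \<eta>}" "x' \<in> {x, - x}" for \<tau> \<theta> \<sigma> x'
          proof -
            have "((\<tau>, \<theta>), \<sigma>, x') \<in> I" using that unfolding I_def by (intro SigmaI)
            from not4[OF this] \<omega> show ?thesis by (simp add: F4_def err_at_eq)
          qed
        qed
        with bad show False by simp
      qed
    qed
  qed
  also have "\<dots> \<le> emeasure M F1 + (emeasure M F2 + (emeasure M F3 + (emeasure M (\<Union>i\<in>I. F4 i) + emeasure M F5)))"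
    by (intro order.trans[OF emeasure_subadditive] add_left_mono F1 F2 F3 F4U F5 sets.Un order_refl)
  also have "\<dots> = emeasure M F1 + emeasure M F2 + ennreal (prob F3 + prob (\<Union>i\<in>I. F4 i) + prob F5)"
    by (simp add: emeasure_eq_measure add.assoc)
  also have "\<dots> \<le> emeasure M F1 + emeasure M F2 +
      ennreal (e + real (card \<G>) * (8 * err / \<delta>) + 2 * \<bar>g\<bar> * \<eta> * (1 + real p * (1 + V)) / \<delta>)"
    using m P4 P5 by (intro add_left_mono ennreal_leI add_mono) (simp_all add: F3_def)
  finally show ?thesis unfolding F1_def F2_def .
qed

end

section \<open>Uniformity in the contamination and the alternative\<close>

lemma tail_integral_tendsto_0:
  assumes "real_distribution P" and c: "0 \<le> c"
  shows "(\<lambda>n. \<integral>s. min 1 (c * \<bar>s\<bar> / sqrt (real n)) \<partial>P) \<longlonglongrightarrow> 0"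
proof -
  interpret real_distribution P by fact
  have "(\<lambda>n. \<integral>s. min 1 (c * \<bar>s\<bar> / sqrt (real n)) \<partial>P) \<longlonglongrightarrow> (\<integral>s. 0 \<partial>P)"
  proof (rule integral_dominated_convergence[where w="\<lambda>_. 1"])
    show "AE s in P. (\<lambda>n. min 1 (c * \<bar>s\<bar> / sqrt (real n))) \<longlonglongrightarrow> 0"
    proof (intro AE_I2)
      fix s
      have "(\<lambda>n. c * \<bar>s\<bar> / sqrt (real n)) \<longlonglongrightarrow> 0" by real_asymp
      then have "(\<lambda>n. min 1 (c * \<bar>s\<bar> / sqrt (real n))) \<longlonglongrightarrow> min 1 0"
        by (intro tendsto_min tendsto_const)
      then show "(\<lambda>n. min 1 (c * \<bar>s\<bar> / sqrt (real n))) \<longlonglongrightarrow> 0" by simp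
    qed
    show "AE s in P. norm (min 1 (c * \<bar>s\<bar> / sqrt (real n))) \<le> 1" for n
      using c by (intro AE_I2) (auto simp: abs_le_iff min_le_iff_disj intro!: order.trans[of _ 0])
  qed auto
  then show ?thesis by simp
qed

context outlier_ar_model
begin

lemma measurable_sample: "sample p n y \<in> measurable M (PiM {1 - int p..int n} (\<lambda>_. borel))"
proof -
  note [measurable] = solution_measurable
  have "y t \<in> borel_measurable M" if "t \<in> {1 - int p..int n}" for t
    by (subst measurable_cong[OF observations[OF that]]) measurable
  then show ?thesis unfolding sample_def[abs_def] by (intro measurable_restrict)
qed

lemma innovation_second_moment_le:
  assumes "real_distribution G" "real_distribution H" and A: "A = mixture_df (cdf G) (cdf H) r"
    and r: "0 \<le> r" "r \<le> 1" and G: "centered_finite_variance G" and H: "centered_finite_variance H"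
  shows "expectation (\<lambda>\<omega>. (\<epsilon> t \<omega>)\<^sup>2) \<le> (\<integral>s. s\<^sup>2 \<partial>G) + (\<integral>s. s\<^sup>2 \<partial>H)"
proof -
  have "(\<integral>s. s\<^sup>2 \<partial>distr M borel (\<epsilon> t)) \<le> (\<integral>s. s\<^sup>2 \<partial>G) + (\<integral>s. s\<^sup>2 \<partial>H)"
    using G H r assms(1,2) innovations_cdf[of t]
    by (intro mixture_second_moment_le) (auto simp: A centered_finite_variance_def)
  then show ?thesis by (simp add: integral_distr)
qed

end

theorem corollary2p2:
  fixes p :: nat and \<beta> :: "nat \<Rightarrow> real" and \<nu> \<mu> :: real
    and G\<^sub>0 H P\<^sub>\<xi> :: "real measure"
    and M :: "nat \<Rightarrow> real \<Rightarrow> real \<Rightarrow> 'a measure"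
    and \<epsilon> z \<xi> v y :: "nat \<Rightarrow> real \<Rightarrow> real \<Rightarrow> int \<Rightarrow> 'a \<Rightarrow> real"
    and mu_hat :: "nat \<Rightarrow> (int \<Rightarrow> real) \<Rightarrow> real"
    and beta_hat :: "nat \<Rightarrow> (int \<Rightarrow> real) \<Rightarrow> nat \<Rightarrow> real"
    and \<Gamma> R x \<delta> :: real
  assumes p: "p \<ge> 1"
    and roots: "\<And>r::complex.
        r ^ p - (\<Sum>j=1..p. complex_of_real (\<beta> j) * r ^ (p - j)) = 0 \<Longrightarrow> norm r < 1"
    and mu: "\<nu> = (1 - (\<Sum>j=1..p. \<beta> j)) * \<mu>"
    and distributions: "real_distribution G\<^sub>0" "real_distribution H" "real_distribution P\<^sub>\<xi>"
    and moments: "centered_finite_variance G\<^sub>0" "centered_finite_variance H"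
    and smooth: "twice_diff_bounded (cdf G\<^sub>0)" "twice_diff_bounded (cdf H)"
    and symmetric: "\<And>s. cdf G\<^sub>0 (- s) = 1 - cdf G\<^sub>0 s"
    and model: "\<And>n \<gamma> \<rho>. n \<ge> 1 \<Longrightarrow> \<gamma> \<ge> 0 \<Longrightarrow> \<rho> \<ge> 0 \<Longrightarrow>
        outlier_ar_model (M n \<gamma> \<rho>) p \<beta> \<nu>
          (mixture_df (cdf G\<^sub>0) (cdf H) (local_rate \<rho> n)) (local_rate \<gamma> n) P\<^sub>\<xi> n
          (\<epsilon> n \<gamma> \<rho>) (z n \<gamma> \<rho>) (\<xi> n \<gamma> \<rho>) (v n \<gamma> \<rho>) (y n \<gamma> \<rho>)"
    and estimators: "\<And>n. n \<ge> 1 \<Longrightarrow> statistic p n (mu_hat n)"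
        "\<And>n j. n \<ge> 1 \<Longrightarrow> j \<in> {1..p} \<Longrightarrow> statistic p n (\<lambda>Y. beta_hat n Y j)"
    and mu_hat_rate: "\<And>\<Gamma> R. \<Gamma> \<ge> 0 \<Longrightarrow> R \<ge> 0 \<Longrightarrow>
        unif_OP1 M (\<lambda>n \<gamma> \<rho> \<omega>. sqrt (real n) * (mu_hat n (sample p n (y n \<gamma> \<rho>) \<omega>) - \<mu>)) \<Gamma> R"
    and beta_hat_rate: "\<And>\<Gamma> R. \<Gamma> \<ge> 0 \<Longrightarrow> R \<ge> 0 \<Longrightarrow>
        unif_OP1 M (\<lambda>n \<gamma> \<rho> \<omega>.
          L2_set (\<lambda>j. sqrt (real n) * (beta_hat n (sample p n (y n \<gamma> \<rho>) \<omega>) j - \<beta> j)) {1..p}) \<Gamma> R"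
    and "\<Gamma> \<ge> 0" "R \<ge> 0" "\<delta> > 0"
  shows "sup_prob M (\<lambda>n \<gamma> \<rho> \<omega>.
      let Y = sample p n (y n \<gamma> \<rho>) \<omega>;
          S_hat = symmetrized (empirical_df n (residual p (mu_hat n Y) (beta_hat n Y) Y));
          S = symmetrized (empirical_df n (\<lambda>t. \<epsilon> n \<gamma> \<rho> t \<omega>))
      in sqrt (real n) * (S_hat x - S x) - \<gamma> * Delta_S p \<beta> (cdf G\<^sub>0) P\<^sub>\<xi> x) \<Gamma> R \<delta>
    \<longlonglongrightarrow> 0"
proof -
  interpret G: real_distribution G\<^sub>0 by fact
  interpret H: real_distribution H by fact
  obtain LG where LG: "LG \<ge> 0" "\<And>x. \<bar>deriv (cdf G\<^sub>0) x\<bar> \<le> LG"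
    "\<And>x y. \<bar>cdf G\<^sub>0 x - cdf G\<^sub>0 y\<bar> \<le> LG * \<bar>x - y\<bar>"
    "\<And>x s. \<bar>cdf G\<^sub>0 (x + s) - cdf G\<^sub>0 x - deriv (cdf G\<^sub>0) x * s\<bar> \<le> LG * s\<^sup>2"
    using smooth_cdf_bounds[OF distributions(1) smooth(1)] by blast
  obtain LH where LH: "LH \<ge> 0" "\<And>x. \<bar>deriv (cdf H) x\<bar> \<le> LH"
    "\<And>x y. \<bar>cdf H x - cdf H y\<bar> \<le> LH * \<bar>x - y\<bar>"
    "\<And>x s. \<bar>cdf H (x + s) - cdf H x - deriv (cdf H) x * s\<bar> \<le> LH * s\<^sup>2"
    using smooth_cdf_bounds[OF distributions(2) smooth(2)] by blast
  define L where "L = max LG LH"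
  have L: "LG \<le> L" "LH \<le> L" "0 \<le> L" using LG(1) by (auto simp: L_def)
  define g where "g = deriv (cdf G\<^sub>0) x"
  \<comment> \<open>Evenness of the density: a single slope \<open>g\<close> serves both
    \<open>x\<close> and \<open>- x\<close>, so that the two linear terms cancel.\<close>
  have g_eq: "deriv (cdf G\<^sub>0) x' = g" if "x' \<in> {x, - x}" for x'
    using that deriv_symmetric_cdf[of "cdf G\<^sub>0" x, OF symmetric] smooth(1) by (auto simp: g_def twice_diff_bounded_def)
  obtain K\<psi> where K\<psi>: "K\<psi> \<ge> 0" "\<And>m. (\<Sum>k<m. (ma_coeff p \<beta> k)\<^sup>2) \<le> K\<psi>"
    using ma_coeff_square_sums_bounded[OF roots] by blast
  define s2 where "s2 = (\<integral>s. s\<^sup>2 \<partial>G\<^sub>0) + (\<integral>s. s\<^sup>2 \<partial>H)"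
  have s2: "0 \<le> s2" by (simp add: s2_def)
  define V where "V = s2 * K\<psi>"
  have V0: "0 \<le> V" using s2 K\<psi> by (simp add: V_def)
  have rate: "0 \<le> local_rate r n" "local_rate r n \<le> 1" "local_rate r n \<le> r / sqrt (real n)" if "0 \<le> r" for r n
    using that by (auto simp: local_rate_def)
  let ?Xm = "\<lambda>n \<gamma> \<rho> \<omega>. sqrt (real n) * (mu_hat n (sample p n (y n \<gamma> \<rho>) \<omega>) - \<mu>)"
  let ?Xb = "\<lambda>n \<gamma> \<rho> \<omega>. L2_set (\<lambda>j. sqrt (real n) * (beta_hat n (sample p n (y n \<gamma> \<rho>) \<omega>) j - \<beta> j)) {1..p}"
  let ?X = "\<lambda>n \<gamma> \<rho> \<omega>. sqrt (real n) *
      (symmetrized (empirical_df n (residual p (mu_hat n (sample p n (y n \<gamma> \<rho>) \<omega>))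
         (beta_hat n (sample p n (y n \<gamma> \<rho>) \<omega>)) (sample p n (y n \<gamma> \<rho>) \<omega>))) x -
       symmetrized (empirical_df n (\<lambda>t. \<epsilon> n \<gamma> \<rho> t \<omega>)) x) - \<gamma> * Delta_S p \<beta> (cdf G\<^sub>0) P\<^sub>\<xi> x"
  \<comment> \<open>The five shares of \<open>e\<close> pay for the tails of the two estimators, the
    truncation of the moving average, the linearization over the grid and the width of the bracket.
    \<open>K\<close>, then \<open>\<eta>\<close>, then the grid are fixed before \<open>n\<close>
    and do not depend on \<open>\<gamma>\<close> or \<open>\<rho>\<close>.\<close>
  have main: "\<forall>\<^sub>F n in sequentially. sup_prob M ?X \<Gamma> R \<delta> n \<le> ennreal (5 * e)" if e: "e > 0" for e
  proof -
    have "\<forall>\<^sub>F C in at_top. limsup (sup_prob M ?Xm \<Gamma> R C) < ennreal e"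
      using mu_hat_rate[OF \<open>\<Gamma> \<ge> 0\<close> \<open>R \<ge> 0\<close>] e unfolding unif_OP1_def by (intro order_tendstoD(2)) auto
    moreover have "\<forall>\<^sub>F C in at_top. limsup (sup_prob M ?Xb \<Gamma> R C) < ennreal e"
      using beta_hat_rate[OF \<open>\<Gamma> \<ge> 0\<close> \<open>R \<ge> 0\<close>] e unfolding unif_OP1_def by (intro order_tendstoD(2)) auto
    ultimately have "\<forall>\<^sub>F C in at_top. limsup (sup_prob M ?Xm \<Gamma> R C) < ennreal e \<and>
        limsup (sup_prob M ?Xb \<Gamma> R C) < ennreal e \<and> C \<ge> 0"
      by (intro eventually_conj eventually_ge_at_top)
    from eventually_happens'[OF trivial_limit_at_top_linorder this]
    obtain K where K: "limsup (sup_prob M ?Xm \<Gamma> R K) < ennreal e" "limsup (sup_prob M ?Xb \<Gamma> R K) < ennreal e" "K \<ge> 0"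
      by (elim exE conjE)
    define K' where "K' = K * (1 + (\<Sum>j=1..p. \<bar>\<beta> j\<bar>) + real p * K)"
    have K'0: "0 \<le> K'"
      unfolding K'_def using K(3) by (intro mult_nonneg_nonneg add_nonneg_nonneg sum_nonneg) auto
    define W where "W = 1 + real p * (1 + V)"
    have W: "W > 0" unfolding W_def using V0 by (intro add_pos_nonneg) auto
    \<comment> \<open>Chosen to make the expected width of the bracket cost at most
      \<open>e\<close>; \<open>\<bar>g\<bar> + 1\<close> in place of \<open>\<bar>g\<bar>\<close>
      allows for a vanishing density.\<close>
    define \<eta> where "\<eta> = e * \<delta> / (2 * (\<bar>g\<bar> + 1) * W)"
    have \<eta>: "\<eta> > 0" using e \<open>\<delta> > 0\<close> W by (simp add: \<eta>_def)
    have g\<eta>: "2 * \<bar>g\<bar> * \<eta> * W / \<delta> \<le> e"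
    proof -
      have "2 * \<bar>g\<bar> * \<eta> * W / \<delta> = e * (\<bar>g\<bar> / (\<bar>g\<bar> + 1))"
        using \<open>\<delta> > 0\<close> W by (simp add: \<eta>_def divide_simps)
      also have "\<dots> \<le> e * 1" using e by (intro mult_left_mono) auto
      finally show ?thesis by simp
    qed
    obtain \<G> :: "(real \<times> (nat \<Rightarrow> real)) set" where \<G>: "finite \<G>"
      and grid: "\<And>\<tau> \<theta>. \<bar>\<tau>\<bar> \<le> K' \<Longrightarrow> (\<And>j. j \<in> {1..p} \<Longrightarrow> \<bar>\<theta> j\<bar> \<le> K') \<Longrightarrow>
       \<exists>(\<tau>', \<theta>')\<in>\<G>. \<bar>\<tau> - \<tau>'\<bar> \<le> \<eta> / 2 \<and> (\<forall>j\<in>{1..p}. \<bar>\<theta> j - \<theta>' j\<bar> \<le> \<eta> / 2)"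
      by (rule finite_grid[OF half_gt_zero[OF \<eta>] K'0, of p], rule that, assumption) blast
    define sz where "sz = (\<lambda>((\<tau>, \<theta>), \<sigma>). shift_size p \<tau> \<theta> \<sigma>)"
    have sz0: "0 \<le> sz i" for i unfolding sz_def by (auto simp: shift_size_nonneg split: prod.split)
    define err1 where "err1 i n = linearity_error p L ((sz i)\<^sup>2 * (1 + real p * V)) \<Gamma> R
        (\<integral>s. min 1 (L * sz i * \<bar>s\<bar> / sqrt (real n)) \<partial>P\<^sub>\<xi>) (1 / sqrt (real n))" for i n
    define I where "I = \<G> \<times> {\<eta>, - \<eta>}"
    have I: "finite I" using \<G> by (simp add: I_def)
    \<comment> \<open>Summing over the finite index set gives one null sequence that dominates the
      errors at all grid points and both signs.\<close>
    define err where "err n = (\<Sum>i\<in>I. \<bar>err1 i n\<bar>)" for n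
    have "(\<lambda>n. err1 i n) \<longlonglongrightarrow> 0" for i
      unfolding err1_def
    proof (rule linearity_error_tendsto)
      show "(\<lambda>n. \<integral>s. min 1 (L * sz i * \<bar>s\<bar> / sqrt (real n)) \<partial>P\<^sub>\<xi>) \<longlonglongrightarrow> 0"
        using distributions(3) L(3) sz0 by (intro tail_integral_tendsto_0) auto
      show "(\<lambda>n. 1 / sqrt (real n)) \<longlonglongrightarrow> 0" by real_asymp
    qed
    then have "err \<longlonglongrightarrow> (\<Sum>i\<in>I. \<bar>0\<bar>)"
      unfolding err_def[abs_def] by (intro tendsto_sum tendsto_rabs)
    then have "(\<lambda>n. real (card \<G>) * (8 * err n / \<delta>)) \<longlonglongrightarrow> real (card \<G>) * (8 * 0 / \<delta>)"
      using \<open>\<delta> > 0\<close> by (intro tendsto_intros) auto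
    then have ev1: "\<forall>\<^sub>F n in sequentially. real (card \<G>) * (8 * err n / \<delta>) < e"
      using e by (intro order_tendstoD(2)[where y="real (card \<G>) * (8 * 0 / \<delta>)"]) auto
    \<comment> \<open>From here on the minimum in \<open>local_rate\<close> is not attained at 1, or
      is tied, so \<open>sqrt (real n) * local_rate \<gamma> n\<close> equals
      \<open>\<gamma>\<close> exactly for all \<open>\<gamma> \<le> \<Gamma>\<close>.\<close>
    have ev2: "\<forall>\<^sub>F n in sequentially. \<Gamma> \<le> sqrt (real n)"
      by real_asymp
    have ev3: "\<forall>\<^sub>F n in sequentially. sup_prob M ?Xm \<Gamma> R K n < ennreal e"
      using K(1) by (rule Limsup_lessD)
    have ev4: "\<forall>\<^sub>F n in sequentially. sup_prob M ?Xb \<Gamma> R K n < ennreal e"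
      using K(2) by (rule Limsup_lessD)
    show ?thesis
      using ev1 ev2 ev3 ev4 eventually_ge_at_top[of 1]
    proof eventually_elim
      case (elim n)
      show ?case
        unfolding sup_prob_def
      proof (rule SUP_least, safe)
        fix \<gamma> \<rho> assume \<gamma>: "\<gamma> \<in> {0..\<Gamma>}" and \<rho>: "\<rho> \<in> {0..R}"
        then have \<gamma>0: "0 \<le> \<gamma>" "\<gamma> \<le> \<Gamma>" and \<rho>0: "0 \<le> \<rho>" "\<rho> \<le> R" by auto
        define r where "r = local_rate \<rho> n"
        have r: "0 \<le> r" "r \<le> 1" "r \<le> R / sqrt (real n)"
          using rate[OF \<rho>0(1), of n] \<rho>0(2) divide_right_mono[of \<rho> R "sqrt (real n)"] by (auto simp: r_def)
        have mod: "outlier_ar_model (M n \<gamma> \<rho>) p \<beta> \<nu> (mixture_df (cdf G\<^sub>0) (cdf H) r) (local_rate \<gamma> n) P\<^sub>\<xi> n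
          (\<epsilon> n \<gamma> \<rho>) (z n \<gamma> \<rho>) (\<xi> n \<gamma> \<rho>) (v n \<gamma> \<rho>) (y n \<gamma> \<rho>)"
          unfolding r_def using elim(5) \<gamma>0(1) \<rho>0(1) by (rule model)
        interpret m: outlier_ar_model "M n \<gamma> \<rho>" p \<beta> \<nu> "mixture_df (cdf G\<^sub>0) (cdf H) r" "local_rate \<gamma> n" P\<^sub>\<xi> n
          "\<epsilon> n \<gamma> \<rho>" "z n \<gamma> \<rho>" "\<xi> n \<gamma> \<rho>" "v n \<gamma> \<rho>" "y n \<gamma> \<rho>" by (rule mod)
        have sqn: "sqrt (real n) > 0" using elim(5) by simp
        have aq: "sqrt (real n) * local_rate \<gamma> n = \<gamma>"
        proof -
          have "\<gamma> / sqrt (real n) \<le> 1" using sqn elim(2) \<gamma>0(2) by simp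
          then show ?thesis using sqn by (simp add: local_rate_def)
        qed
        have e2: "m.expectation (\<lambda>\<omega>. (\<epsilon> n \<gamma> \<rho> t \<omega>)\<^sup>2) \<le> s2" for t
          unfolding s2_def by (rule m.innovation_second_moment_le[OF distributions(1,2) refl r(1,2) moments])
        have V: "integrable (M n \<gamma> \<rho>) (\<lambda>\<omega>. (m.ma k t \<omega>)\<^sup>2)" "m.expectation (\<lambda>\<omega>. (m.ma k t \<omega>)\<^sup>2) \<le> V" for k t
        proof -
          show "integrable (M n \<gamma> \<rho>) (\<lambda>\<omega>. (m.ma k t \<omega>)\<^sup>2)" using e2 by (rule m.ma_second_moment)
          have "m.expectation (\<lambda>\<omega>. (m.ma k t \<omega>)\<^sup>2) \<le> s2 * (\<Sum>k<k. (ma_coeff p \<beta> k)\<^sup>2)"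
            using e2 by (rule m.ma_second_moment)
          also have "\<dots> \<le> V" unfolding V_def using K\<psi>(2) s2 by (rule mult_left_mono)
          finally show "m.expectation (\<lambda>\<omega>. (m.ma k t \<omega>)\<^sup>2) \<le> V" .
        qed
        have lin: "integrable (M n \<gamma> \<rho>) (\<lambda>\<omega>. \<bar>m.shift_count k x' \<tau> \<theta> \<sigma> \<omega> - \<gamma> * Delta p \<beta> (cdf G\<^sub>0) P\<^sub>\<xi> x' - g * m.shift_mean k \<tau> \<theta> \<sigma> \<omega>\<bar>) \<and>
          m.expectation (\<lambda>\<omega>. \<bar>m.shift_count k x' \<tau> \<theta> \<sigma> \<omega> - \<gamma> * Delta p \<beta> (cdf G\<^sub>0) P\<^sub>\<xi> x' - g * m.shift_mean k \<tau> \<theta> \<sigma> \<omega>\<bar>) \<le> err n"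
          if t: "(\<tau>, \<theta>) \<in> \<G>" "\<sigma> \<in> {\<eta>, - \<eta>}" and x': "x' \<in> {x, - x}" for k \<tau> \<theta> \<sigma> x'
        proof -
          have Gb: "\<bar>cdf G\<^sub>0 s - cdf G\<^sub>0 s'\<bar> \<le> L * \<bar>s - s'\<bar>"
            "\<bar>cdf G\<^sub>0 (x' + u) - cdf G\<^sub>0 x' - g * u\<bar> \<le> L * u\<^sup>2" "\<bar>g\<bar> \<le> L" for s s' u
          proof -
            show "\<bar>cdf G\<^sub>0 s - cdf G\<^sub>0 s'\<bar> \<le> L * \<bar>s - s'\<bar>"
              using L(1) by (intro order.trans[OF LG(3)] mult_right_mono) auto
            show "\<bar>cdf G\<^sub>0 (x' + u) - cdf G\<^sub>0 x' - g * u\<bar> \<le> L * u\<^sup>2"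
              using L(1) LG(4)[of x' u] unfolding g_eq[OF x'] by (elim order.trans) (intro mult_right_mono, auto)
            show "\<bar>g\<bar> \<le> L" using LG(2)[of x] L(1) by (simp add: g_def)
          qed
          have Hb: "\<bar>cdf H s - cdf H s'\<bar> \<le> L * \<bar>s - s'\<bar>"
            "\<bar>cdf H (x' + u) - cdf H x' - deriv (cdf H) x' * u\<bar> \<le> L * u\<^sup>2" "\<bar>deriv (cdf H) x'\<bar> \<le> L" for s s' u
          proof -
            show "\<bar>cdf H s - cdf H s'\<bar> \<le> L * \<bar>s - s'\<bar>"
              using L(2) by (intro order.trans[OF LH(3)] mult_right_mono) auto
            show "\<bar>cdf H (x' + u) - cdf H x' - deriv (cdf H) x' * u\<bar> \<le> L * u\<^sup>2"
              using L(2) by (intro order.trans[OF LH(4)] mult_right_mono) auto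
            show "\<bar>deriv (cdf H) x'\<bar> \<le> L" using LH(2)[of x'] L(2) by linarith
          qed
          note mix = mixture_df_bounds[OF r(1,2) Gb G.cdf_nonneg G.cdf_bounded_prob Hb H.cdf_nonneg H.cdf_bounded_prob]
          have Gm: "cdf G\<^sub>0 \<in> borel_measurable borel"
            by (intro borel_measurable_mono monoI G.cdf_nondecreasing)
          have S: "shifted_ar_model (M n \<gamma> \<rho>) p \<beta> \<nu> (mixture_df (cdf G\<^sub>0) (cdf H) r) (local_rate \<gamma> n) P\<^sub>\<xi> n
            (\<epsilon> n \<gamma> \<rho>) (z n \<gamma> \<rho>) (\<xi> n \<gamma> \<rho>) (v n \<gamma> \<rho>) (y n \<gamma> \<rho>) (cdf G\<^sub>0) g L r V \<gamma> x' k"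
            by (intro shifted_ar_model.intro mod shifted_ar_model_axioms.intro elim(5) mix Gb(3) r(1) \<gamma>0(1) Gm
                G.cdf_nonneg G.cdf_bounded_prob V)
          define i where "i = ((\<tau>, \<theta>), \<sigma>)"
          have i: "i \<in> I" using t unfolding i_def I_def by (intro SigmaI)
          have szi: "shift_size p \<tau> \<theta> \<sigma> = sz i" by (simp add: sz_def i_def)
          note B = shifted_ar_model.shift_count_error_bound[OF S aq \<gamma>0(2) r(3), where \<tau>=\<tau> and \<theta>=\<theta> and \<eta>=\<sigma>, unfolded szi, folded err1_def]
          have "err1 i n \<le> \<bar>err1 i n\<bar>" by simp
          also have "\<dots> \<le> err n" unfolding err_def using i I by (intro member_le_sum) auto
          finally have "err1 i n \<le> err n" .
          with B show ?thesis by auto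
        qed
        have err0: "0 \<le> err n" unfolding err_def by (intro sum_nonneg) simp
        have km: "(\<lambda>\<omega>. mu_hat n (sample p n (y n \<gamma> \<rho>) \<omega>)) \<in> borel_measurable (M n \<gamma> \<rho>)"
          using estimators(1)[OF elim(5)] unfolding statistic_def by (rule measurable_compose[OF m.measurable_sample])
        have bm: "(\<lambda>\<omega>. beta_hat n (sample p n (y n \<gamma> \<rho>) \<omega>) j) \<in> borel_measurable (M n \<gamma> \<rho>)" if "j \<in> {1..p}" for j
          using estimators(2)[OF elim(5) that] unfolding statistic_def by (rule measurable_compose[OF m.measurable_sample])
        let ?P = "\<lambda>C X. emeasure (M n \<gamma> \<rho>) {\<omega> \<in> space (M n \<gamma> \<rho>). C < \<bar>X n \<gamma> \<rho> \<omega> :: real\<bar>}"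
        have "?P \<delta> ?X \<le>
            ?P K ?Xm +
            ?P K ?Xb +
            ennreal (e + real (card \<G>) * (8 * err n / \<delta>) + 2 * \<bar>g\<bar> * \<eta> * (1 + real p * (1 + V)) / \<delta>)"
          by (rule m.symmetrized_deviation_prob[OF elim(5) mu roots km bm K(3) K'_def \<eta> \<open>\<delta> > 0\<close> e err0 \<G> grid lin V])
        also have "\<dots> \<le> ennreal e + ennreal e + ennreal (e + e + e)"
        proof (intro add_mono ennreal_leI)
          have "?P K ?Xm \<le> sup_prob M ?Xm \<Gamma> R K n"
            unfolding sup_prob_def using \<gamma> \<rho> by (intro SUP_upper2[of "(\<gamma>, \<rho>)"]) auto
          with elim(3) show "?P K ?Xm \<le> ennreal e" by simp
          have "?P K ?Xb \<le> sup_prob M ?Xb \<Gamma> R K n"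
            unfolding sup_prob_def using \<gamma> \<rho> by (intro SUP_upper2[of "(\<gamma>, \<rho>)"]) auto
          with elim(4) show "?P K ?Xb \<le> ennreal e" by simp
          show "real (card \<G>) * (8 * err n / \<delta>) \<le> e" using elim(1) by simp
          show "2 * \<bar>g\<bar> * \<eta> * (1 + real p * (1 + V)) / \<delta> \<le> e" using g\<eta> by (simp add: W_def)
        qed simp
        also have "\<dots> = ennreal (5 * e)" using e by (simp flip: ennreal_plus)
        finally show "?P \<delta> ?X \<le> ennreal (5 * e)" .
      qed
    qed
  qed
  have "sup_prob M ?X \<Gamma> R \<delta> \<longlonglongrightarrow> 0"
  proof (rule order_tendstoI)
    fix c :: ennreal assume "0 < c"
    then obtain c' where c': "0 < c'" "c' < c" using dense by blast
    then have fin: "c' < top" by (intro order.strict_trans2[OF _ top_greatest])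
    define e where "e = enn2real c' / 5"
    have e: "e > 0" using c' fin by (simp add: e_def enn2real_positive_iff)
    have eq: "ennreal (5 * e) = c'" using fin by (simp add: e_def)
    show "\<forall>\<^sub>F n in sequentially. sup_prob M ?X \<Gamma> R \<delta> n < c"
      using main[OF e] unfolding eq by (rule eventually_mono) (rule order.strict_trans1[OF _ c'(2)])
  qed simp
  then show ?thesis unfolding Let_def .
qed

end
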